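(* Let $K$ be a field, $R=K[c_{12},c_{13},c_{23},u_{kl}\ (1\le k,l\le3)]$, $\widetilde R=R[\tau_1,\tau_2,\tau_3,\tau_4]$, and let $\mathcal C(\psi): 0\to\widetilde R\to\widetilde R^7\to\widetilde R^{12}\to\widetilde R^7\to\widetilde R$ be the resolution of $\widetilde R/I$, $I=J\widetilde R+\langle s_1,s_2,s_3\rangle$, obtained by generic doubling of the almost complete intersection $J$ (all objects are defined in the context). Then, under the substitution $$x_1=-c_{23},\quad x_2=-c_{13},\quad x_3=-c_{12},\quad x_4=0,\quad v=-\tau_4,\qquad M\mapsto M'=\begin{bmatrix}-u_{11}&u_{12}&-u_{13}&\tau_1\\-u_{21}&u_{22}&-u_{23}&-\tau_2\\-u_{31}&u_{32}&-u_{33}&\tau_3\end{bmatrix}$$ the resolution $\mathcal C(\psi)$ is a specialization of the Kustin-Miller model, i.e. $\mathcal C(\psi)$ is isomorphic to the base change of the Kustin-Miller resolution along the $K$-algebra homomorphism $R_{KM}\to\widetilde R$ given by this substitution.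
   Context: The almost complete intersection. Let $N=\begin{bmatrix}-u_{11}&u_{12}&-u_{13}\\-u_{21}&u_{22}&-u_{23}\\-u_{31}&u_{32}&-u_{33}\end{bmatrix}$, write $N_{\mathcal K;\mathcal L}$ for the minor of $N$ on rows $\mathcal K$ and columns $\mathcal L$, and $q_i=c_{23}u_{i1}-c_{13}u_{i2}+c_{12}u_{i3}$ for $i=1,2,3$. Let $J=\langle q_1,q_2,q_3,-N_{123;123}\rangle\subset R$; this is a perfect ideal of codimension $3$ whose minimal free resolution $\mathbb F$ has format $0\to R^3\to R^6\to R^4\to R$. The canonical module $\omega_{R/J}$ is the cokernel of the $3\times6$ matrix transpose to the matrix with rows $(0,-c_{12},c_{13})$, $(c_{12},0,-c_{23})$, $(-c_{13},c_{23},0)$, $(-u_{i1},u_{i2},-u_{i3})$ for $i=1,2,3$. The doubling. Put $s_1=\tau_4c_{23}+\tau_1N_{23;23}+\tau_2N_{13;23}+\tau_3N_{12;23}$, $s_2=\tau_4c_{13}-\tau_1N_{23;13}-\tau_2N_{13;13}-\tau_3N_{12;13}$, $s_3=\tau_4c_{12}+\tau_1N_{23;12}+\tau_2N_{13;12}+\tau_3N_{12;12}$. The row $\psi_1=[s_1\ s_2\ s_3]$ induces an injective map $\omega_{\widetilde R/J\widetilde R}\to\widetilde R/J\widetilde R$; it lifts to a chain map $\psi:\widetilde{\mathbb F}^*\to\widetilde{\mathbb F}$, with $\widetilde{\mathbb F}=\mathbb F\otimes_R\widetilde R$, and $\mathcal C(\psi)$ is the mapping cone of $\psi$, a free resolution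 of $\widetilde R/I$ with entries of all differentials in the ideal generated by the variables. The Kustin-Miller model (KMM). Let $R_{KM}=K[x_1,\dots,x_4,\,a_{ij}\ (1\le i\le3,1\le j\le4),\,v]$, $M=(a_{ij})$ the $3\times4$ matrix, $q_i^{KM}=\sum_{j=1}^4a_{ij}x_j$, and $M_{123;jkl}$ the maximal minor of $M$ on columns $j,k,l$. The Kustin-Miller ideal is $$I_{KM}=\langle q^{KM}_1,q^{KM}_2,q^{KM}_3,\ x_1v+M_{123;234},\ x_2v-M_{123;134},\ x_3v+M_{123;124},\ x_4v-M_{123;123}\rangle ,$$ a Gorenstein ideal of codimension $4$, and the Kustin-Miller resolution is its minimal free resolution $0\to R_{KM}\to R_{KM}^7\to R_{KM}^{12}\to R_{KM}^7\to R_{KM}$. A specialization of it is a resolution isomorphic to its base change along a ring homomorphism out of $R_{KM}$. *)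

theory Defs
  imports
    "HOL-Library.Poly_Mapping"
    "Jordan_Normal_Form.Determinant"
    "Jordan_Normal_Form.DL_Submatrix"
begin

section \<open>Polynomial rings\<close>

text \<open>Polynomials with coefficients in \<^typ>\<open>'k\<close> whose variables are the elements of the type
  \<^typ>\<open>'v\<close>: finitely supported functions on the monomials, with the convolution product. All
  variable types used below are finite enumerations.\<close>

type_synonym ('v, 'k) mpoly = "('v \<Rightarrow>\<^sub>0 nat) \<Rightarrow>\<^sub>0 'k"

definition Const :: "'k::comm_ring_1 \<Rightarrow> ('v, 'k) mpoly" where
  "Const a = Poly_Mapping.single 0 a"

definition Var :: "'v \<Rightarrow> ('v, 'k::comm_ring_1) mpoly" where
  "Var x = Poly_Mapping.single (Poly_Mapping.single x 1) 1"

text \<open>The homomorphism of \<^typ>\<open>'k\<close>-algebras that sends each variable \<open>x\<close> to \<open>f x\<close>.\<close>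

definition subst_hom ::
    "('v \<Rightarrow> ('w, 'k::comm_ring_1) mpoly) \<Rightarrow> ('v, 'k) mpoly \<Rightarrow> ('w, 'k) mpoly" where
  "subst_hom f p =
    (\<Sum>m\<in>Poly_Mapping.keys p. Const (Poly_Mapping.lookup p m) *
       (\<Prod>x\<in>Poly_Mapping.keys m. f x ^ Poly_Mapping.lookup m x))"

definition wdeg :: "('v \<Rightarrow> nat) \<Rightarrow> ('v \<Rightarrow>\<^sub>0 nat) \<Rightarrow> nat" where
  "wdeg w m = (\<Sum>x\<in>Poly_Mapping.keys m. w x * Poly_Mapping.lookup m x)"

definition homogeneous :: "('v \<Rightarrow> nat) \<Rightarrow> int \<Rightarrow> ('v, 'k::comm_ring_1) mpoly \<Rightarrow> bool" where
  "homogeneous w n p \<longleftrightarrow> (\<forall>m\<in>Poly_Mapping.keys p. int (wdeg w m) = n)"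

abbreviation ideal_gen :: "'a::comm_ring_1 set \<Rightarrow> 'a set" where
  "ideal_gen S \<equiv> Modules.module.span (*) S"

definition irrelevant_ideal :: "('v, 'k::comm_ring_1) mpoly set" where
  "irrelevant_ideal = ideal_gen (range Var)"


section \<open>Complexes of finitely generated free modules\<close>

text \<open>The module in homological degree \<open>i\<close> is the free module of rank \<open>rk C i\<close>, whose elements are
  column vectors, and \<open>df C i\<close> is the matrix of the differential from degree \<open>i + 1\<close> to degree \<open>i\<close>.
  A complex that ends in degree \<open>n\<close> has \<open>rk C i = 0\<close> for \<open>i > n\<close>; matrices with no rows or no
  columns are legitimate.\<close>

record 'a cpx =
  rk :: "nat \<Rightarrow> nat"
  df :: "nat \<Rightarrow> 'a mat"

definition is_complex :: "'a::comm_ring_1 cpx \<Rightarrow> bool" where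
  "is_complex C \<longleftrightarrow>
    (\<forall>i. df C i \<in> carrier_mat (rk C i) (rk C (Suc i))) \<and>
    (\<forall>i. df C i * df C (Suc i) = 0\<^sub>m (rk C i) (rk C (Suc (Suc i))))"

definition mat_image :: "'a::comm_ring_1 mat \<Rightarrow> 'a vec set" where
  "mat_image A = {A *\<^sub>v x |x. x \<in> carrier_vec (dim_col A)}"

definition mat_ker :: "'a::comm_ring_1 mat \<Rightarrow> 'a vec set" where
  "mat_ker A = {x \<in> carrier_vec (dim_col A). A *\<^sub>v x = 0\<^sub>v (dim_row A)}"

text \<open>A free resolution of the quotient by the ideal \<open>I\<close>: exact in positive degrees, and the image
  of the first differential in the module of rank one is \<open>I\<close>.\<close>

definition free_resolution :: "'a::comm_ring_1 cpx \<Rightarrow> 'a set \<Rightarrow> bool" where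
  "free_resolution C I \<longleftrightarrow>
    is_complex C \<and> rk C 0 = 1 \<and>
    (\<lambda>y. y $ 0) ` mat_image (df C 0) = I \<and>
    (\<forall>i. mat_ker (df C i) = mat_image (df C (Suc i)))"

text \<open>Minimal free resolutions over a polynomial ring are graded ones: with respect to a grading of
  the ring by positive weights \<open>w\<close> of the variables, the basis elements of each module can be given
  degrees that make the differentials homogeneous of degree zero. Minimality says that the entries
  of the differentials lie in the ideal generated by the variables. Without the grading such
  resolutions would not be unique up to isomorphism.\<close>

definition graded_complex :: "('v \<Rightarrow> nat) \<Rightarrow> ('v, 'k::comm_ring_1) mpoly cpx \<Rightarrow> bool" where
  "graded_complex w C \<longleftrightarrow>
    (\<exists>b :: nat \<Rightarrow> nat \<Rightarrow> int. \<forall>i. \<forall>p<rk C i. \<forall>q<rk C (Suc i).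
       homogeneous w (b (Suc i) q - b i p) (df C i $$ (p, q)))"

definition minimal_free_resolution ::
    "('v \<Rightarrow> nat) \<Rightarrow> ('v, 'k::comm_ring_1) mpoly cpx \<Rightarrow> ('v, 'k) mpoly set \<Rightarrow> bool" where
  "minimal_free_resolution w C I \<longleftrightarrow>
    free_resolution C I \<and> graded_complex w C \<and>
    (\<forall>i. elements_mat (df C i) \<subseteq> irrelevant_ideal)"

definition format :: "nat list \<Rightarrow> nat \<Rightarrow> nat" where
  "format ns i = (if i < length ns then ns ! i else 0)"

definition base_change :: "('a \<Rightarrow> 'b) \<Rightarrow> 'a cpx \<Rightarrow> 'b cpx" where
  "base_change h C = \<lparr>rk = rk C, df = (\<lambda>i. map_mat h (df C i))\<rparr>"

text \<open>The dual of a complex concentrated in degrees \<open>0, \<dots>, n\<close>, placed in the same degrees: the dual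
  of the module of degree \<open>n - i\<close> sits in degree \<open>i\<close>.\<close>

definition dual :: "nat \<Rightarrow> 'a::comm_ring_1 cpx \<Rightarrow> 'a cpx" where
  "dual n C =
    \<lparr>rk = (\<lambda>i. if i \<le> n then rk C (n - i) else 0),
     df = (\<lambda>i. if i < n then transpose_mat (df C (n - 1 - i))
               else 0\<^sub>m (if i = n then rk C 0 else 0) 0)\<rparr>"

definition chain_map :: "'a::comm_ring_1 cpx \<Rightarrow> 'a cpx \<Rightarrow> (nat \<Rightarrow> 'a mat) \<Rightarrow> bool" where
  "chain_map C D f \<longleftrightarrow>
    (\<forall>i. f i \<in> carrier_mat (rk D i) (rk C i)) \<and>
    (\<forall>i. f i * df C i = df D i * f (Suc i))"

text \<open>The mapping cone of \<open>f\<close> from \<open>C\<close> to \<open>D\<close>: the module in degree \<open>i\<close> is the direct sum of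
  \<open>D\<close> in degree \<open>i\<close> and \<open>C\<close> in degree \<open>i - 1\<close>, with differential
  \<open>(x, y) \<mapsto> (d x + f y, - d y)\<close>.\<close>

definition cone :: "'a::comm_ring_1 cpx \<Rightarrow> 'a cpx \<Rightarrow> (nat \<Rightarrow> 'a mat) \<Rightarrow> 'a cpx" where
  "cone C D f =
    \<lparr>rk = (\<lambda>i. rk D i + (case i of 0 \<Rightarrow> 0 | Suc j \<Rightarrow> rk C j)),
     df = (\<lambda>i. four_block_mat (df D i) (f i)
       (0\<^sub>m (case i of 0 \<Rightarrow> 0 | Suc j \<Rightarrow> rk C j) (rk D (Suc i)))
       (case i of 0 \<Rightarrow> 0\<^sub>m 0 (rk C 0) | Suc j \<Rightarrow> - df C j))\<rparr>"

definition isomorphic_complexes :: "'a::comm_ring_1 cpx \<Rightarrow> 'a cpx \<Rightarrow> bool" where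
  "isomorphic_complexes C D \<longleftrightarrow>
    (\<exists>f g. chain_map C D f \<and> chain_map D C g \<and>
       (\<forall>i. g i * f i = 1\<^sub>m (rk C i) \<and> f i * g i = 1\<^sub>m (rk D i)))"

text \<open>Rows and columns are numbered from 1 here, while matrix indices start at 0.\<close>

definition minor :: "'a::comm_ring_1 mat \<Rightarrow> nat set \<Rightarrow> nat set \<Rightarrow> 'a" where
  "minor A K L = det (submatrix A {i. Suc i \<in> K} {j. Suc j \<in> L})"


section \<open>The almost complete intersection\<close>

datatype rvar = C12 | C13 | C23 | U11 | U12 | U13 | U21 | U22 | U23 | U31 | U32 | U33

definition N_mat :: "(rvar, 'k::field) mpoly mat" where
  "N_mat = mat_of_rows_list 3
    [[- Var U11, Var U12, - Var U13],
     [- Var U21, Var U22, - Var U23],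
     [- Var U31, Var U32, - Var U33]]"

definition J_ideal :: "(rvar, 'k::field) mpoly set" where
  "J_ideal = ideal_gen
    {Var C23 * Var U11 - Var C13 * Var U12 + Var C12 * Var U13,
     Var C23 * Var U21 - Var C13 * Var U22 + Var C12 * Var U23,
     Var C23 * Var U31 - Var C13 * Var U32 + Var C12 * Var U33,
     - minor N_mat {1,2,3} {1,2,3}}"

text \<open>The canonical module of the quotient by \<^const>\<open>J_ideal\<close> is the cokernel of the transpose of
  this matrix.\<close>

definition W_mat :: "(rvar, 'k::field) mpoly mat" where
  "W_mat = mat_of_rows_list 3
    [[0, - Var C12, Var C13],
     [Var C12, 0, - Var C23],
     [- Var C13, Var C23, 0],
     [- Var U11, Var U12, - Var U13],
     [- Var U21, Var U22, - Var U23],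
     [- Var U31, Var U32, - Var U33]]"


section \<open>The doubling\<close>

datatype tvar = Base rvar | T1 | T2 | T3 | T4

definition extend :: "(rvar, 'k::field) mpoly \<Rightarrow> (tvar, 'k) mpoly" where
  "extend = subst_hom (\<lambda>x. Var (Base x))"

definition s1 :: "(tvar, 'k::field) mpoly" where
  "s1 = Var T4 * extend (Var C23) + Var T1 * extend (minor N_mat {2,3} {2,3})
      + Var T2 * extend (minor N_mat {1,3} {2,3}) + Var T3 * extend (minor N_mat {1,2} {2,3})"

definition s2 :: "(tvar, 'k::field) mpoly" where
  "s2 = Var T4 * extend (Var C13) - Var T1 * extend (minor N_mat {2,3} {1,3})
      - Var T2 * extend (minor N_mat {1,3} {1,3}) - Var T3 * extend (minor N_mat {1,2} {1,3})"

definition s3 :: "(tvar, 'k::field) mpoly" where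
  "s3 = Var T4 * extend (Var C12) + Var T1 * extend (minor N_mat {2,3} {1,2})
      + Var T2 * extend (minor N_mat {1,3} {1,2}) + Var T3 * extend (minor N_mat {1,2} {1,2})"

definition psi1 :: "(tvar, 'k::field) mpoly mat" where
  "psi1 = mat_of_rows_list 3 [[s1, s2, s3]]"

definition I_ideal :: "(tvar, 'k::field) mpoly set" where
  "I_ideal = ideal_gen (extend ` J_ideal \<union> {s1, s2, s3})"


section \<open>The Kustin-Miller model\<close>

datatype kmvar = X1 | X2 | X3 | X4
  | A11 | A12 | A13 | A14 | A21 | A22 | A23 | A24 | A31 | A32 | A33 | A34 | V

definition M_mat :: "(kmvar, 'k::field) mpoly mat" where
  "M_mat = mat_of_rows_list 4
    [[Var A11, Var A12, Var A13, Var A14],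
     [Var A21, Var A22, Var A23, Var A24],
     [Var A31, Var A32, Var A33, Var A34]]"

definition KM_ideal :: "(kmvar, 'k::field) mpoly set" where
  "KM_ideal = ideal_gen
    {Var A11 * Var X1 + Var A12 * Var X2 + Var A13 * Var X3 + Var A14 * Var X4,
     Var A21 * Var X1 + Var A22 * Var X2 + Var A23 * Var X3 + Var A24 * Var X4,
     Var A31 * Var X1 + Var A32 * Var X2 + Var A33 * Var X3 + Var A34 * Var X4,
     Var X1 * Var V + minor M_mat {1,2,3} {2,3,4},
     Var X2 * Var V - minor M_mat {1,2,3} {1,3,4},
     Var X3 * Var V + minor M_mat {1,2,3} {1,2,4},
     Var X4 * Var V - minor M_mat {1,2,3} {1,2,3}}"

text \<open>The generators of \<^const>\<open>KM_ideal\<close> are homogeneous once \<open>v\<close> has degree 2 and all other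
  variables have degree 1.\<close>

definition KM_weight :: "kmvar \<Rightarrow> nat" where
  "KM_weight x = (if x = V then 2 else 1)"

primrec KM_subst :: "kmvar \<Rightarrow> (tvar, 'k::field) mpoly" where
  "KM_subst X1 = - Var (Base C23)"
| "KM_subst X2 = - Var (Base C13)"
| "KM_subst X3 = - Var (Base C12)"
| "KM_subst X4 = 0"
| "KM_subst V = - Var T4"
| "KM_subst A11 = - Var (Base U11)"
| "KM_subst A12 = Var (Base U12)"
| "KM_subst A13 = - Var (Base U13)"
| "KM_subst A14 = Var T1"
| "KM_subst A21 = - Var (Base U21)"
| "KM_subst A22 = Var (Base U22)"
| "KM_subst A23 = - Var (Base U23)"
| "KM_subst A24 = - Var T2"
| "KM_subst A31 = - Var (Base U31)"
| "KM_subst A32 = Var (Base U32)"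
| "KM_subst A33 = - Var (Base U33)"
| "KM_subst A34 = Var T3"


section \<open>Substitution is an algebra homomorphism\<close>

lemma module_mult: "Modules.module ((*) :: 'a::comm_ring_1 \<Rightarrow> _)"
  by unfold_locales (auto simp: algebra_simps)

lemma Const_add: "Const (a + b) = Const a + Const b"
  by (simp add: Const_def single_add)

lemma Const_mult: "Const (a * b) = Const a * Const b"
  by (simp add: Const_def mult_single)

lemma Const_0: "Const 0 = 0" by (simp add: Const_def)
lemma Const_1: "Const 1 = 1" by (simp add: Const_def)

definition monom_value :: "('v \<Rightarrow> 'a) \<Rightarrow> ('v \<Rightarrow>\<^sub>0 nat) \<Rightarrow> 'a::comm_ring_1" where
  "monom_value f m = (\<Prod>x\<in>Poly_Mapping.keys m. f x ^ Poly_Mapping.lookup m x)"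

lemma monom_value_superset:
  fixes f :: "'v \<Rightarrow> 'a::comm_ring_1"
  assumes "finite A" "Poly_Mapping.keys m \<subseteq> A"
  shows "monom_value f m = (\<Prod>x\<in>A. f x ^ Poly_Mapping.lookup m x)"
  unfolding monom_value_def by (rule prod.mono_neutral_left) (use assms in \<open>auto simp: in_keys_iff\<close>)

lemma monom_value_add: "monom_value f (m + n) = monom_value f m * (monom_value f n :: 'a::comm_ring_1)"
proof -
  let ?A = "Poly_Mapping.keys m \<union> Poly_Mapping.keys n"
  have "Poly_Mapping.keys (m+n) \<subseteq> ?A" by (rule Poly_Mapping.keys_add)
  then show ?thesis
    by (simp add: monom_value_superset[of ?A] lookup_add power_add prod.distrib)
qed

lemma subst_superset:
  assumes "finite A" "Poly_Mapping.keys p \<subseteq> A"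
  shows "subst_hom f p = (\<Sum>m\<in>A. Const (Poly_Mapping.lookup p m) * monom_value f m)"
  unfolding subst_hom_def monom_value_def
  by (rule sum.mono_neutral_left) (use assms in \<open>auto simp: in_keys_iff Const_0\<close>)

lemma subst_add: "subst_hom f (p + q) = subst_hom f p + subst_hom f q"
proof -
  let ?A = "Poly_Mapping.keys p \<union> Poly_Mapping.keys q"
  have "Poly_Mapping.keys (p+q) \<subseteq> ?A" by (rule Poly_Mapping.keys_add)
  then show ?thesis
    by (simp add: subst_superset[of ?A] lookup_add Const_add algebra_simps sum.distrib)
qed

lemma subst_0: "subst_hom f 0 = 0" by (simp add: subst_hom_def)

lemma subst_sum: "subst_hom f (sum g A) = (\<Sum>a\<in>A. subst_hom f (g a))"
  by (induction A rule: infinite_finite_induct) (simp_all add: subst_0 subst_add)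

lemma subst_single: "subst_hom f (Poly_Mapping.single m a) = Const a * monom_value f m"
  using subst_superset[of "{m}" "Poly_Mapping.single m a" f] by auto

lemma poly_sum_single: "p = (\<Sum>m\<in>Poly_Mapping.keys p. Poly_Mapping.single m (Poly_Mapping.lookup p m))"
proof (rule poly_mapping_eqI)
  fix k
  have "Poly_Mapping.lookup (\<Sum>m\<in>Poly_Mapping.keys p. Poly_Mapping.single m (Poly_Mapping.lookup p m)) k
    = (\<Sum>m\<in>Poly_Mapping.keys p. if m = k then Poly_Mapping.lookup p m else 0)"
    by (simp add: lookup_sum lookup_single when_def)
  also have "\<dots> = Poly_Mapping.lookup p k" by (simp add: sum.delta in_keys_iff)
  finally show "Poly_Mapping.lookup p k = Poly_Mapping.lookup (\<Sum>m\<in>Poly_Mapping.keys p. Poly_Mapping.single m (Poly_Mapping.lookup p m)) k" by simp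
qed

lemma subst_mult: "subst_hom f (p * q) = subst_hom f p * subst_hom f q"
proof -
  let ?s = "\<lambda>p m. Poly_Mapping.single m (Poly_Mapping.lookup p m)"
  have "p * q = (\<Sum>m\<in>Poly_Mapping.keys p. \<Sum>n\<in>Poly_Mapping.keys q. ?s p m * ?s q n)"
    by (subst poly_sum_single[of p], subst poly_sum_single[of q], rule sum_product)
  then have "subst_hom f (p * q) =
     (\<Sum>m\<in>Poly_Mapping.keys p. \<Sum>n\<in>Poly_Mapping.keys q. subst_hom f (?s p m) * subst_hom f (?s q n))"
    by (simp add: subst_sum mult_single subst_single monom_value_add Const_mult mult_ac)
  also have "\<dots> = (\<Sum>m\<in>Poly_Mapping.keys p. subst_hom f (?s p m)) * (\<Sum>n\<in>Poly_Mapping.keys q. subst_hom f (?s q n))"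
    by (rule sum_product[symmetric])
  also have "\<dots> = subst_hom f p * subst_hom f q"
    unfolding subst_sum[symmetric] poly_sum_single[symmetric] ..
  finally show ?thesis .
qed

lemma subst_Var: "subst_hom f (Var x) = f x"
  by (simp add: Var_def subst_single Const_1 monom_value_def)
lemma subst_Const: "subst_hom f (Const x) = Const x"
  by (simp add: Const_def subst_single[unfolded Const_def] monom_value_def)


section \<open>The cokernel of the first differential of the mapping cone\<close>

lemma row_image:
  fixes A :: "'a::comm_ring_1 mat"
  assumes "dim_row A = 1" "dim_col A = n"
  shows "(\<lambda>y. y $ 0) ` mat_image A = {(\<Sum>j<n. A $$ (0,j) * a j) | a. True}"
proof (intro equalityI subsetI)
  fix z assume "z \<in> (\<lambda>y. y $ 0) ` mat_image A"
  then obtain x where "x \<in> carrier_vec n" "z = (A *\<^sub>v x) $ 0" using assms by (auto simp: mat_image_def)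
  then show "z \<in> {(\<Sum>j<n. A $$ (0,j) * a j) | a. True}"
    using assms by (intro CollectI exI[of _ "\<lambda>j. x $ j"]) (auto simp: scalar_prod_def atLeast0LessThan)
next
  fix z assume "z \<in> {(\<Sum>j<n. A $$ (0,j) * a j) | a. True}"
  then obtain a where "z = (\<Sum>j<n. A $$ (0,j) * a j)" by blast
  then have "z = (A *\<^sub>v vec n a) $ 0" using assms by (auto simp: scalar_prod_def atLeast0LessThan)
  moreover have "A *\<^sub>v vec n a \<in> mat_image A" using assms by (auto simp: mat_image_def)
  ultimately show "z \<in> (\<lambda>y. y $ 0) ` mat_image A" by blast
qed

text \<open>The mapping cone of a lift of \<^const>\<open>psi1\<close> has as zeroth homology the quotient by \<^const>\<open>I_ideal\<close>.\<close>

lemma cone_H0: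
  fixes F :: "(rvar, 'k::field) mpoly cpx"
  assumes F: "is_complex F" "rk F 0 = 1" "rk F 3 = 3" and J: "(\<lambda>y. y $ 0) ` mat_image (df F 0) = J_ideal"
   and psi: "chain_map (dual 3 (base_change extend F)) (base_change extend F) \<psi>" "\<psi> 0 = psi1"
  shows "(\<lambda>y. y $ 0) ` mat_image (df (cone (dual 3 (base_change extend F)) (base_change extend F) \<psi>) 0) = I_ideal"
proof -
  let ?n = "rk F 1" and ?d = "df F 0"
  have d: "?d \<in> carrier_mat 1 ?n" using F unfolding is_complex_def by (metis One_nat_def)
  define e where "e j = extend (?d $$ (0,j))" for j
  define s where "s j = (if j = 0 then s1 else if j = (1::nat) then s2 else (s3 :: (tvar,'k) mpoly))" for j
  let ?D = "df (cone (dual 3 (base_change extend F)) (base_change extend F) \<psi>) 0"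
  have dimD: "dim_row ?D = 1" "dim_col ?D = ?n + 3"
    using d F psi by (auto simp: cone_def base_change_def dual_def psi1_def mat_of_rows_list_def)
  have ent: "?D $$ (0,j) = (if j < ?n then e j else s (j - ?n))" if "j < ?n + 3" for j
    using d F psi that
    by (auto simp: cone_def base_change_def dual_def psi1_def mat_of_rows_list_def e_def s_def nth_Cons split: nat.splits)
  have J': "J_ideal = {(\<Sum>j<?n. ?d $$ (0,j) * a j) | a. True}"
    using row_image[of ?d ?n] d J by simp
  interpret m: Modules.module "(*) :: (tvar,'k) mpoly \<Rightarrow> _" by (rule module_mult)
  have sub: "m.subspace I_ideal" unfolding I_ideal_def by (rule m.subspace_span)
  have sc: "x * c \<in> I_ideal" if "x \<in> I_ideal" for x c :: "(tvar, 'k) mpoly"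
    using m.subspace_scale[OF sub that, of c] by (simp add: mult.commute)
  have eI: "e j \<in> I_ideal" if "j < ?n" for j
  proof -
    have "?d $$ (0,j) \<in> J_ideal" unfolding J'
      using that by (intro CollectI exI[of _ "\<lambda>i. if i = j then 1 else 0"]) (simp add: if_distrib cong: if_cong)
    then show ?thesis unfolding I_ideal_def e_def by (intro m.span_base) auto
  qed
  have sI: "s j \<in> I_ideal" for j unfolding I_ideal_def s_def by (intro m.span_base) auto
  have im: "(\<lambda>y. y $ 0) ` mat_image ?D = {(\<Sum>j<?n+3. ?D $$ (0,j) * a j) | a. True}" (is "_ = ?S")
    by (rule row_image) (use dimD in auto)
  have "?S \<subseteq> I_ideal"
  proof safe
    fix a :: "nat \<Rightarrow> (tvar,'k) mpoly"
    show "(\<Sum>j<?n+3. ?D $$ (0,j) * a j) \<in> I_ideal"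
    proof (rule m.subspace_sum[OF sub])
      fix j assume "j \<in> {..<?n + 3}"
      then have "?D $$ (0,j) = (if j < ?n then e j else s (j - ?n))" by (intro ent) simp
      then have "?D $$ (0,j) \<in> I_ideal" using eI[of j] sI[of "j - ?n"] by simp
      then show "?D $$ (0,j) * a j \<in> I_ideal" by (rule sc)
    qed
  qed
  moreover have "I_ideal \<subseteq> ?S"
    unfolding I_ideal_def
  proof (rule m.span_minimal)
    show "m.subspace ?S"
    proof (rule m.subspaceI)
      show "0 \<in> ?S"
        by (intro CollectI exI[of _ "\<lambda>_. 0"]) simp
    next
      fix x y assume "x \<in> ?S" "y \<in> ?S"
      then obtain a b where "x = (\<Sum>j<?n+3. ?D $$ (0,j) * a j)" "y = (\<Sum>j<?n+3. ?D $$ (0,j) * b j)"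
        by (elim CollectE exE conjE) (rule that)
      then have "x + y = (\<Sum>j<?n+3. ?D $$ (0,j) * (a j + b j))"
        by (simp only: distrib_left sum.distrib)
      then show "x + y \<in> ?S" by (intro CollectI exI[of _ "\<lambda>j. a j + b j"]) simp
    next
      fix c x assume "x \<in> ?S"
      then obtain a where "x = (\<Sum>j<?n+3. ?D $$ (0,j) * a j)"
        by (elim CollectE exE conjE) (rule that)
      then have "c * x = (\<Sum>j<?n+3. ?D $$ (0,j) * (c * a j))"
        by (simp only: sum_distrib_left mult.left_commute)
      then show "c * x \<in> ?S" by (intro CollectI exI[of _ "\<lambda>j. c * a j"]) simp
    qed
    have e1: "extend g \<in> ?S" if gJ: "g \<in> J_ideal" for g
    proof -
      from gJ obtain a where a: "g = (\<Sum>j<?n. ?d $$ (0,j) * a j)" unfolding J' by blast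
      have "(\<Sum>j<?n+3. ?D $$ (0,j) * (if j < ?n then extend (a j) else 0)) = (\<Sum>j<?n. ?D $$ (0,j) * extend (a j))"
        by (rule sum.mono_neutral_cong_right) auto
      also have "\<dots> = (\<Sum>j<?n. e j * extend (a j))"
        by (rule sum.cong) (auto simp: ent)
      also have "\<dots> = extend g" unfolding a e_def
        by (simp add: extend_def subst_sum subst_mult)
      finally show ?thesis by (intro CollectI exI[of _ "\<lambda>j. if j < ?n then extend (a j) else 0"]) simp
    qed
    have e2: "s i \<in> ?S" if "i < 3" for i
    proof -
      have "(\<Sum>j<?n+3. ?D $$ (0,j) * (if j = ?n + i then 1 else 0))
          = (\<Sum>j\<in>{?n + i}. ?D $$ (0,j) * (if j = ?n + i then 1 else 0))"
        by (rule sum.mono_neutral_right) (use that in auto)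
      also have "\<dots> = s i" using ent[of "?n + i"] that by simp
      finally show ?thesis by (intro CollectI exI[of _ "\<lambda>j. if j = ?n + i then 1 else 0"]) simp
    qed
    have "s1 \<in> ?S" "s2 \<in> ?S" "s3 \<in> ?S" using e2[of 0, unfolded s_def] e2[of 1, unfolded s_def] e2[of 2, unfolded s_def]
      by simp_all
    then show "extend ` J_ideal \<union> {s1, s2, s3} \<subseteq> ?S" using e1 by blast
  qed
  ultimately show ?thesis using im by blast
qed

end

theory Submission
  imports Defs "HOL-Library.Countable"
begin

text \<open>The substitution kills \<open>x\<^sub>4\<close> and maps the other variables of the Kustin-Miller ring bijectively, up to
  sign, to those of the target ring, which is thus the quotient by \<open>x\<^sub>4\<close>; the Kustin-Miller generators go to
  the generators of \<open>I\<close>. The base change of the Kustin-Miller resolution stays exact because \<open>x\<^sub>4\<close> is a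
  nonzerodivisor modulo the Kustin-Miller ideal: every syzygy of the generators of \<open>I\<close> lifts to a syzygy
  of the Kustin-Miller generators.

  The mapping cone is exact because \<open>F\<close> stays exact over \<open>R[\<tau>]\<close>, its dual is exact (\<open>J\<close> contains the regular
  sequence \<open>q\<^sub>1, q\<^sub>2, q\<^sub>3\<close>, so that \<open>Ext\<^sup>i(R/J, R) = 0\<close> for \<open>i < 3\<close>), and \<open>\<psi>\<^sub>1\<close> is injective on the canonical module. For the
  injectivity one looks at the leading coefficient in \<open>\<tau>\<^sub>4\<close>, where \<open>\<psi>\<^sub>1\<close> is the row \<open>c\<close>.

  Two graded exact complexes that resolve the same ideal, have the same ranks and one of which is
  minimal are isomorphic. This applies to the cone of the homogeneous part of \<open>\<psi>\<close>, which is homotopic to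
  \<open>\<psi>\<close> and hence has an isomorphic cone.\<close>

section \<open>Finitely generated ideals\<close>

text \<open>The complexes \<open>F\<close> and \<open>G\<close> and the lift \<open>\<psi>\<close>
  are known only through their properties, so no isomorphism can be written down in matrices; it has
  to come from uniqueness, and uniqueness needs one grading for both sides. \<open>T4\<close> gets
  weight 2 because it is, up to sign, the image of \<open>V\<close>; then \<open>s1\<close>,
  \<open>s2\<close>, \<open>s3\<close> are cubics. Whether \<open>psi1\<close> preserves degrees
  also depends on the degrees of the three basis elements of \<open>F\<close> in degree 3. These are
  not given and must be shown equal, which is where the presentation by \<open>W_mat\<close> enters
  a second time.

  One computation carries both halves: if \<open>s1 b1 + s2 b2 + s3 b3\<close> lies in
  \<open>J\<close>, then \<open>(b1, b2, b3)\<close> is in the image of the transpose of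
  \<open>W_mat\<close>. It is the injectivity of \<open>psi1\<close>, and it also lists the syzygies
  that have to be lifted to the Kustin-Miller generators.

  Regularity is proved without dimension theory: variables are set to zero and top components for a
  weight supported on one variable are compared, until only nonzero elements of a domain
  remain.\<close>

lemmas ideal_gen_base = module.span_base[OF module_mult]
  and ideal_gen_zero = module.span_zero[OF module_mult]
  and ideal_gen_add = module.span_add[OF module_mult]
  and ideal_gen_diff = module.span_diff[OF module_mult]
  and ideal_gen_neg = module.span_neg[OF module_mult]
  and ideal_gen_mult = module.span_scale[OF module_mult]
  and ideal_gen_induct = module.span_induct_alt[OF module_mult, consumes 1, case_names base step]

lemma ideal_gen_mult_right: "x \<in> ideal_gen S \<Longrightarrow> x * c \<in> ideal_gen S"
  using ideal_gen_mult[of x S c] by (simp only: mult.commute)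

lemma ideal_gen_insertE:
  assumes "x \<in> ideal_gen (insert a S)" obtains b y where "x = y + a * b" "y \<in> ideal_gen S"
proof -
  obtain b where "x - b * a \<in> ideal_gen S"
    using assms unfolding module.span_insert[OF module_mult] by blast
  then show ?thesis by (rule that[rotated]) (simp add: mult.commute)
qed

lemma ideal_gen_emptyE: assumes "x \<in> ideal_gen {}" obtains "x = 0"
  using assms unfolding module.span_empty[OF module_mult] by blast

lemma ideal_gen_3E:
  assumes "x \<in> ideal_gen {g1, g2, g3}" obtains a1 a2 a3 where "x = g1 * a1 + g2 * a2 + g3 * a3"
proof -
  from assms obtain a1 y1 where 1: "x = y1 + g1 * a1" "y1 \<in> ideal_gen {g2, g3}" by (rule ideal_gen_insertE)
  from 1(2) obtain a2 y2 where 2: "y1 = y2 + g2 * a2" "y2 \<in> ideal_gen {g3}" by (rule ideal_gen_insertE)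
  from 2(2) obtain a3 y3 where 3: "y2 = y3 + g3 * a3" "y3 \<in> ideal_gen {}" by (rule ideal_gen_insertE)
  from 3(2) have "y3 = 0" by (rule ideal_gen_emptyE)
  then show ?thesis by (intro that[of a1 a2 a3]) (simp add: 1 2 3 add.commute)
qed

section \<open>Polynomials\<close>

lemma ex_in_keys: "m \<noteq> 0 \<Longrightarrow> \<exists>x. x \<in> Poly_Mapping.keys m"
  by (metis poly_mapping_eqI in_keys_iff lookup_zero)

lemma mpoly_sum_induct [case_names single add]:
  fixes p :: "('v, 'k::comm_ring_1) mpoly"
  assumes single: "\<And>m a. P (Poly_Mapping.single m a)"
    and add: "\<And>p q. P p \<Longrightarrow> P q \<Longrightarrow> P (p + q)"
  shows "P p"
proof -
  have 0: "P 0" using single[of 0 0] by simp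
  have "P (\<Sum>m\<in>A. Poly_Mapping.single m (Poly_Mapping.lookup p m))" if "finite A" for A
    using that by (induction A rule: finite_induct) (auto intro: 0 single add)
  then show ?thesis by (subst poly_sum_single) simp
qed

lemma monom_value_Var: "monom_value Var m = (Poly_Mapping.single m 1 :: ('v, 'k::comm_ring_1) mpoly)"
proof -
  have pow: "(Var x :: ('v,'k) mpoly) ^ n = Poly_Mapping.single (Poly_Mapping.single x n) 1" for x n
    by (induction n) (simp_all add: Var_def mult_single single_add[symmetric])
  have prod: "(\<Prod>x\<in>A. Poly_Mapping.single (g x) (1::'k)) = Poly_Mapping.single (sum g A) 1"
    for A and g :: "'v \<Rightarrow> 'v \<Rightarrow>\<^sub>0 nat"
    by (induction A rule: infinite_finite_induct) (simp_all add: mult_single)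
  have "m = (\<Sum>x\<in>Poly_Mapping.keys m. Poly_Mapping.single x (Poly_Mapping.lookup m x))"
    by (rule poly_mapping_eqI) (auto simp: lookup_sum lookup_single when_def sum.delta in_keys_iff)
  then show ?thesis unfolding monom_value_def pow prod by simp
qed

lemma subst_hom_id: "subst_hom Var p = p"
  by (induction p rule: mpoly_sum_induct)
    (simp_all add: subst_add subst_single monom_value_Var Const_def mult_single)

lemma mpoly_ring_induct [case_names Const Var add mult]:
  fixes p :: "('v, 'k::comm_ring_1) mpoly"
  assumes Const: "\<And>c. P (Const c)" and Var: "\<And>x. P (Var x)"
    and add: "\<And>p q. P p \<Longrightarrow> P q \<Longrightarrow> P (p + q)" and mult: "\<And>p q. P p \<Longrightarrow> P q \<Longrightarrow> P (p * q)"
  shows "P p"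
proof (induction p rule: mpoly_sum_induct)
  case (single m a)
  have 1: "P 1" using Const[of 1] by (simp add: Const_1)
  have pow: "P (Var x ^ n)" for x n by (induction n) (auto intro: 1 Var mult)
  have "P (\<Prod>x\<in>A. Var x ^ Poly_Mapping.lookup m x)" for A
    by (induction A rule: infinite_finite_induct) (auto intro: 1 pow mult)
  then have "P (Const a * monom_value Var m)" unfolding monom_value_def by (intro mult Const)
  then show ?case by (simp add: monom_value_Var Const_def mult_single)
qed (rule add)

lemma comm_ring_hom_subst_hom:
  "comm_ring_hom (subst_hom f :: ('v, 'k::comm_ring_1) mpoly \<Rightarrow> ('w, 'k) mpoly)"
  by unfold_locales (simp_all add: subst_add subst_mult subst_0 subst_Const[of f 1, unfolded Const_1])

lemma subst_1: "subst_hom f 1 = 1"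
  using subst_Const[of f 1] by (simp add: Const_1)

lemma subst_uminus: "subst_hom f (- p) = - subst_hom f p"
proof -
  have "subst_hom f (- p) + subst_hom f p = 0" by (simp add: subst_add[symmetric] subst_0)
  then show ?thesis by (simp add: eq_neg_iff_add_eq_0)
qed

lemma subst_diff: "subst_hom f (p - q) = subst_hom f p - subst_hom f q"
  using subst_add[of f p "- q"] by (simp add: subst_uminus)

lemmas subst_simps = subst_add subst_diff subst_uminus subst_mult subst_0 subst_1 subst_Var subst_Const

lemma subst_subst: "subst_hom f (subst_hom g p) = subst_hom (\<lambda>x. subst_hom f (g x)) p"
  by (induction p rule: mpoly_ring_induct) (simp_all add: subst_simps)

subsection \<open>Setting a variable to zero\<close>

text \<open>Setting \<open>x\<close> to zero is kept as an endomorphism of the ring, not as a map to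
  a ring with fewer variables: then \<open>p\<close> and \<open>kill x p\<close> can be compared,
  and the image is a complement of the ideal generated by \<open>x\<close>.\<close>

definition kill :: "'v \<Rightarrow> ('v, 'k::comm_ring_1) mpoly \<Rightarrow> ('v, 'k) mpoly" where
  "kill x = subst_hom (\<lambda>y. if y = x then 0 else Var y)"

lemma kill_simps [simp]:
  "kill x (p + q) = kill x p + kill x q" "kill x (p - q) = kill x p - kill x q"
  "kill x (- p) = - kill x p" "kill x (p * q) = kill x p * kill x q"
  "kill x 0 = 0" "kill x 1 = 1" "kill x (Var y) = (if y = x then 0 else Var y)"
  by (simp_all add: kill_def subst_simps)

lemma kill_split:
  obtains q where "p = kill x p + Var x * q"
proof -
  have "\<exists>q. p = kill x p + Var x * q"
  proof (induction p rule: mpoly_ring_induct)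
    case (Const c)
    show ?case by (rule exI[of _ 0]) (simp add: kill_def subst_simps)
  next
    case (Var y)
    show ?case by (rule exI[of _ "if y = x then 1 else 0"]) simp
  next
    case (add p q)
    then obtain a b where "p = kill x p + Var x * a" "q = kill x q + Var x * b" by blast
    moreover have "p + q = (p' + v * a) + (q' + v * b) \<Longrightarrow> p + q = p' + q' + v * (a + b)"
      for p' q' v :: "('a, 'b) mpoly" by (simp add: algebra_simps)
    ultimately have "p + q = kill x (p + q) + Var x * (a + b)" unfolding kill_simps by metis
    then show ?case by blast
  next
    case (mult p q)
    then obtain a b where "p = kill x p + Var x * a" "q = kill x q + Var x * b" by blast
    moreover have "p * q = (p' + v * a) * (q' + v * b) \<Longrightarrow>
        p * q = p' * q' + v * (a * q' + p' * b + v * a * b)" for p' q' v :: "('a, 'b) mpoly"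
      by (simp add: algebra_simps)
    ultimately have "p * q = kill x (p * q) + Var x * (a * kill x q + kill x p * b + Var x * a * b)"
      unfolding kill_simps by metis
    then show ?case by blast
  qed
  then show ?thesis using that by blast
qed

lemma kill_eq_0E:
  assumes "kill x p = 0" obtains q where "p = Var x * q"
  using kill_split[of p x] assms by auto

text \<open>Multiplication by a variable shifts the coefficients along an injection of monomials, so
  this holds over every coefficient ring.\<close>

lemma Var_mult_eq_0:
  fixes p :: "('v, 'k::comm_ring_1) mpoly"
  assumes "Var x * p = 0" shows "p = 0"
proof -
  have *: "Poly_Mapping.lookup (Var x * p) (Poly_Mapping.single x 1 + n) = Poly_Mapping.lookup p n" for n
    by (induction p rule: mpoly_sum_induct)
      (simp_all add: Var_def mult_single lookup_single when_def distrib_left lookup_add)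
  show ?thesis by (rule poly_mapping_eqI) (simp add: *[symmetric] assms)
qed

lemma Var_mult_cancel: "Var x * p = Var x * (q :: ('v, 'k::comm_ring_1) mpoly) \<Longrightarrow> p = q"
  using Var_mult_eq_0[of x "p - q"] by (simp add: right_diff_distrib)

subsection \<open>Homogeneous components\<close>

lemma wdeg_superset:
  assumes "finite A" "Poly_Mapping.keys m \<subseteq> A"
  shows "wdeg w m = (\<Sum>x\<in>A. w x * Poly_Mapping.lookup m x)"
  unfolding wdeg_def by (rule sum.mono_neutral_left) (use assms in \<open>auto simp: in_keys_iff\<close>)

lemma wdeg_add: "wdeg w (m + n) = wdeg w m + wdeg w n"
proof -
  let ?A = "Poly_Mapping.keys m \<union> Poly_Mapping.keys n"
  have "Poly_Mapping.keys (m + n) \<subseteq> ?A" by (rule Poly_Mapping.keys_add)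
  then show ?thesis by (simp add: wdeg_superset[of ?A] lookup_add algebra_simps sum.distrib)
qed

lemma wdeg_0 [simp]: "wdeg w 0 = 0" by (simp add: wdeg_def)

lemma wdeg_single [simp]: "wdeg w (Poly_Mapping.single x k) = w x * k"
  by (simp add: wdeg_def)

text \<open>The degree is an integer because it will be a difference of degrees of basis elements;
  in negative degrees the component is 0.\<close>

lift_definition hcomp :: "('v \<Rightarrow> nat) \<Rightarrow> int \<Rightarrow> ('v, 'k::comm_ring_1) mpoly \<Rightarrow> ('v, 'k) mpoly"
  is "\<lambda>w n p m. if int (wdeg w m) = n then p m else 0"
  by (rule finite_subset) auto

lemma lookup_hcomp:
  "Poly_Mapping.lookup (hcomp w n p) m = (if int (wdeg w m) = n then Poly_Mapping.lookup p m else 0)"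
  by transfer simp

lemma hcomp_add: "hcomp w n (p + q) = hcomp w n p + hcomp w n q"
  by (rule poly_mapping_eqI) (simp add: lookup_hcomp lookup_add)

lemma hcomp_0: "hcomp w n 0 = 0"
  by (rule poly_mapping_eqI) (simp add: lookup_hcomp)

lemma hcomp_uminus: "hcomp w n (- p) = - hcomp w n p"
  by (rule poly_mapping_eqI) (simp add: lookup_hcomp)

lemma hcomp_diff: "hcomp w n (p - q) = hcomp w n p - hcomp w n q"
  by (rule poly_mapping_eqI) (simp add: lookup_hcomp lookup_minus)

lemma hcomp_sum: "hcomp w n (sum g A) = (\<Sum>a\<in>A. hcomp w n (g a))"
  by (induction A rule: infinite_finite_induct) (simp_all add: hcomp_0 hcomp_add)

lemma hcomp_single: "hcomp w n (Poly_Mapping.single m a) =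
    (if int (wdeg w m) = n then Poly_Mapping.single m a else 0)"
  by (rule poly_mapping_eqI) (auto simp: lookup_hcomp lookup_single when_def)

lemma homogeneous_iff_hcomp: "homogeneous w n p \<longleftrightarrow> hcomp w n p = p"
  unfolding homogeneous_def poly_mapping_eq_iff fun_eq_iff by (auto simp: lookup_hcomp in_keys_iff)

lemma hcomp_homogeneous: "homogeneous w n p \<Longrightarrow> hcomp w n p = p"
  by (simp add: homogeneous_iff_hcomp)

lemma hcomp_other: "homogeneous w n p \<Longrightarrow> k \<noteq> n \<Longrightarrow> hcomp w k p = 0"
  by (rule poly_mapping_eqI) (auto simp: homogeneous_def lookup_hcomp in_keys_iff)

lemma homogeneous_hcomp: "homogeneous w n (hcomp w n p)"
  by (auto simp: homogeneous_def in_keys_iff lookup_hcomp split: if_splits)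

lemma homogeneous_0: "homogeneous w n 0"
  by (simp add: homogeneous_def)

lemma homogeneous_add: "homogeneous w n p \<Longrightarrow> homogeneous w n q \<Longrightarrow> homogeneous w n (p + q)"
  by (simp add: homogeneous_iff_hcomp hcomp_add)

lemma homogeneous_uminus: "homogeneous w n p \<Longrightarrow> homogeneous w n (- p)"
  by (simp add: homogeneous_iff_hcomp hcomp_uminus)

lemma homogeneous_diff: "homogeneous w n p \<Longrightarrow> homogeneous w n q \<Longrightarrow> homogeneous w n (p - q)"
  by (simp add: homogeneous_iff_hcomp hcomp_diff)

lemma homogeneous_sum: "(\<And>a. a \<in> A \<Longrightarrow> homogeneous w n (g a)) \<Longrightarrow> homogeneous w n (sum g A)"
  by (simp add: homogeneous_iff_hcomp hcomp_sum)

lemma homogeneous_Var: "int (w x) = n \<Longrightarrow> homogeneous w n (Var x)"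
  by (simp add: homogeneous_iff_hcomp Var_def hcomp_single)

lemma homogeneous_Const: "homogeneous w 0 (Const c)"
  by (simp add: homogeneous_iff_hcomp Const_def hcomp_single)

lemma homogeneous_mult:
  assumes "homogeneous w n p" "homogeneous w k q" shows "homogeneous w (n + k) (p * q)"
proof (unfold homogeneous_def, intro ballI)
  fix m assume "m \<in> Poly_Mapping.keys (p * q)"
  then obtain a b where "a \<in> Poly_Mapping.keys p" "b \<in> Poly_Mapping.keys q" "m = a + b"
    using Poly_Mapping.keys_mult[of p q] by auto
  then show "int (wdeg w m) = n + k" using assms by (auto simp: homogeneous_def wdeg_add)
qed

lemma homogeneous_prod:
  "(\<And>a. a \<in> A \<Longrightarrow> homogeneous w (d a) (g a)) \<Longrightarrow> homogeneous w (sum d A) (prod g A)"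
proof (induction A rule: infinite_finite_induct)
  case (insert x A)
  then show ?case by (simp add: homogeneous_mult)
qed (simp_all add: homogeneous_Const[of _ 1, unfolded Const_1])

lemma hcomp_mult:
  assumes "homogeneous w k a" shows "hcomp w (n + k) (a * p) = a * hcomp w n p"
proof (induction p rule: mpoly_sum_induct)
  case (single m c)
  have h: "homogeneous w (int (wdeg w m)) (Poly_Mapping.single m c)"
    by (simp add: homogeneous_iff_hcomp hcomp_single)
  have "homogeneous w (int (wdeg w m) + k) (a * Poly_Mapping.single m c)"
    using homogeneous_mult[OF assms h] by (simp add: add.commute)
  then show ?case
    by (cases "int (wdeg w m) = n") (simp_all add: hcomp_single hcomp_homogeneous hcomp_other)
qed (simp add: distrib_left hcomp_add)

lemma hcomp_mult': "homogeneous w k a \<Longrightarrow> hcomp w n (a * p) = a * hcomp w (n - k) p"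
  using hcomp_mult[of w k a "n - k" p] by simp

lemma hcomp_mult_right: "homogeneous w k a \<Longrightarrow> hcomp w n (p * a) = hcomp w (n - k) p * a"
  using hcomp_mult'[of w k a n p] by (simp add: mult.commute)

lemma hcomp_bounded: obtains N where "\<And>n. n > N \<Longrightarrow> hcomp w (int n) p = 0"
proof -
  let ?D = "wdeg w ` Poly_Mapping.keys p"
  have "hcomp w (int n) p = 0" if "n > Max (insert 0 ?D)" for n
  proof (rule poly_mapping_eqI)
    fix m
    have "m \<notin> Poly_Mapping.keys p" if "wdeg w m = n"
      using that \<open>n > Max (insert 0 ?D)\<close> by (auto simp: not_less[symmetric])
    then show "Poly_Mapping.lookup (hcomp w (int n) p) m = Poly_Mapping.lookup 0 m"
      by (auto simp: lookup_hcomp in_keys_iff)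
  qed
  then show ?thesis by (rule that)
qed

lemma homogeneous_subst_hom:
  assumes f: "\<And>x. homogeneous w' (int (w x)) (f x)" and p: "homogeneous w n p"
  shows "homogeneous w' n (subst_hom f p)"
  unfolding subst_hom_def
proof (rule homogeneous_sum)
  fix m assume m: "m \<in> Poly_Mapping.keys p"
  have pow: "homogeneous w' (int (w x * k)) (f x ^ k)" for x k
  proof (induction k)
    case 0
    show ?case using homogeneous_Const[of w' 1] by (simp add: Const_1)
  next
    case (Suc k)
    then show ?case using homogeneous_mult[OF f[of x] Suc] by (simp add: algebra_simps)
  qed
  have "homogeneous w' (\<Sum>x\<in>Poly_Mapping.keys m. int (w x * Poly_Mapping.lookup m x))
      (\<Prod>x\<in>Poly_Mapping.keys m. f x ^ Poly_Mapping.lookup m x)"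
    by (rule homogeneous_prod) (rule pow)
  moreover have "(\<Sum>x\<in>Poly_Mapping.keys m. int (w x * Poly_Mapping.lookup m x)) = n"
    using p m by (simp add: homogeneous_def wdeg_def)
  ultimately show "homogeneous w' n (Const (Poly_Mapping.lookup p m) *
      (\<Prod>x\<in>Poly_Mapping.keys m. f x ^ Poly_Mapping.lookup m x))"
    using homogeneous_mult[OF homogeneous_Const] by fastforce
qed

subsection \<open>Constant terms\<close>

abbreviation const_part :: "('v, 'k::comm_ring_1) mpoly \<Rightarrow> ('v, 'k) mpoly" where
  "const_part \<equiv> subst_hom (\<lambda>_. 0)"

lemma const_part_eq:
  fixes p :: "('v, 'k::comm_ring_1) mpoly"
  shows "const_part p = Const (Poly_Mapping.lookup p 0)"
proof (induction p rule: mpoly_sum_induct)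
  case (single m a)
  show ?case
  proof (cases "m = 0")
    case True
    then show ?thesis by (simp add: subst_single monom_value_def)
  next
    case False
    then obtain x where "x \<in> Poly_Mapping.keys m" using ex_in_keys by blast
    then have "monom_value (\<lambda>_. 0 :: ('v, 'k) mpoly) m = 0"
      unfolding monom_value_def by (intro prod_zero bexI[of _ x]) (auto simp: in_keys_iff zero_power)
    then show ?thesis using False by (simp add: subst_single lookup_single when_def Const_0)
  qed
qed (simp add: subst_add lookup_add Const_add)

lemma const_part_irrelevant: "p \<in> irrelevant_ideal \<Longrightarrow> const_part p = 0"
  unfolding irrelevant_ideal_def
  by (erule ideal_gen_induct)
    (auto simp: subst_simps)

text \<open>With positive weights the only monomial of degree 0 is trivial, so a homogeneous
  polynomial with nonzero constant term is a constant. This turns invertibility modulo the variables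
  into invertibility.\<close>

lemma homogeneous_unit:
  fixes p :: "('v, 'k::field) mpoly"
  assumes "homogeneous w n p" "\<And>x. w x > 0" "const_part p \<noteq> 0"
  obtains u where "p * u = 1"
proof -
  have c: "Poly_Mapping.lookup p 0 \<noteq> 0" using assms(3) by (auto simp: const_part_eq Const_0)
  then have "0 \<in> Poly_Mapping.keys p" by (simp add: in_keys_iff)
  then have n: "n = 0" using assms(1) by (auto simp: homogeneous_def)
  have "p = Const (Poly_Mapping.lookup p 0)"
  proof (rule poly_mapping_eqI)
    fix m
    have "m = 0" if "m \<in> Poly_Mapping.keys p"
    proof (rule ccontr)
      assume "m \<noteq> 0"
      then obtain x where x: "x \<in> Poly_Mapping.keys m" using ex_in_keys by blast
      have "wdeg w m = 0" using that assms(1) n by (auto simp: homogeneous_def)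
      then have "w x * Poly_Mapping.lookup m x = 0" using x by (simp add: wdeg_def)
      then show False using x assms(2)[of x] by (simp add: in_keys_iff)
    qed
    then show "Poly_Mapping.lookup p m = Poly_Mapping.lookup (Const (Poly_Mapping.lookup p 0)) m"
      by (auto simp: Const_def lookup_single when_def in_keys_iff)
  qed
  then have "p * Const (inverse (Poly_Mapping.lookup p 0)) = 1"
    using c by (metis Const_mult Const_1 right_inverse)
  then show ?thesis by (rule that)
qed

section \<open>Complexes of free modules\<close>

lemma minus_zero_mat: "A \<in> carrier_mat n m \<Longrightarrow> A - 0\<^sub>m n m = (A :: 'a::comm_ring_1 mat)"
  by (intro eq_matI) auto

lemma uminus_zero_mat: "- 0\<^sub>m n m = (0\<^sub>m n m :: 'a::comm_ring_1 mat)"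
  by (intro eq_matI) auto

lemma add_uminus_mat: "A \<in> carrier_mat n m \<Longrightarrow> A + (- A) = (0\<^sub>m n m :: 'a::comm_ring_1 mat)"
  by (intro eq_matI) auto

lemma zero_mat_mult_vec: "x \<in> carrier_vec m \<Longrightarrow> 0\<^sub>m n m *\<^sub>v x = (0\<^sub>v n :: 'a::comm_ring_1 vec)"
  by (intro eq_vecI) (auto simp: scalar_prod_def)

section \<open>Images, kernels and factorization through exact matrices\<close>

abbreviation img0 :: "'a::comm_ring_1 mat \<Rightarrow> 'a set" where
  "img0 A \<equiv> (\<lambda>y. y $ 0) ` mat_image A"

lemma mat_imageI: "x \<in> carrier_vec (dim_col A) \<Longrightarrow> A *\<^sub>v x \<in> mat_image A"
  by (auto simp: mat_image_def)

lemma mat_factor: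
  fixes A B :: "'a::comm_ring_1 mat"
  assumes A: "A \<in> carrier_mat n k" and B: "B \<in> carrier_mat n m"
    and im: "\<And>j. j < k \<Longrightarrow> col A j \<in> mat_image B"
  obtains X where "X \<in> carrier_mat m k" "A = B * X"
proof -
  have "\<forall>j. \<exists>x. j < k \<longrightarrow> x \<in> carrier_vec m \<and> col A j = B *\<^sub>v x"
    using im B by (fastforce simp: mat_image_def)
  then obtain x where x: "\<And>j. j < k \<Longrightarrow> x j \<in> carrier_vec m" "\<And>j. j < k \<Longrightarrow> col A j = B *\<^sub>v x j"
    by metis
  define X where "X = mat_of_cols m (map x [0..<k])"
  have X: "X \<in> carrier_mat m k"
    using mat_of_cols_carrier(1)[of m "map x [0..<k]"] by (simp add: X_def)
  have "A = B * X"
  proof (rule mat_col_eqI)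
    fix j assume "j < dim_col (B * X)"
    then have j: "j < k" using X by simp
    have "col X j = x j" using j x(1) by (simp add: X_def)
    then show "col A j = col (B * X) j" using x(2)[OF j] col_mult2[OF B X j] by simp
  qed (use A B X in auto)
  with X show ?thesis by (rule that)
qed

text \<open>The lifting property of a free module, column by column.\<close>

lemma exact_factor:
  fixes A :: "'a::comm_ring_1 mat"
  assumes ex: "mat_ker D = mat_image E"
    and D: "D \<in> carrier_mat p n" and E: "E \<in> carrier_mat n m"
    and A: "A \<in> carrier_mat n k" and 0: "D * A = 0\<^sub>m p k"
  obtains X where "X \<in> carrier_mat m k" "A = E * X"
proof (rule mat_factor[OF A E])
  fix j assume j: "j < k"
  have "D *\<^sub>v col A j = col (D * A) j" using col_mult2[OF D A j] by simp
  also have "\<dots> = 0\<^sub>v p" using 0 j by simp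
  finally have "col A j \<in> mat_ker D" using D A by (auto simp: mat_ker_def)
  then show "col A j \<in> mat_image E" using ex by simp
qed

abbreviation acyclic :: "'a::comm_ring_1 cpx \<Rightarrow> bool" where
  "acyclic C \<equiv> \<forall>i. mat_ker (df C i) = mat_image (df C (Suc i))"

lemma complexD:
  assumes "is_complex C"
  shows "df C i \<in> carrier_mat (rk C i) (rk C (Suc i))"
    "df C i * df C (Suc i) = 0\<^sub>m (rk C i) (rk C (Suc (Suc i)))"
    "dim_row (df C i) = rk C i" "dim_col (df C i) = rk C (Suc i)"
  using assms by (auto simp: is_complex_def)

lemma chain_mapD:
  assumes "chain_map C D f"
  shows "f i \<in> carrier_mat (rk D i) (rk C i)" "f i * df C i = df D i * f (Suc i)"
    "dim_row (f i) = rk D i" "dim_col (f i) = rk C i"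
  using assms by (auto simp: chain_map_def)

lemma image_subset_ker:
  assumes C: "is_complex C" shows "mat_image (df C (Suc i)) \<subseteq> mat_ker (df C i)"
proof
  fix v assume "v \<in> mat_image (df C (Suc i))"
  then obtain u where u: "u \<in> carrier_vec (rk C (Suc (Suc i)))" "v = df C (Suc i) *\<^sub>v u"
    by (auto simp: mat_image_def complexD(4)[OF C])
  have "df C i *\<^sub>v v = df C i * df C (Suc i) *\<^sub>v u"
    unfolding u(2) by (rule assoc_mult_mat_vec[symmetric]) (rule complexD(1)[OF C] u)+
  also have "\<dots> = 0\<^sub>v (rk C i)" using u(1) by (simp add: complexD(2)[OF C] zero_mat_mult_vec)
  finally show "v \<in> mat_ker (df C i)"
    using mult_mat_vec_carrier[OF complexD(1)[OF C] u(1)] u(2)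
    by (simp add: mat_ker_def complexD(3,4)[OF C])
qed

lemma acyclicI:
  assumes C: "is_complex C"
    and ex: "\<And>i v. v \<in> carrier_vec (rk C (Suc i)) \<Longrightarrow> df C i *\<^sub>v v = 0\<^sub>v (rk C i) \<Longrightarrow>
      \<exists>u\<in>carrier_vec (rk C (Suc (Suc i))). v = df C (Suc i) *\<^sub>v u"
  shows "acyclic C"
proof (intro allI equalityI)
  fix i
  show "mat_image (df C (Suc i)) \<subseteq> mat_ker (df C i)" by (rule image_subset_ker[OF C])
  show "mat_ker (df C i) \<subseteq> mat_image (df C (Suc i))"
  proof
    fix v assume "v \<in> mat_ker (df C i)"
    then have "v \<in> carrier_vec (rk C (Suc i))" "df C i *\<^sub>v v = 0\<^sub>v (rk C i)"
      by (auto simp: mat_ker_def complexD(3,4)[OF C])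
    from ex[OF this] show "v \<in> mat_image (df C (Suc i))"
      by (auto simp: mat_image_def complexD(4)[OF C])
  qed
qed

lemma acyclicD:
  assumes C: "is_complex C" "acyclic C" and v: "v \<in> carrier_vec (rk C (Suc i))" "df C i *\<^sub>v v = 0\<^sub>v (rk C i)"
  obtains u where "u \<in> carrier_vec (rk C (Suc (Suc i)))" "v = df C (Suc i) *\<^sub>v u"
proof -
  have "v \<in> mat_image (df C (Suc i))"
    using C(2) v by (auto simp: mat_ker_def complexD(3,4)[OF C(1)])
  then show ?thesis using that by (auto simp: mat_image_def complexD(4)[OF C(1)])
qed

section \<open>Comparison maps and homotopies\<close>

text \<open>The comparison theorem. Acyclicity says nothing about the cokernel of
  \<open>df D 0\<close>, so the square in degree 0 has to be supplied through
  \<open>f1\<close>.\<close>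

lemma chain_map_lift:
  assumes C: "is_complex C" and D: "is_complex D" "acyclic D"
    and f0: "f0 \<in> carrier_mat (rk D 0) (rk C 0)"
    and f1: "f1 \<in> carrier_mat (rk D 1) (rk C 1)" "f0 * df C 0 = df D 0 * f1"
  obtains f where "chain_map C D f" "f 0 = f0"
proof -
  \<comment> \<open>The recursion runs over pairs of consecutive components: the next one exists
    because the square formed by the last two commutes.\<close>
  define P where "P n x \<longleftrightarrow> fst x \<in> carrier_mat (rk D n) (rk C n) \<and>
      snd x \<in> carrier_mat (rk D (Suc n)) (rk C (Suc n)) \<and> fst x * df C n = df D n * snd x \<and>
      (n = 0 \<longrightarrow> fst x = f0)"
    for n and x :: "'a mat \<times> 'a mat"
  have "\<exists>g. \<forall>n. P n (g n) \<and> fst (g (Suc n)) = snd (g n)"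
  proof (rule dependent_nat_choice)
    show "\<exists>x. P 0 x" by (rule exI[of _ "(f0, f1)"]) (use f0 f1 in \<open>simp add: P_def\<close>)
  next
    fix x n assume "P n x"
    then obtain a b where x: "x = (a, b)" and a: "a \<in> carrier_mat (rk D n) (rk C n)"
      and b: "b \<in> carrier_mat (rk D (Suc n)) (rk C (Suc n))" and ab: "a * df C n = df D n * b"
      by (cases x) (auto simp: P_def)
    note c = complexD(1)[OF C] and d = complexD(1)[OF D(1)]
    have bc: "b * df C (Suc n) \<in> carrier_mat (rk D (Suc n)) (rk C (Suc (Suc n)))"
      using b c by (rule mult_carrier_mat)
    have "df D n * (b * df C (Suc n)) = df D n * b * df C (Suc n)"
      by (rule assoc_mult_mat[symmetric]) (rule d b c)+
    also have "\<dots> = a * df C n * df C (Suc n)" using ab by simp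
    also have "\<dots> = a * (df C n * df C (Suc n))"
      by (rule assoc_mult_mat) (rule a c)+
    also have "\<dots> = 0\<^sub>m (rk D n) (rk C (Suc (Suc n)))" using a by (simp add: complexD(2)[OF C])
    finally obtain b' where "b' \<in> carrier_mat (rk D (Suc (Suc n))) (rk C (Suc (Suc n)))"
      "b * df C (Suc n) = df D (Suc n) * b'"
      using exact_factor[OF D(2)[rule_format] d d bc] by metis
    then show "\<exists>y. P (Suc n) y \<and> fst y = snd x"
      by (intro exI[of _ "(b, b')"]) (use b x in \<open>simp add: P_def\<close>)
  qed
  then obtain g where g: "\<And>n. P n (g n)" "\<And>n. fst (g (Suc n)) = snd (g n)" by blast
  have "chain_map C D (\<lambda>n. fst (g n))"
    unfolding chain_map_def using g by (simp add: P_def)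
  moreover have "fst (g 0) = f0" using g(1)[of 0] by (simp add: P_def)
  ultimately show ?thesis by (rule that)
qed

text \<open>The uniqueness half of the comparison theorem; \<open>h0\<close> witnesses that
  \<open>e\<close> is zero on zeroth homology.\<close>

lemma chain_map_homotopy:
  assumes C: "is_complex C" and D: "is_complex D" "acyclic D" and e: "chain_map C D e"
    and h0: "h0 \<in> carrier_mat (rk D 1) (rk C 0)" "e 0 = df D 0 * h0"
  obtains h where "\<And>i. h i \<in> carrier_mat (rk D (Suc i)) (rk C i)" "h 0 = h0"
    "\<And>i. e (Suc i) = df D (Suc i) * h (Suc i) + h i * df C i"
proof -
  note c = complexD(1)[OF C] and d = complexD(1)[OF D(1)] and ec = chain_mapD(1)[OF e]
  \<comment> \<open>The equation is what makes the columns of \<open>e (Suc n) - x * df C n\<close>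
    cycles, so that exactness of \<open>D\<close> yields the next homotopy.\<close>
  define P where "P n x \<longleftrightarrow> x \<in> carrier_mat (rk D (Suc n)) (rk C n) \<and>
      df D n * x * df C n = e n * df C n \<and> (n = 0 \<longrightarrow> x = h0)" for n x
  have "\<exists>h. \<forall>n. P n (h n) \<and> e (Suc n) = df D (Suc n) * h (Suc n) + h n * df C n"
  proof (rule dependent_nat_choice)
    show "\<exists>x. P 0 x" by (rule exI[of _ h0]) (use h0 in \<open>simp add: P_def\<close>)
  next
    fix x n assume "P n x"
    then have x: "x \<in> carrier_mat (rk D (Suc n)) (rk C n)" "df D n * x * df C n = e n * df C n"
      by (auto simp: P_def)
    let ?A = "e (Suc n) - x * df C n"
    have xc: "x * df C n \<in> carrier_mat (rk D (Suc n)) (rk C (Suc n))" using x(1) c by (rule mult_carrier_mat)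
    have A: "?A \<in> carrier_mat (rk D (Suc n)) (rk C (Suc n))" using xc by (rule minus_carrier_mat)
    have "df D n * ?A = df D n * e (Suc n) - df D n * (x * df C n)"
      by (rule mult_minus_distrib_mat[OF d ec xc])
    also have "df D n * (x * df C n) = df D n * x * df C n"
      by (rule assoc_mult_mat[symmetric]) (rule d x c)+
    also have "\<dots> = df D n * e (Suc n)" using x(2) chain_mapD(2)[OF e] by simp
    also have "df D n * e (Suc n) - df D n * e (Suc n) = 0\<^sub>m (rk D n) (rk C (Suc n))"
      by (rule minus_r_inv_mat) (rule mult_carrier_mat[OF d ec])
    finally obtain y where y: "y \<in> carrier_mat (rk D (Suc (Suc n))) (rk C (Suc n))"
      "?A = df D (Suc n) * y"
      using exact_factor[OF D(2)[rule_format] d d A] by metis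
    have ee: "e (Suc n) = df D (Suc n) * y + x * df C n"
      unfolding y(2)[symmetric] using ec[of "Suc n"] xc by (intro eq_matI) auto
    have "df D (Suc n) * y * df C (Suc n) = e (Suc n) * df C (Suc n) - x * df C n * df C (Suc n)"
      unfolding y(2)[symmetric] by (rule minus_mult_distrib_mat[OF ec xc c])
    also have "x * df C n * df C (Suc n) = x * (df C n * df C (Suc n))"
      by (rule assoc_mult_mat) (rule x c)+
    also have "\<dots> = 0\<^sub>m (rk D (Suc n)) (rk C (Suc (Suc n)))" using x(1) by (simp add: complexD(2)[OF C])
    also have "e (Suc n) * df C (Suc n) - 0\<^sub>m (rk D (Suc n)) (rk C (Suc (Suc n))) = e (Suc n) * df C (Suc n)"
      by (rule minus_zero_mat) (rule mult_carrier_mat[OF ec c])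
    finally show "\<exists>y. P (Suc n) y \<and> e (Suc n) = df D (Suc n) * y + x * df C n"
      using y(1) ee by (intro exI[of _ y]) (simp add: P_def)
  qed
  then obtain h where h: "\<And>n. P n (h n)" "\<And>n. e (Suc n) = df D (Suc n) * h (Suc n) + h n * df C n"
    by blast
  show ?thesis by (rule that[of h]) (use h in \<open>auto simp: P_def\<close>)
qed

section \<open>Operations on chain maps and isomorphisms of complexes\<close>

lemma chain_map_id: "is_complex C \<Longrightarrow> chain_map C C (\<lambda>i. 1\<^sub>m (rk C i))"
  by (simp add: chain_map_def complexD(1)[THEN left_mult_one_mat] complexD(1)[THEN right_mult_one_mat])

lemma chain_map_comp:
  assumes C: "is_complex C" "is_complex D" "is_complex E" and f: "chain_map C D f" and g: "chain_map D E g"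
  shows "chain_map C E (\<lambda>i. g i * f i)"
  unfolding chain_map_def
proof (intro conjI allI)
  fix i
  note F = chain_mapD(1)[OF f] and G = chain_mapD(1)[OF g]
  note c = complexD(1)[OF C(1)] and d = complexD(1)[OF C(2)] and e = complexD(1)[OF C(3)]
  show "g i * f i \<in> carrier_mat (rk E i) (rk C i)" using G F by (rule mult_carrier_mat)
  have "g i * f i * df C i = g i * (f i * df C i)" by (rule assoc_mult_mat) (rule G F c)+
  also have "\<dots> = g i * df D i * f (Suc i)"
    unfolding chain_mapD(2)[OF f] by (rule assoc_mult_mat[symmetric]) (rule G F d)+
  also have "\<dots> = df E i * (g (Suc i) * f (Suc i))"
    unfolding chain_mapD(2)[OF g] by (rule assoc_mult_mat) (rule G F e)+
  finally show "g i * f i * df C i = df E i * (g (Suc i) * f (Suc i))" .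
qed

lemma chain_map_diff:
  assumes C: "is_complex C" "is_complex D" and f: "chain_map C D f" and g: "chain_map C D g"
  shows "chain_map C D (\<lambda>i. f i - g i)"
  unfolding chain_map_def
proof (intro conjI allI)
  fix i
  note F = chain_mapD(1)[OF f] and G = chain_mapD(1)[OF g]
  note c = complexD(1)[OF C(1)] and d = complexD(1)[OF C(2)]
  show "f i - g i \<in> carrier_mat (rk D i) (rk C i)" using G by (rule minus_carrier_mat)
  show "(f i - g i) * df C i = df D i * (f (Suc i) - g (Suc i))"
    by (simp add: minus_mult_distrib_mat[OF F G c] mult_minus_distrib_mat[OF d F G]
        chain_mapD(2)[OF f] chain_mapD(2)[OF g])
qed

lemma chain_map_smult:
  assumes C: "is_complex C"
  shows "chain_map C C (\<lambda>i. x \<cdot>\<^sub>m 1\<^sub>m (rk C i))"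
  unfolding chain_map_def
proof (intro conjI allI)
  fix i
  note c = complexD(1)[OF C]
  show "x \<cdot>\<^sub>m 1\<^sub>m (rk C i) * df C i = df C i * (x \<cdot>\<^sub>m 1\<^sub>m (rk C (Suc i)))"
    by (simp add: mult_smult_distrib[OF c one_carrier_mat] mult_smult_assoc_mat[OF one_carrier_mat c]
       left_mult_one_mat[OF c] right_mult_one_mat[OF c])
qed simp

text \<open>Degreewise inverses of a chain map commute with the differentials automatically.\<close>

lemma isomorphic_complexesI:
  assumes C: "is_complex C" and D: "is_complex D" and f: "chain_map C D f"
    and V: "\<And>i. v i \<in> carrier_mat (rk C i) (rk D i)"
    and fv: "\<And>i. f i * v i = 1\<^sub>m (rk D i)" "\<And>i. v i * f i = 1\<^sub>m (rk C i)"
  shows "isomorphic_complexes C D"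
proof -
  note F = chain_mapD(1)[OF f] and c = complexD(1)[OF C] and d = complexD(1)[OF D]
  have "chain_map D C v"
    unfolding chain_map_def
  proof (intro conjI allI V)
    fix i
    have "v i * df D i = v i * (df D i * (f (Suc i) * v (Suc i)))"
      using d[of i] by (simp add: fv)
    also have "\<dots> = v i * (df D i * f (Suc i) * v (Suc i))"
      by (simp only: assoc_mult_mat[OF d F V])
    also have "\<dots> = v i * (f i * df C i * v (Suc i))" by (simp only: chain_mapD(2)[OF f])
    also have "\<dots> = v i * (f i * (df C i * v (Suc i)))" by (simp only: assoc_mult_mat[OF F c V])
    also have "\<dots> = v i * f i * (df C i * v (Suc i))"
      by (simp only: assoc_mult_mat[OF V F mult_carrier_mat[OF c V]])
    also have "\<dots> = df C i * v (Suc i)"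
      unfolding fv by (rule left_mult_one_mat[OF mult_carrier_mat[OF c V]])
    finally show "v i * df D i = df C i * v (Suc i)" .
  qed
  with f fv show ?thesis unfolding isomorphic_complexes_def by blast
qed

lemma isomorphic_complexes_trans:
  assumes c: "is_complex A" "is_complex B" "is_complex C"
    and 1: "isomorphic_complexes A B" and 2: "isomorphic_complexes B C"
  shows "isomorphic_complexes A C"
proof -
  from 1 obtain f g where f: "chain_map A B f" and g: "chain_map B A g"
    and fg: "\<And>i. g i * f i = 1\<^sub>m (rk A i)" "\<And>i. f i * g i = 1\<^sub>m (rk B i)"
    by (auto simp: isomorphic_complexes_def)
  from 2 obtain f' g' where f': "chain_map B C f'" and g': "chain_map C B g'"
    and fg': "\<And>i. g' i * f' i = 1\<^sub>m (rk B i)" "\<And>i. f' i * g' i = 1\<^sub>m (rk C i)"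
    by (auto simp: isomorphic_complexes_def)
  note F = chain_mapD(1)[OF f] and G = chain_mapD(1)[OF g]
    and F' = chain_mapD(1)[OF f'] and G' = chain_mapD(1)[OF g']
  have "(g i * g' i) * (f' i * f i) = 1\<^sub>m (rk A i)" for i
  proof -
    have "(g i * g' i) * (f' i * f i) = g i * (g' i * (f' i * f i))"
      by (rule assoc_mult_mat) (rule G G' mult_carrier_mat[OF F' F])+
    also have "g' i * (f' i * f i) = g' i * f' i * f i"
      by (rule assoc_mult_mat[symmetric]) (rule F G' F')+
    finally show ?thesis using fg(1) fg'(1) left_mult_one_mat[OF F] by simp
  qed
  moreover have "(f' i * f i) * (g i * g' i) = 1\<^sub>m (rk C i)" for i
  proof -
    have "(f' i * f i) * (g i * g' i) = f' i * (f i * (g i * g' i))"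
      by (rule assoc_mult_mat) (rule F F' mult_carrier_mat[OF G G'])+
    also have "f i * (g i * g' i) = f i * g i * g' i"
      by (rule assoc_mult_mat[symmetric]) (rule F G G')+
    finally show ?thesis using fg(2) fg'(2) left_mult_one_mat[OF G'] by simp
  qed
  ultimately show ?thesis unfolding isomorphic_complexes_def
    using chain_map_comp[OF c f f'] chain_map_comp[OF c(3,2,1) g' g] by blast
qed

section \<open>Dual complexes and base change\<close>

lemma dual_rk: "rk (dual n C) i = (if i \<le> n then rk C (n - i) else 0)"
  by (simp add: dual_def)

lemma is_complex_dual:
  assumes C: "is_complex C" shows "is_complex (dual n C)"
  unfolding is_complex_def
proof (intro conjI allI)
  note c = complexD(1)[OF C]
  show car: "df (dual n C) i \<in> carrier_mat (rk (dual n C) i) (rk (dual n C) (Suc i))" for i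
  proof -
    have "transpose_mat (df C (n - 1 - i)) \<in> carrier_mat (rk C (n - i)) (rk C (n - Suc i))" if "i < n"
      using c[of "n - 1 - i"] that by (simp add: Suc_diff_Suc)
    then show ?thesis by (auto simp: dual_def)
  qed
  fix i
  show "df (dual n C) i * df (dual n C) (Suc i) = 0\<^sub>m (rk (dual n C) i) (rk (dual n C) (Suc (Suc i)))"
  proof (cases "Suc i < n")
    case True
    define j where "j = n - 1 - Suc i"
    have j: "n - 1 - i = Suc j" "n - i = Suc (Suc j)" "n - Suc i = Suc j" "n - Suc (Suc i) = j" using True by (auto simp: j_def)
    have "df (dual n C) i * df (dual n C) (Suc i) = transpose_mat (df C j * df C (Suc j))"
      using True by (simp add: dual_def transpose_mult[OF c c] j j_def[symmetric])
    then show ?thesis using True j by (simp add: complexD(2)[OF C] dual_def)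
  next
    case False
    then have "df (dual n C) (Suc i) = 0\<^sub>m (rk (dual n C) (Suc i)) 0" "rk (dual n C) (Suc (Suc i)) = 0"
      by (auto simp: dual_def)
    then show ?thesis using car[of i] by simp
  qed
qed

lemma is_complex_base_change:
  assumes h: "comm_ring_hom h" and C: "is_complex C" shows "is_complex (base_change h C)"
proof -
  interpret comm_ring_hom h by (rule h)
  show ?thesis unfolding is_complex_def base_change_def
    using complexD(1)[OF C] by (auto simp: mat_hom_mult[OF complexD(1)[OF C] complexD(1)[OF C], symmetric]
       complexD(2)[OF C])
qed

subsection \<open>Mapping cones\<close>

lemma rk_cone: "rk (cone C D f) i = rk D i + (case i of 0 \<Rightarrow> 0 | Suc j \<Rightarrow> rk C j)"
  by (simp add: cone_def)

abbreviation shifted_df :: "'a::comm_ring_1 cpx \<Rightarrow> nat \<Rightarrow> 'a mat" where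
  "shifted_df C i \<equiv> (case i of 0 \<Rightarrow> 0\<^sub>m 0 (rk C 0) | Suc j \<Rightarrow> - df C j)"

abbreviation shifted_rk :: "'a::comm_ring_1 cpx \<Rightarrow> nat \<Rightarrow> nat" where
  "shifted_rk C i \<equiv> (case i of 0 \<Rightarrow> 0 | Suc j \<Rightarrow> rk C j)"

lemma df_cone: "df (cone C D f) i =
    four_block_mat (df D i) (f i) (0\<^sub>m (shifted_rk C i) (rk D (Suc i))) (shifted_df C i)"
  by (simp add: cone_def)

lemma shifted_df_carrier: "is_complex C \<Longrightarrow> shifted_df C i \<in> carrier_mat (shifted_rk C i) (rk C i)"
  by (simp add: complexD(1) split: nat.splits)

lemma shifted_df_comp:
  assumes C: "is_complex C"
  shows "shifted_df C i * df C i = 0\<^sub>m (shifted_rk C i) (rk C (Suc i))"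
proof (cases i)
  case (Suc j)
  then show ?thesis using uminus_mult_left_mat[of "df C j" "df C (Suc j)"]
    by (simp add: complexD(2,3,4)[OF C] uminus_zero_mat)
qed (use complexD(1)[OF C, of 0] in simp)

lemma is_complex_cone:
  assumes C: "is_complex C" and D: "is_complex D" and f: "chain_map C D f"
  shows "is_complex (cone C D f)"
  unfolding is_complex_def
proof (intro conjI allI)
  note c = complexD(1)[OF C] and d = complexD(1)[OF D] and F = chain_mapD(1)[OF f]
    and s = shifted_df_carrier[OF C]
  fix i
  show "df (cone C D f) i \<in> carrier_mat (rk (cone C D f) i) (rk (cone C D f) (Suc i))"
    using d[of i] s[of i] by (simp add: df_cone rk_cone)
  have s': "shifted_df C (Suc i) \<in> carrier_mat (rk C i) (rk C (Suc i))" using s[of "Suc i"] by simp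
  have z: "0\<^sub>m (rk C i) (rk D (Suc (Suc i))) \<in> carrier_mat (rk C i) (rk D (Suc (Suc i)))"
    "0\<^sub>m (shifted_rk C i) (rk D (Suc i)) \<in> carrier_mat (shifted_rk C i) (rk D (Suc i))" by auto
  have 2: "df D i * f (Suc i) + f i * (- df C i) = 0\<^sub>m (rk D i) (rk C (Suc i))"
    using uminus_mult_right_mat[of "f i" "df C i"] mult_carrier_mat[OF d F]
    by (simp add: complexD(3)[OF C] chain_mapD[OF f] add_uminus_mat)
  have 3: "shifted_df C i * (- df C i) = 0\<^sub>m (shifted_rk C i) (rk C (Suc i))"
    using uminus_mult_right_mat[of "shifted_df C i" "df C i"] s[of i] 
    by (simp add: complexD(3)[OF C] shifted_df_comp[OF C] uminus_zero_mat)
  have m: "df (cone C D f) i * df (cone C D f) (Suc i) =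
    four_block_mat (df D i * df D (Suc i) + f i * 0\<^sub>m (rk C i) (rk D (Suc (Suc i))))
     (df D i * f (Suc i) + f i * shifted_df C (Suc i))
     (0\<^sub>m (shifted_rk C i) (rk D (Suc i)) * df D (Suc i) + shifted_df C i * 0\<^sub>m (rk C i) (rk D (Suc (Suc i))))
     (0\<^sub>m (shifted_rk C i) (rk D (Suc i)) * f (Suc i) + shifted_df C i * shifted_df C (Suc i))"
    unfolding df_cone nat.case
    by (rule mult_four_block_mat[OF d F z(2) s d F z(1)]) (use c in simp)
  show "df (cone C D f) i * df (cone C D f) (Suc i) = 0\<^sub>m (rk (cone C D f) i) (rk (cone C D f) (Suc (Suc i)))"
    unfolding m using F[of i] F[of "Suc i"] s[of i] d[of "Suc i"]
    by (simp add: 2 3 complexD(2)[OF D] rk_cone uminus_zero_mat)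
qed

text \<open>In the long exact sequence of the cone all homology of \<open>C\<close> and
  \<open>D\<close> in positive degrees is zero, so only injectivity on zeroth homology is left to
  ask for.\<close>

lemma acyclic_cone:
  assumes C: "is_complex C" "acyclic C" and D: "is_complex D" "acyclic D" and f: "chain_map C D f"
    and inj: "\<And>y. y \<in> carrier_vec (rk C 0) \<Longrightarrow> f 0 *\<^sub>v y \<in> mat_image (df D 0) \<Longrightarrow> y \<in> mat_image (df C 0)"
  shows "acyclic (cone C D f)"
proof (rule acyclicI)
  note c = complexD(1)[OF C(1)] and d = complexD(1)[OF D(1)] and F = chain_mapD(1)[OF f]
    and s = shifted_df_carrier[OF C(1)]
  let ?K = "cone C D f"
  show K: "is_complex ?K" by (rule is_complex_cone[OF C(1) D(1) f])
  have mult: "df ?K i *\<^sub>v (x @\<^sub>v y) = (df D i *\<^sub>v x + f i *\<^sub>v y) @\<^sub>v (shifted_df C i *\<^sub>v y)"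
    if "x \<in> carrier_vec (rk D (Suc i))" "y \<in> carrier_vec (rk C i)" for i x y
    unfolding df_cone using four_block_mat_mult_vec[OF d F zero_carrier_mat s that] mult_mat_vec_carrier[OF s that(2)] that
    by (simp add: zero_mat_mult_vec)
  fix i v assume "v \<in> carrier_vec (rk ?K (Suc i))" and v0: "df ?K i *\<^sub>v v = 0\<^sub>v (rk ?K i)"
  then have v: "v \<in> carrier_vec (rk D (Suc i) + rk C i)" by (simp add: rk_cone)
  define x y where "x = vec_first v (rk D (Suc i))" and "y = vec_last v (rk C i)"
  have xy: "x \<in> carrier_vec (rk D (Suc i))" "y \<in> carrier_vec (rk C i)" "v = x @\<^sub>v y"
    using v by (auto simp: x_def y_def)
  have dx: "df D i *\<^sub>v x \<in> carrier_vec (rk D i)" and fy: "f i *\<^sub>v y \<in> carrier_vec (rk D i)"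
    using mult_mat_vec_carrier d F xy by blast+
  have "0\<^sub>v (n + m) = 0\<^sub>v n @\<^sub>v (0\<^sub>v m :: 'a vec)" for n m by (rule eq_vecI) auto
  then have "(df D i *\<^sub>v x + f i *\<^sub>v y) @\<^sub>v (shifted_df C i *\<^sub>v y) = 0\<^sub>v (rk D i) @\<^sub>v 0\<^sub>v (shifted_rk C i)"
    using v0 unfolding xy(3) mult[OF xy(1,2)] by (simp add: rk_cone)
  then have eq: "df D i *\<^sub>v x + f i *\<^sub>v y = 0\<^sub>v (rk D i)" "shifted_df C i *\<^sub>v y = 0\<^sub>v (shifted_rk C i)"
    using append_vec_eq[of "df D i *\<^sub>v x + f i *\<^sub>v y" "rk D i" "0\<^sub>v (rk D i)"] dx fy by auto
  have "y \<in> mat_image (df C i)"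
  proof (cases i)
    case 0
    have "f 0 *\<^sub>v y = df D 0 *\<^sub>v (- x)"
      using eq(1) 0 dx fy d[of 0] xy(1) by (auto simp: vec_eq_iff eq_neg_iff_add_eq_0 add.commute)
    also have "\<dots> \<in> mat_image (df D 0)"
      using xy(1) 0 by (intro mat_imageI) (simp add: complexD(4)[OF D(1)])
    finally show ?thesis using inj xy(2) 0 by simp
  next
    case (Suc j)
    have "df C j *\<^sub>v y = 0\<^sub>v (rk C j)"
      using eq(2) Suc c[of j] xy(2) by (auto simp: vec_eq_iff)
    then have "y \<in> mat_ker (df C j)" using xy(2) Suc by (simp add: mat_ker_def complexD(3,4)[OF C(1)])
    then show ?thesis using C(2) Suc by simp
  qed
  then obtain y' where y': "y' \<in> carrier_vec (rk C (Suc i))" "y = df C i *\<^sub>v y'"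
    by (auto simp: mat_image_def complexD(4)[OF C(1)])
  let ?fy = "f (Suc i) *\<^sub>v y'"
  have fy': "?fy \<in> carrier_vec (rk D (Suc i))" by (rule mult_mat_vec_carrier[OF F y'(1)])
  have "f i *\<^sub>v y = df D i *\<^sub>v ?fy"
    unfolding y'(2) assoc_mult_mat_vec[OF F c y'(1), symmetric] chain_mapD(2)[OF f]
    by (rule assoc_mult_mat_vec[OF d F y'(1)])
  then have "df D i *\<^sub>v (x + ?fy) = 0\<^sub>v (rk D i)"
    using eq(1) by (simp add: mult_add_distrib_mat_vec[OF d xy(1) fy'])
  then have "x + ?fy \<in> mat_ker (df D i)" using xy(1) fy' by (simp add: mat_ker_def complexD(3,4)[OF D(1)])
  then obtain x' where x': "x' \<in> carrier_vec (rk D (Suc (Suc i)))" "x + ?fy = df D (Suc i) *\<^sub>v x'"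
    using D(2) by (auto simp: mat_image_def complexD(4)[OF D(1)])
  \<comment> \<open>The shifted differential carries a minus sign, hence the preimage
    \<open>- y'\<close> in the summand \<open>C\<close>.\<close>
  have ny: "- y' \<in> carrier_vec (rk C (Suc i))" using y'(1) by simp
  have "df D (Suc i) *\<^sub>v x' + f (Suc i) *\<^sub>v (- y') = x"
    unfolding x'(2)[symmetric] using xy(1) fy' F[of "Suc i"] y'(1) by (auto simp: vec_eq_iff)
  moreover have "shifted_df C (Suc i) *\<^sub>v (- y') = y"
    using y' c[of i] by (auto simp: vec_eq_iff)
  ultimately have "v = df ?K (Suc i) *\<^sub>v (x' @\<^sub>v (- y'))"
    unfolding mult[OF x'(1) ny] xy(3) by simp
  moreover have "x' @\<^sub>v (- y') \<in> carrier_vec (rk ?K (Suc (Suc i)))"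
    using x'(1) y'(1) by (simp add: rk_cone)
  ultimately show "\<exists>u\<in>carrier_vec (rk ?K (Suc (Suc i))). v = df ?K (Suc i) *\<^sub>v u" by blast
qed

lemma mat_diff_eqD:
  fixes A :: "'a::comm_ring_1 mat"
  assumes c: "A \<in> carrier_mat n m" "B \<in> carrier_mat n m" "X \<in> carrier_mat n m" "Y \<in> carrier_mat n m"
    and eq: "A - B = X + Y"
  shows "A + (- Y) = X + B"
proof (rule eq_matI)
  fix i j assume "i < dim_row (X + B)" "j < dim_col (X + B)"
  moreover from this have "(A - B) $$ (i, j) = (X + Y) $$ (i, j)" by (simp only: eq)
  ultimately show "(A + (- Y)) $$ (i, j) = (X + B) $$ (i, j)"
    using c by (simp add: algebra_simps)
qed (use c in auto)

text \<open>The isomorphism is the unipotent block matrix with the homotopy in its upper right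
  corner; the inverse has the negative homotopy there.\<close>

lemma isomorphic_cones_homotopic:
  assumes C: "is_complex C" and D: "is_complex D" and f: "chain_map C D f" and g: "chain_map C D g"
    and h: "\<And>i. h i \<in> carrier_mat (rk D (Suc i)) (rk C i)" and 0: "f 0 - g 0 = df D 0 * h 0"
    and Suc: "\<And>i. f (Suc i) - g (Suc i) = df D (Suc i) * h (Suc i) + h i * df C i"
  shows "isomorphic_complexes (cone C D f) (cone C D g)"
proof -
  note c = complexD(1)[OF C] and d = complexD(1)[OF D] and s = shifted_df_carrier[OF C]
  \<comment> \<open>In degree \<open>i\<close> the cone contains \<open>C\<close> in degree
    \<open>i - 1\<close>, so the homotopy is read with its index lowered by one and is an empty
    block in degree 0.\<close>
  define u where "u i = (case i of 0 \<Rightarrow> 0\<^sub>m (rk D 0) 0 | Suc j \<Rightarrow> h j)" for i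
  have u: "u i \<in> carrier_mat (rk D i) (shifted_rk C i)" for i
    using h by (auto simp: u_def split: nat.splits)
  define \<Phi> where "\<Phi> u i = four_block_mat (1\<^sub>m (rk D i)) (u i) (0\<^sub>m (shifted_rk C i) (rk D i)) (1\<^sub>m (shifted_rk C i))"
    for i and u :: "nat \<Rightarrow> 'a mat"
  have fg: "f i + u i * shifted_df C i = df D i * u (Suc i) + g i" for i
  proof -
    have u': "u (Suc i) \<in> carrier_mat (rk D (Suc i)) (rk C i)" using u[of "Suc i"] by simp
    define Y where "Y = (case i of 0 \<Rightarrow> 0\<^sub>m (rk D 0) (rk C 0) | Suc j \<Rightarrow> h j * df C j)"
    have Y: "Y \<in> carrier_mat (rk D i) (rk C i)" "u i * shifted_df C i = - Y"
    proof -
      have hc: "h j * df C j \<in> carrier_mat (rk D (Suc j)) (rk C (Suc j))" for j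
        using h c by (rule mult_carrier_mat)
      then show "Y \<in> carrier_mat (rk D i) (rk C i)" by (simp add: Y_def split: nat.splits)
      have "h j * (- df C j) = - (h j * df C j)" for j
        using uminus_mult_right_mat[of "h j" "df C j"] carrier_matD(2)[OF h] by (simp add: complexD(3)[OF C])
      then show "u i * shifted_df C i = - Y"
        by (simp add: Y_def u_def uminus_zero_mat split: nat.splits)
    qed
    have "f i - g i = df D i * u (Suc i) + Y"
      using 0 Suc mult_carrier_mat[OF d h, of 0] by (auto simp: Y_def u_def split: nat.splits)
    from mat_diff_eqD[OF chain_mapD(1)[OF f] chain_mapD(1)[OF g] mult_carrier_mat[OF d u'] Y(1) this]
    show ?thesis by (simp add: Y(2))
  qed
  have chain: "chain_map (cone C D f) (cone C D g) (\<Phi> u)"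
    unfolding chain_map_def
  proof (intro conjI allI)
    fix i
    note F = chain_mapD(1)[OF f] and G = chain_mapD(1)[OF g]
    have u': "u (Suc i) \<in> carrier_mat (rk D (Suc i)) (rk C i)" using u[of "Suc i"] by simp
    show "\<Phi> u i \<in> carrier_mat (rk (cone C D g) i) (rk (cone C D f) i)"
      by (simp add: \<Phi>_def rk_cone)
    have "\<Phi> u i * df (cone C D f) i =
      four_block_mat (1\<^sub>m (rk D i) * df D i + u i * 0\<^sub>m (shifted_rk C i) (rk D (Suc i)))
        (1\<^sub>m (rk D i) * f i + u i * shifted_df C i)
        (0\<^sub>m (shifted_rk C i) (rk D i) * df D i + 1\<^sub>m (shifted_rk C i) * 0\<^sub>m (shifted_rk C i) (rk D (Suc i)))
        (0\<^sub>m (shifted_rk C i) (rk D i) * f i + 1\<^sub>m (shifted_rk C i) * shifted_df C i)"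
      unfolding \<Phi>_def df_cone
      by (rule mult_four_block_mat[OF one_carrier_mat u zero_carrier_mat one_carrier_mat d F zero_carrier_mat s])
    also have "\<dots> = four_block_mat (df D i) (df D i * u (Suc i) + g i)
         (0\<^sub>m (shifted_rk C i) (rk D (Suc i))) (shifted_df C i)"
      using d[of i] F[of i] u[of i] s[of i] fg[of i] by simp
    also have "\<dots> = four_block_mat (df D i * 1\<^sub>m (rk D (Suc i)) + g i * 0\<^sub>m (rk C i) (rk D (Suc i)))
        (df D i * u (Suc i) + g i * 1\<^sub>m (rk C i))
        (0\<^sub>m (shifted_rk C i) (rk D (Suc i)) * 1\<^sub>m (rk D (Suc i)) + shifted_df C i * 0\<^sub>m (rk C i) (rk D (Suc i)))
        (0\<^sub>m (shifted_rk C i) (rk D (Suc i)) * u (Suc i) + shifted_df C i * 1\<^sub>m (rk C i))"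
      using d[of i] G[of i] u' s[of i] by simp
    also have "\<dots> = df (cone C D g) i * \<Phi> u (Suc i)"
      unfolding \<Phi>_def df_cone nat.case
      by (rule mult_four_block_mat[symmetric, OF d G zero_carrier_mat s one_carrier_mat u' zero_carrier_mat one_carrier_mat])
    finally show "\<Phi> u i * df (cone C D f) i = df (cone C D g) i * \<Phi> u (Suc i)" .
  qed
  have inv: "\<Phi> u i * \<Phi> v i = 1\<^sub>m (rk D i + shifted_rk C i)"
    if u: "u i \<in> carrier_mat (rk D i) (shifted_rk C i)" and v: "v i \<in> carrier_mat (rk D i) (shifted_rk C i)"
      and uv: "v i + u i = 0\<^sub>m (rk D i) (shifted_rk C i)" for u v i
    unfolding \<Phi>_def
    by (subst mult_four_block_mat[OF one_carrier_mat u zero_carrier_mat one_carrier_mat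
          one_carrier_mat v zero_carrier_mat one_carrier_mat])
      (use u v uv in \<open>simp add: rk_cone\<close>)
  define v where "v i = - u i" for i
  have v: "v i \<in> carrier_mat (rk D i) (shifted_rk C i)" for i using u[of i] by (simp add: v_def)
  have "v i + u i = 0\<^sub>m (rk D i) (shifted_rk C i)" "u i + v i = 0\<^sub>m (rk D i) (shifted_rk C i)" for i
    using u[of i] by (auto simp: v_def)
  then have "\<Phi> v i * \<Phi> u i = 1\<^sub>m (rk (cone C D f) i)" "\<Phi> u i * \<Phi> v i = 1\<^sub>m (rk (cone C D g) i)" for i
    unfolding rk_cone using inv u v by blast+
  moreover have "\<Phi> v i \<in> carrier_mat (rk (cone C D f) i) (rk (cone C D g) i)" for i
    by (simp add: \<Phi>_def rk_cone)
  ultimately show ?thesis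
    using isomorphic_complexesI[OF is_complex_cone[OF C D f] is_complex_cone[OF C D g] chain] by blast
qed

subsection \<open>Regular sequences and dual complexes\<close>

text \<open>A regular sequence in the weak sense: the ideal it generates may be the whole
  ring.\<close>

definition regular3 :: "'a::comm_ring_1 \<Rightarrow> 'a \<Rightarrow> 'a \<Rightarrow> bool" where
  "regular3 x y z \<longleftrightarrow> (\<forall>a. x * a = 0 \<longrightarrow> a = 0) \<and>
    (\<forall>a b. y * a = x * b \<longrightarrow> (\<exists>c. a = x * c)) \<and>
    (\<forall>a b c. z * a = x * b + y * c \<longrightarrow> (\<exists>d e. a = x * d + y * e))"

text \<open>Vanishing of the first Koszul homology. The coefficients are rewritten from the last to
  the first, using the three regularity conditions in reverse order.\<close>

lemma regular3_koszul:
  assumes r: "regular3 x y z" and eq: "a * x + b * y + c * z = (0 :: 'a::comm_ring_1)"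
  obtains d e f where "a = - d * y - e * z" "b = d * x - f * z" "c = e * x + f * y"
proof -
  have r1: "\<And>a. x * a = 0 \<Longrightarrow> a = 0" and r2: "\<And>a b. y * a = x * b \<Longrightarrow> \<exists>c. a = x * c"
    and r3: "\<And>a b c. z * a = x * b + y * c \<Longrightarrow> \<exists>d e. a = x * d + y * e"
    using r unfolding regular3_def by blast+
  have "z * c - (x * (- a) + y * (- b)) = a * x + b * y + c * z" by (simp add: algebra_simps)
  then have "z * c = x * (- a) + y * (- b)" using eq by simp
  then obtain e f where c: "c = x * e + y * f" using r3 by blast
  have eq2: "x * (a + e * z) + y * (b + f * z) = 0" using eq by (simp add: c algebra_simps)
  have "y * (b + f * z) - x * (- (a + e * z)) = x * (a + e * z) + y * (b + f * z)"
    by (simp add: algebra_simps)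
  then have "y * (b + f * z) = x * (- (a + e * z))" using eq2 by simp
  then obtain d where d: "b + f * z = x * d" using r2 by blast
  have "x * (a + e * z + y * d) = 0" using eq2 unfolding d by (simp add: algebra_simps)
  then have "a + e * z + y * d = 0" by (rule r1)
  then have "a = - d * y - e * z" by (simp add: algebra_simps eq_neg_iff_add_eq_0)
  moreover have "b = d * x - f * z" using d by (simp add: algebra_simps eq_diff_eq)
  moreover have "c = e * x + f * y" using c by (simp add: algebra_simps)
  ultimately show ?thesis by (rule that)
qed

lemma regular_mat1:
  assumes r: "\<And>a. x * a = 0 \<Longrightarrow> a = (0 :: 'a::comm_ring_1)"
    and A: "A \<in> carrier_mat n m" and B: "B \<in> carrier_mat n m" and eq: "x \<cdot>\<^sub>m A = x \<cdot>\<^sub>m B"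
  shows "A = B"
proof (rule eq_matI)
  fix i j assume ij: "i < dim_row B" "j < dim_col B"
  have "(x \<cdot>\<^sub>m A) $$ (i, j) = (x \<cdot>\<^sub>m B) $$ (i, j)" by (simp only: eq)
  then have "x * (A $$ (i, j) - B $$ (i, j)) = 0" using A B ij by (simp add: algebra_simps)
  then show "A $$ (i, j) = B $$ (i, j)" using r by fastforce
qed (use A B in auto)

lemma regular_mat2:
  assumes r: "\<And>a b. y * a = x * b \<Longrightarrow> \<exists>c. a = x * (c :: 'a::comm_ring_1)"
    and A: "A \<in> carrier_mat n m" and B: "B \<in> carrier_mat n m" and eq: "y \<cdot>\<^sub>m A = x \<cdot>\<^sub>m B"
  obtains C where "C \<in> carrier_mat n m" "A = x \<cdot>\<^sub>m C"
proof -
  have "\<exists>c. A $$ (i, j) = x * c" if "i < n" "j < m" for i j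
  proof -
    have "(y \<cdot>\<^sub>m A) $$ (i, j) = (x \<cdot>\<^sub>m B) $$ (i, j)" by (simp only: eq)
    then show ?thesis using A B that r by auto
  qed
  then obtain c where c: "\<And>i j. i < n \<Longrightarrow> j < m \<Longrightarrow> A $$ (i, j) = x * c i j" by metis
  have "A = x \<cdot>\<^sub>m mat n m (\<lambda>(i, j). c i j)"
    by (rule eq_matI) (use A c in auto)
  with mat_carrier show ?thesis by (rule that)
qed

lemma regular_mat3:
  assumes r: "\<And>a b c. z * a = x * b + y * c \<Longrightarrow> \<exists>d e. a = x * d + y * (e :: 'a::comm_ring_1)"
    and A: "A \<in> carrier_mat n m" and B: "B \<in> carrier_mat n m" and C: "C \<in> carrier_mat n m"
    and eq: "z \<cdot>\<^sub>m A = x \<cdot>\<^sub>m B + y \<cdot>\<^sub>m C"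
  obtains D E where "D \<in> carrier_mat n m" "E \<in> carrier_mat n m" "A = x \<cdot>\<^sub>m D + y \<cdot>\<^sub>m E"
proof -
  have "\<exists>d e. A $$ (i, j) = x * d + y * e" if "i < n" "j < m" for i j
  proof -
    have "(z \<cdot>\<^sub>m A) $$ (i, j) = (x \<cdot>\<^sub>m B + y \<cdot>\<^sub>m C) $$ (i, j)" by (simp only: eq)
    then show ?thesis using A B C that r by auto
  qed
  then obtain d e where c: "\<And>i j. i < n \<Longrightarrow> j < m \<Longrightarrow> A $$ (i, j) = x * d i j + y * e i j" by metis
  have "A = x \<cdot>\<^sub>m mat n m (\<lambda>(i, j). d i j) + y \<cdot>\<^sub>m mat n m (\<lambda>(i, j). e i j)"
    by (rule eq_matI) (use A c in auto)
  with mat_carrier mat_carrier show ?thesis by (rule that)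
qed

text \<open>The matrices \<open>h\<close> form a null-homotopy of the multiplication by \<open>x\<close>. It is stated on row
  vectors \<open>\<theta>\<close>, which stand for the elements of the dual complex.\<close>

lemma null_homotopy:
  fixes P :: "'a::comm_ring_1 cpx"
  assumes P: "is_complex P" "acyclic P" "rk P 0 = 1" and x: "x \<in> img0 (df P 0)"
  obtains h where "\<And>i. h i \<in> carrier_mat (rk P (Suc i)) (rk P i)"
    "\<And>(\<theta> :: 'a mat) p. \<theta> \<in> carrier_mat p 1 \<Longrightarrow> x \<cdot>\<^sub>m \<theta> = \<theta> * df P 0 * h 0"
    "\<And>(\<theta> :: 'a mat) p i. \<theta> \<in> carrier_mat p (rk P (Suc i)) \<Longrightarrow>
      x \<cdot>\<^sub>m \<theta> = \<theta> * df P (Suc i) * h (Suc i) + \<theta> * h i * df P i"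
proof -
  note d = complexD(1)[OF P(1)]
  obtain v where v: "v \<in> carrier_vec (rk P 1)" "x = (df P 0 *\<^sub>v v) $ 0"
    using x by (auto simp: mat_image_def complexD(4)[OF P(1)])
  define h0 where "h0 = mat_of_cols (rk P 1) [v]"
  have h0: "h0 \<in> carrier_mat (rk P 1) (rk P 0)"
    using mat_of_cols_carrier(1)[of "rk P 1" "[v]"] P(3) by (simp add: h0_def)
  have col: "col h0 0 = v" using v(1) by (simp add: h0_def)
  have "x \<cdot>\<^sub>m 1\<^sub>m (rk P 0) = df P 0 * h0"
  proof (rule eq_matI)
    fix i j assume "i < dim_row (df P 0 * h0)" "j < dim_col (df P 0 * h0)"
    then have ij: "i = 0" "j = 0" using h0 P(3) d[of 0] by auto
    show "(x \<cdot>\<^sub>m 1\<^sub>m (rk P 0)) $$ (i, j) = (df P 0 * h0) $$ (i, j)"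
      using h0 P(3) d[of 0] v ij col by simp
  qed (use h0 d[of 0] in auto)
  from chain_map_homotopy[OF P(1) P(1,2) chain_map_smult[OF P(1)] h0 this]
  obtain h where h: "\<And>i. h i \<in> carrier_mat (rk P (Suc i)) (rk P i)" "h 0 = h0"
    "\<And>i. x \<cdot>\<^sub>m 1\<^sub>m (rk P (Suc i)) = df P (Suc i) * h (Suc i) + h i * df P i" by metis
  show ?thesis
  proof (rule that[OF h(1)])
    fix \<theta> :: "'a mat" and p assume t: "\<theta> \<in> carrier_mat p (1::nat)"
    have "x \<cdot>\<^sub>m \<theta> = \<theta> * (x \<cdot>\<^sub>m 1\<^sub>m (rk P 0))" using mult_smult_distrib[OF t one_carrier_mat] t P(3) by simp
    also have "\<dots> = \<theta> * (df P 0 * h 0)"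
      using \<open>x \<cdot>\<^sub>m 1\<^sub>m (rk P 0) = df P 0 * h0\<close> by (simp add: h(2))
    also have "\<dots> = \<theta> * df P 0 * h 0"
      by (rule assoc_mult_mat[symmetric]) (use t P(3) d[of 0] h(1)[of 0] in auto)
    finally show "x \<cdot>\<^sub>m \<theta> = \<theta> * df P 0 * h 0" .
  next
    fix \<theta> :: "'a mat" and p i assume t: "\<theta> \<in> carrier_mat p (rk P (Suc i))"
    have "x \<cdot>\<^sub>m \<theta> = \<theta> * (x \<cdot>\<^sub>m 1\<^sub>m (rk P (Suc i)))" using mult_smult_distrib[OF t one_carrier_mat] t by simp
    also have "\<dots> = \<theta> * (df P (Suc i) * h (Suc i)) + \<theta> * (h i * df P i)"
      unfolding h(3) by (rule mult_add_distrib_mat[OF t mult_carrier_mat[OF d h(1)] mult_carrier_mat[OF h(1) d]])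
    also have "\<dots> = \<theta> * df P (Suc i) * h (Suc i) + \<theta> * h i * df P i"
      by (simp only: assoc_mult_mat[OF t d h(1)] assoc_mult_mat[OF t h(1) d])
    finally show "x \<cdot>\<^sub>m \<theta> = \<theta> * df P (Suc i) * h (Suc i) + \<theta> * h i * df P i" .
  qed
qed

context
  fixes P :: "'a::comm_ring_1 cpx" and x y z :: 'a
  assumes P: "is_complex P" "acyclic P" "rk P 0 = 1" and reg: "regular3 x y z"
    and xyz: "x \<in> img0 (df P 0)" "y \<in> img0 (df P 0)"
      "z \<in> img0 (df P 0)"
begin

private lemma d0: "df P 0 \<in> carrier_mat 1 (rk P 1)" and d1: "df P 1 \<in> carrier_mat (rk P 1) (rk P 2)"
  and d2: "df P 2 \<in> carrier_mat (rk P 2) (rk P 3)" and d01: "df P 0 * df P 1 = 0\<^sub>m 1 (rk P 2)"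
  using complexD(1)[OF P(1), of 0] complexD(1)[OF P(1), of 1] complexD(1)[OF P(1), of 2]
    complexD(2)[OF P(1), of 0] P(3) by (simp_all add: numeral_2_eq_2 numeral_3_eq_3)

private lemma reg1: "x * a = 0 \<Longrightarrow> a = 0" and reg2: "y * a = x * b \<Longrightarrow> \<exists>c. a = x * c"
  and reg3: "z * a = x * b + y * c \<Longrightarrow> \<exists>d e. a = x * d + y * e"
  using reg unfolding regular3_def by blast+

text \<open>A null-homotopy of multiplication by \<open>w\<close>, seen from the dual: the rows
  \<open>\<theta>\<close> are its cochains. Degrees 0 to 2 suffice, since only the Ext modules in
  these degrees have to vanish.\<close>

private definition htpy :: "'a \<Rightarrow> 'a mat \<Rightarrow> 'a mat \<Rightarrow> 'a mat \<Rightarrow> bool" where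
  "htpy w h0 h1 h2 \<longleftrightarrow> h0 \<in> carrier_mat (rk P 1) 1 \<and> h1 \<in> carrier_mat (rk P 2) (rk P 1) \<and>
    h2 \<in> carrier_mat (rk P 3) (rk P 2) \<and>
    (\<forall>\<theta>\<in>carrier_mat 1 1. w \<cdot>\<^sub>m \<theta> = \<theta> * df P 0 * h0) \<and>
    (\<forall>\<theta>\<in>carrier_mat 1 (rk P 1). w \<cdot>\<^sub>m \<theta> = \<theta> * df P 1 * h1 + \<theta> * h0 * df P 0) \<and>
    (\<forall>\<theta>\<in>carrier_mat 1 (rk P 2). w \<cdot>\<^sub>m \<theta> = \<theta> * df P 2 * h2 + \<theta> * h1 * df P 1)"

private lemma htpyD:
  assumes "htpy w h0 h1 h2"
  shows "h0 \<in> carrier_mat (rk P 1) 1" "h1 \<in> carrier_mat (rk P 2) (rk P 1)"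
    "h2 \<in> carrier_mat (rk P 3) (rk P 2)"
    "\<theta>0 \<in> carrier_mat 1 1 \<Longrightarrow> w \<cdot>\<^sub>m \<theta>0 = \<theta>0 * df P 0 * h0"
    "\<theta>1 \<in> carrier_mat 1 (rk P 1) \<Longrightarrow> w \<cdot>\<^sub>m \<theta>1 = \<theta>1 * df P 1 * h1 + \<theta>1 * h0 * df P 0"
    "\<theta>2 \<in> carrier_mat 1 (rk P 2) \<Longrightarrow> w \<cdot>\<^sub>m \<theta>2 = \<theta>2 * df P 2 * h2 + \<theta>2 * h1 * df P 1"
  using assms unfolding htpy_def by blast+

private lemma homotopy:
  assumes w: "w \<in> img0 (df P 0)"
  obtains h0 h1 h2 where "htpy w h0 h1 h2"
proof (rule null_homotopy[OF P w])
  fix h :: "nat \<Rightarrow> 'a mat"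
  assume h: "\<And>i. h i \<in> carrier_mat (rk P (Suc i)) (rk P i)"
    "\<And>\<theta> p. \<theta> \<in> carrier_mat p 1 \<Longrightarrow> w \<cdot>\<^sub>m \<theta> = \<theta> * df P 0 * h 0"
    "\<And>\<theta> p i. \<theta> \<in> carrier_mat p (rk P (Suc i)) \<Longrightarrow>
      w \<cdot>\<^sub>m \<theta> = \<theta> * df P (Suc i) * h (Suc i) + \<theta> * h i * df P i"
  have S: "Suc 2 = 3" by simp
  have "htpy w (h 0) (h 1) (h 2)" unfolding htpy_def
    using h(1)[of 0] h(1)[of 1] h(1)[of 2] h(2)[of _ 1] h(3)[of _ 1 0] h(3)[of _ 1 1]
    unfolding One_nat_def[symmetric] Suc_1 S P(3) by blast
  then show ?thesis by (rule that)
qed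

text \<open>The homotopy for \<open>x\<close> reduces to \<open>x \<phi> = \<phi> d h = 0\<close>,
  and \<open>x\<close> is a nonzerodivisor.\<close>

lemma ext0:
  assumes t: "\<phi> \<in> carrier_mat 1 1" "\<phi> * df P 0 = 0\<^sub>m 1 (rk P 1)"
  shows "\<phi> = 0\<^sub>m 1 1"
proof -
  obtain h0 h1 h2 where H: "htpy x h0 h1 h2" by (rule homotopy[OF xyz(1)])
  note h = htpyD(1)[OF H] htpyD(4)[OF H t(1)]
  show ?thesis
    by (rule regular_mat1[OF reg1 t(1) zero_carrier_mat]) (use h t in auto)
qed

text \<open>The homotopy for \<open>x\<close> makes \<open>x \<phi>\<close> a coboundary of some
  \<open>\<eta>\<close>. The homotopy for \<open>y\<close>, applied to \<open>\<eta>\<close>, shows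
  that \<open>y \<eta>\<close> is divisible by \<open>x\<close>; by regularity so is
  \<open>\<eta>\<close>, and \<open>x\<close> cancels.\<close>

lemma ext1:
  assumes t: "\<phi> \<in> carrier_mat 1 (rk P 1)" "\<phi> * df P 1 = 0\<^sub>m 1 (rk P 2)"
  obtains a where "a \<in> carrier_mat 1 1" "\<phi> = a * df P 0"
proof -
  obtain h0 h1 h2 where H: "htpy x h0 h1 h2" by (rule homotopy[OF xyz(1)])
  note h = htpyD(1,2)[OF H] htpyD(5)[OF H t(1)]
  obtain k0 k1 k2 where K: "htpy y k0 k1 k2" by (rule homotopy[OF xyz(2)])
  note k = htpyD(1)[OF K] htpyD(4)[OF K]
  define \<eta> where "\<eta> = \<phi> * h0"
  have \<eta>: "\<eta> \<in> carrier_mat 1 1" unfolding \<eta>_def using t(1) h(1) by (rule mult_carrier_mat)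
  have x\<phi>: "x \<cdot>\<^sub>m \<phi> = \<eta> * df P 0"
    using h(3) mult_carrier_mat[OF \<eta> d0] h(2) by (simp add: t(2) \<eta>_def del: One_nat_def)
  have e: "y \<cdot>\<^sub>m \<eta> = x \<cdot>\<^sub>m (\<phi> * k0)"
    using k(2)[OF \<eta>] mult_smult_assoc_mat[OF t(1) k(1)] by (simp add: x\<phi>[symmetric])
  obtain a where a: "a \<in> carrier_mat 1 1" "\<eta> = x \<cdot>\<^sub>m a"
    by (rule regular_mat2[OF _ \<eta> mult_carrier_mat[OF t(1) k(1)] e])
      (rule reg2, assumption, rule that, assumption+)
  have e2: "x \<cdot>\<^sub>m \<phi> = x \<cdot>\<^sub>m (a * df P 0)"
    unfolding x\<phi> a(2) by (rule mult_smult_assoc_mat[OF a(1) d0])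
  from reg1 t(1) mult_carrier_mat[OF a(1) d0] e2 have "\<phi> = a * df P 0" by (rule regular_mat1)
  with a(1) show ?thesis by (rule that)
qed

text \<open>This is \<open>ext1\<close> read modulo \<open>x\<close>, with \<open>y\<close>,
  \<open>z\<close> in place of \<open>x\<close>, \<open>y\<close>: a cocycle modulo \<open>x\<close>
  is a coboundary modulo \<open>x\<close>. It is the dimension shift that \<open>ext2\<close> rests
  on.\<close>

lemma ext1_mod:
  assumes t: "\<theta> \<in> carrier_mat 1 (rk P 1)" and f: "\<phi> \<in> carrier_mat 1 (rk P 2)"
    and eq: "\<theta> * df P 1 = x \<cdot>\<^sub>m \<phi>"
  obtains b c where "b \<in> carrier_mat 1 1" "c \<in> carrier_mat 1 (rk P 1)" "\<theta> = b * df P 0 + x \<cdot>\<^sub>m c"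
proof -
  obtain k0 k1 k2 where K: "htpy y k0 k1 k2" by (rule homotopy[OF xyz(2)])
  note k = htpyD(1,2)[OF K] htpyD(5)[OF K t]
  obtain l0 l1 l2 where L: "htpy z l0 l1 l2" by (rule homotopy[OF xyz(3)])
  note l = htpyD(1)[OF L] htpyD(4)[OF L]
  define \<eta> where "\<eta> = \<theta> * k0"
  have \<eta>: "\<eta> \<in> carrier_mat 1 1" unfolding \<eta>_def using t k(1) by (rule mult_carrier_mat)
  have fk: "\<phi> * k1 \<in> carrier_mat 1 (rk P 1)" using f k(2) by (rule mult_carrier_mat)
  have ed: "\<eta> * df P 0 \<in> carrier_mat 1 (rk P 1)" using \<eta> d0 by (rule mult_carrier_mat)
  have y\<theta>: "y \<cdot>\<^sub>m \<theta> = x \<cdot>\<^sub>m (\<phi> * k1) + \<eta> * df P 0"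
    using k(3) mult_smult_assoc_mat[OF f k(2)] by (simp add: eq \<eta>_def del: One_nat_def)
  have "\<eta> * df P 0 = x \<cdot>\<^sub>m (- (\<phi> * k1)) + y \<cdot>\<^sub>m \<theta>"
  proof -
    have "B = x \<cdot>\<^sub>m (- A) + (x \<cdot>\<^sub>m A + B)" if "A \<in> carrier_mat 1 (rk P 1)" "B \<in> carrier_mat 1 (rk P 1)" for A B
      using that by (intro eq_matI) auto
    from this[OF fk ed] show ?thesis unfolding y\<theta> .
  qed
  then have "\<eta> * df P 0 * l0 = (x \<cdot>\<^sub>m (- (\<phi> * k1)) + y \<cdot>\<^sub>m \<theta>) * l0" by simp
  also have "\<dots> = x \<cdot>\<^sub>m (- (\<phi> * k1) * l0) + y \<cdot>\<^sub>m (\<theta> * l0)"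
    using fk t l(1) by (simp add: add_mult_distrib_mat[of _ 1 "rk P 1" _ _ 1]
      mult_smult_assoc_mat[of _ 1 "rk P 1" _ 1])
  finally have z\<eta>: "z \<cdot>\<^sub>m \<eta> = x \<cdot>\<^sub>m (- (\<phi> * k1) * l0) + y \<cdot>\<^sub>m (\<theta> * l0)" using l(2)[OF \<eta>] by simp
  obtain a b where ab: "a \<in> carrier_mat 1 1" "b \<in> carrier_mat 1 1" "\<eta> = x \<cdot>\<^sub>m a + y \<cdot>\<^sub>m b"
    by (rule regular_mat3[OF _ \<eta> mult_carrier_mat[OF uminus_carrier_mat[OF fk] l(1)]
        mult_carrier_mat[OF t l(1)] z\<eta>]) (rule reg3, assumption, rule that, assumption+)
  have ad: "a * df P 0 \<in> carrier_mat 1 (rk P 1)" and bd: "b * df P 0 \<in> carrier_mat 1 (rk P 1)"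
    using ab d0 by (auto intro: mult_carrier_mat)
  have "\<eta> * df P 0 = x \<cdot>\<^sub>m (a * df P 0) + y \<cdot>\<^sub>m (b * df P 0)"
    using ab d0 by (simp add: add_mult_distrib_mat[of _ 1 1 _ _ "rk P 1"] mult_smult_assoc_mat[of _ 1 1 _ "rk P 1"])
  then have eq2: "y \<cdot>\<^sub>m \<theta> = x \<cdot>\<^sub>m (\<phi> * k1) + (x \<cdot>\<^sub>m (a * df P 0) + y \<cdot>\<^sub>m (b * df P 0))" using y\<theta> by simp
  have eq3: "y \<cdot>\<^sub>m (\<theta> - b * df P 0) = x \<cdot>\<^sub>m (\<phi> * k1 + a * df P 0)"
  proof -
    have "y \<cdot>\<^sub>m (T - C) = x \<cdot>\<^sub>m (A + B)"
      if "T \<in> carrier_mat 1 n" "A \<in> carrier_mat 1 n" "B \<in> carrier_mat 1 n" "C \<in> carrier_mat 1 n"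
        and e: "y \<cdot>\<^sub>m T = x \<cdot>\<^sub>m A + (x \<cdot>\<^sub>m B + y \<cdot>\<^sub>m C)" for T A B C n
    proof (rule eq_matI)
      fix i j assume "i < dim_row (x \<cdot>\<^sub>m (A + B))" "j < dim_col (x \<cdot>\<^sub>m (A + B))"
      moreover have "(y \<cdot>\<^sub>m T) $$ (i, j) = (x \<cdot>\<^sub>m A + (x \<cdot>\<^sub>m B + y \<cdot>\<^sub>m C)) $$ (i, j)" by (simp only: e)
      ultimately show "(y \<cdot>\<^sub>m (T - C)) $$ (i, j) = (x \<cdot>\<^sub>m (A + B)) $$ (i, j)"
        using that(1-4) by (simp add: algebra_simps)
    qed (use that in auto)
    from this[OF t fk ad bd eq2] show ?thesis .
  qed
  obtain c where c: "c \<in> carrier_mat 1 (rk P 1)" "\<theta> - b * df P 0 = x \<cdot>\<^sub>m c"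
    by (rule regular_mat2[OF _ minus_carrier_mat[OF bd] add_carrier_mat[OF ad] eq3])
      (rule reg2, assumption, rule that, assumption+)
  have "\<theta> = b * df P 0 + x \<cdot>\<^sub>m c"
  proof -
    have "T = C + (T - C)" if "T \<in> carrier_mat 1 n" "C \<in> carrier_mat 1 n" for T C :: "'a mat" and n
      using that by (intro eq_matI) auto
    from this[OF t bd] show ?thesis unfolding c(2) .
  qed
  with ab(2) c(1) show ?thesis by (rule that)
qed

text \<open>By the homotopy for \<open>x\<close>, \<open>x \<phi>\<close> is the coboundary of
  \<open>\<theta>\<close>, which is therefore a cocycle modulo \<open>x\<close>. Writing
  \<open>\<theta>\<close> as a coboundary plus \<open>x c\<close> leaves
  \<open>x \<phi> = x c d\<close>, and \<open>x\<close> cancels.\<close>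

lemma ext2:
  assumes t: "\<phi> \<in> carrier_mat 1 (rk P 2)" "\<phi> * df P 2 = 0\<^sub>m 1 (rk P 3)"
  obtains c where "c \<in> carrier_mat 1 (rk P 1)" "\<phi> = c * df P 1"
proof -
  obtain h0 h1 h2 where H: "htpy x h0 h1 h2" by (rule homotopy[OF xyz(1)])
  note h = htpyD(2,3)[OF H] htpyD(6)[OF H t(1)]
  define \<theta> where "\<theta> = \<phi> * h1"
  have \<theta>: "\<theta> \<in> carrier_mat 1 (rk P 1)" unfolding \<theta>_def using t(1) h(1) by (rule mult_carrier_mat)
  have x\<phi>: "\<theta> * df P 1 = x \<cdot>\<^sub>m \<phi>"
    using h(2,3) mult_carrier_mat[OF \<theta> d1] by (simp add: t(2) \<theta>_def del: One_nat_def)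
  obtain b c where b: "b \<in> carrier_mat 1 1" and c: "c \<in> carrier_mat 1 (rk P 1)"
    and \<theta>_eq: "\<theta> = b * df P 0 + x \<cdot>\<^sub>m c" by (rule ext1_mod[OF \<theta> t(1) x\<phi>])
  have xc: "x \<cdot>\<^sub>m c \<in> carrier_mat 1 (rk P 1)" using c by simp
  have "x \<cdot>\<^sub>m \<phi> = b * df P 0 * df P 1 + x \<cdot>\<^sub>m c * df P 1"
    unfolding x\<phi>[symmetric] \<theta>_eq by (rule add_mult_distrib_mat[OF mult_carrier_mat[OF b d0] xc d1])
  also have "b * df P 0 * df P 1 = 0\<^sub>m 1 (rk P 2)"
    unfolding assoc_mult_mat[OF b d0 d1] d01 using b by simp
  also have "0\<^sub>m 1 (rk P 2) + x \<cdot>\<^sub>m c * df P 1 = x \<cdot>\<^sub>m (c * df P 1)"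
    using mult_carrier_mat[OF c d1] by (simp add: mult_smult_assoc_mat[OF c d1] del: One_nat_def)
  finally have "x \<cdot>\<^sub>m \<phi> = x \<cdot>\<^sub>m (c * df P 1)" .
  with reg1 t(1) mult_carrier_mat[OF c d1] have "\<phi> = c * df P 1" by (rule regular_mat1)
  with c show ?thesis by (rule that)
qed

text \<open>The dual is numbered from the top of \<open>P\<close>, so \<open>ext2\<close>,
  \<open>ext1\<close>, \<open>ext0\<close> give exactness at positions 1, 2, 3. The homology at
  position 0, which is the third Ext module, may survive.\<close>

lemma acyclic_dual:
  assumes rk: "\<And>i. i > 3 \<Longrightarrow> rk P i = 0"
  shows "acyclic (dual 3 P)"
proof (rule acyclicI)
  let ?D = "dual 3 P"
  show D: "is_complex ?D" by (rule is_complex_dual[OF P(1)])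
  \<comment> \<open>Kernels and images consist of columns, the Ext lemmas speak of rows; this
    translates by transposition.\<close>
  have *: "v \<in> mat_image (transpose_mat e)"
    if ex: "\<And>\<phi>. \<phi> \<in> carrier_mat 1 n \<Longrightarrow> \<phi> * d = 0\<^sub>m 1 m \<Longrightarrow> \<exists>c. c \<in> carrier_mat 1 k \<and> \<phi> = c * e"
      and d: "d \<in> carrier_mat n m" and e: "e \<in> carrier_mat k n"
      and v: "v \<in> carrier_vec n" "transpose_mat d *\<^sub>v v = 0\<^sub>v m" for v :: "'a vec" and n m k d e
  proof -
    define \<phi> where "\<phi> = mat_of_rows n [v]"
    have \<phi>: "\<phi> \<in> carrier_mat 1 n" and row: "row \<phi> 0 = v"
      using mat_of_rows_carrier(1)[of n "[v]"] v by (simp_all add: \<phi>_def)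
    have "\<phi> * d = 0\<^sub>m 1 m"
    proof (rule eq_matI)
      fix i j assume "i < dim_row (0\<^sub>m 1 m :: 'a mat)" "j < dim_col (0\<^sub>m 1 m :: 'a mat)"
      then have ij: "i = 0" "j < m" by auto
      have "(transpose_mat d *\<^sub>v v) $ j = 0" using v(2) ij by simp
      then show "(\<phi> * d) $$ (i, j) = 0\<^sub>m 1 m $$ (i, j)"
        using \<phi> d ij v(1) row comm_scalar_prod[of v n "col d j"] by simp
    qed (use \<phi> d in auto)
    from ex[OF \<phi> this] obtain c where c: "c \<in> carrier_mat 1 k" "\<phi> = c * e" by blast
    have c0: "row c 0 \<in> carrier_vec k" using row_carrier[of c 0] carrier_matD(2)[OF c(1)] by simp
    have "v = transpose_mat e *\<^sub>v row c 0"
    proof (rule eq_vecI)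
      fix j assume "j < dim_vec (transpose_mat e *\<^sub>v row c 0)"
      then have j: "j < n" using e by simp
      have "v $ j = \<phi> $$ (0, j)" using row j \<phi> by auto
      then show "v $ j = (transpose_mat e *\<^sub>v row c 0) $ j"
        using c e j comm_scalar_prod[OF c0, of "col e j"] by simp
    qed (use v e in auto)
    then show ?thesis using mat_imageI[of "row c 0" "transpose_mat e"] c0 e by simp
  qed
  fix i v assume v: "v \<in> carrier_vec (rk ?D (Suc i))" "df ?D i *\<^sub>v v = 0\<^sub>v (rk ?D i)"
  have D_df: "df ?D 0 = transpose_mat (df P 2)" "df ?D 1 = transpose_mat (df P 1)"
    "df ?D 2 = transpose_mat (df P 0)" "df ?D 3 = 0\<^sub>m 1 0"
    and D_rk: "rk ?D 0 = rk P 3" "rk ?D 1 = rk P 2" "rk ?D 2 = rk P 1" "rk ?D 3 = 1"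
    using P(3) by (simp_all add: dual_def)
  consider "i = 0" | "i = 1" | "i = 2" | "i \<ge> 3" by linarith
  then have "v \<in> mat_image (df ?D (Suc i))"
  proof cases
    case 1
    have "v \<in> mat_image (transpose_mat (df P 1))"
    proof (rule *[OF _ d2 d1])
      show "\<exists>c. c \<in> carrier_mat 1 (rk P 1) \<and> \<phi> = c * df P 1"
        if "\<phi> \<in> carrier_mat 1 (rk P 2)" "\<phi> * df P 2 = 0\<^sub>m 1 (rk P 3)" for \<phi>
        using ext2[OF that] by blast
      show "v \<in> carrier_vec (rk P 2)" "transpose_mat (df P 2) *\<^sub>v v = 0\<^sub>v (rk P 3)"
        using v unfolding 1 One_nat_def[symmetric] D_df D_rk by blast+
    qed
    then show ?thesis unfolding 1 One_nat_def[symmetric] D_df .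
  next
    case 2
    have "v \<in> mat_image (transpose_mat (df P 0))"
    proof (rule *[OF _ d1 d0])
      show "\<exists>c. c \<in> carrier_mat 1 1 \<and> \<phi> = c * df P 0"
        if "\<phi> \<in> carrier_mat 1 (rk P 1)" "\<phi> * df P 1 = 0\<^sub>m 1 (rk P 2)" for \<phi>
        using ext1[OF that] by blast
      show "v \<in> carrier_vec (rk P 1)" "transpose_mat (df P 1) *\<^sub>v v = 0\<^sub>v (rk P 2)"
        using v unfolding 2 Suc_1 D_df D_rk by blast+
    qed
    then show ?thesis unfolding 2 Suc_1 D_df .
  next
    case 3
    have S2: "Suc 2 = 3" by simp
    \<comment> \<open>\<open>df ?D 3\<close> is the matrix with one row and no columns; written as a
      transpose it fits the common pattern, with an \<open>e\<close> that has no rows.\<close>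
    have "v \<in> mat_image (transpose_mat (0\<^sub>m 0 1))"
    proof (rule *[OF _ d0 zero_carrier_mat])
      show "\<exists>c. c \<in> carrier_mat 1 0 \<and> \<phi> = c * 0\<^sub>m 0 1"
        if "\<phi> \<in> carrier_mat 1 1" "\<phi> * df P 0 = 0\<^sub>m 1 (rk P 1)" for \<phi>
        using ext0[OF that] by (intro exI[of _ "0\<^sub>m 1 0"]) simp
      show "v \<in> carrier_vec 1" "transpose_mat (df P 0) *\<^sub>v v = 0\<^sub>v (rk P 1)"
        using v unfolding 3 S2 D_df D_rk by blast+
    qed
    moreover have "transpose_mat (0\<^sub>m 0 1) = (0\<^sub>m 1 0 :: 'a mat)" by (rule eq_matI) auto
    ultimately show ?thesis unfolding 3 S2 D_df by simp
  next
    case 4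
    then have D0: "df ?D (Suc i) = 0\<^sub>m 0 0" "rk ?D (Suc i) = 0" by (simp_all add: dual_def)
    then have "v = 0\<^sub>m 0 0 *\<^sub>v 0\<^sub>v 0" using v(1) by (intro eq_vecI) auto
    then show ?thesis unfolding D0 mat_image_def by auto
  qed
  then show "\<exists>u\<in>carrier_vec (rk ?D (Suc (Suc i))). v = df ?D (Suc i) *\<^sub>v u"
    by (auto simp: mat_image_def complexD(4)[OF D])
qed

end

subsection \<open>Uniqueness of minimal graded resolutions\<close>

text \<open>\<open>graded_complex\<close> with the degrees as a parameter, because those of duals,
  cones and comparison maps are computed from them.\<close>

definition graded_by :: "('v \<Rightarrow> nat) \<Rightarrow> (nat \<Rightarrow> nat \<Rightarrow> int) \<Rightarrow> ('v, 'k::comm_ring_1) mpoly cpx \<Rightarrow> bool" where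
  "graded_by w b C \<longleftrightarrow> (\<forall>i. \<forall>p<rk C i. \<forall>q<rk C (Suc i).
     homogeneous w (b (Suc i) q - b i p) (df C i $$ (p, q)))"

text \<open>The degree-preserving component of a map of graded free modules whose bases have degrees
  \<open>a\<close> (target) and \<open>c\<close> (source).\<close>

definition hpart :: "('v \<Rightarrow> nat) \<Rightarrow> (nat \<Rightarrow> int) \<Rightarrow> (nat \<Rightarrow> int) \<Rightarrow> ('v, 'k::comm_ring_1) mpoly mat \<Rightarrow> ('v, 'k) mpoly mat"
  where "hpart w a c X = mat (dim_row X) (dim_col X) (\<lambda>(p, q). hcomp w (c q - a p) (X $$ (p, q)))"

lemma hpart_carrier: "X \<in> carrier_mat n m \<Longrightarrow> hpart w a c X \<in> carrier_mat n m"
  by (simp add: hpart_def)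

lemma hpart_mult_left:
  assumes A: "A \<in> carrier_mat n m" and X: "X \<in> carrier_mat m k"
    and h: "\<And>p q. p < n \<Longrightarrow> q < m \<Longrightarrow> homogeneous w (c q - a p) (A $$ (p, q))"
  shows "A * hpart w c d X = hpart w a d (A * X)"
proof (rule eq_matI)
  fix p r assume "p < dim_row (hpart w a d (A * X))" "r < dim_col (hpart w a d (A * X))"
  then have pr: "p < n" "r < k" using A X by (auto simp: hpart_def)
  have "(A * hpart w c d X) $$ (p, r) = (\<Sum>q<m. A $$ (p, q) * hcomp w (d r - c q) (X $$ (q, r)))"
    using A X pr by (simp add: hpart_def scalar_prod_def atLeast0LessThan)
  also have "\<dots> = (\<Sum>q<m. hcomp w (d r - a p) (A $$ (p, q) * X $$ (q, r)))"
    using hcomp_mult'[OF h] pr by (intro sum.cong) auto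
  also have "\<dots> = hpart w a d (A * X) $$ (p, r)"
    using A X pr by (simp add: hpart_def scalar_prod_def atLeast0LessThan hcomp_sum)
  finally show "(A * hpart w c d X) $$ (p, r) = hpart w a d (A * X) $$ (p, r)" .
qed (use A X in \<open>auto simp: hpart_def\<close>)

lemma hpart_mult_right:
  assumes X: "X \<in> carrier_mat n m" and A: "A \<in> carrier_mat m k"
    and h: "\<And>p q. p < m \<Longrightarrow> q < k \<Longrightarrow> homogeneous w (d q - c p) (A $$ (p, q))"
  shows "hpart w a c X * A = hpart w a d (X * A)"
proof (rule eq_matI)
  fix p r assume "p < dim_row (hpart w a d (X * A))" "r < dim_col (hpart w a d (X * A))"
  then have pr: "p < n" "r < k" using A X by (auto simp: hpart_def)
  have "(hpart w a c X * A) $$ (p, r) = (\<Sum>q<m. hcomp w (c q - a p) (X $$ (p, q)) * A $$ (q, r))"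
    using A X pr by (simp add: hpart_def scalar_prod_def atLeast0LessThan)
  also have "\<dots> = (\<Sum>q<m. hcomp w (d r - a p) (X $$ (p, q) * A $$ (q, r)))"
    using hcomp_mult_right[OF h] pr by (intro sum.cong) auto
  also have "\<dots> = hpart w a d (X * A) $$ (p, r)"
    using A X pr by (simp add: hpart_def scalar_prod_def atLeast0LessThan hcomp_sum)
  finally show "(hpart w a c X * A) $$ (p, r) = hpart w a d (X * A) $$ (p, r)" .
qed (use A X in \<open>auto simp: hpart_def\<close>)

lemma chain_map_hpart:
  assumes C: "is_complex C" "graded_by w c C" and D: "is_complex D" "graded_by w d D"
    and f: "chain_map C D f"
  shows "chain_map C D (\<lambda>i. hpart w (d i) (c i) (f i))"
  unfolding chain_map_def
proof (intro conjI allI)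
  fix i
  note F = chain_mapD(1)[OF f]
  show "hpart w (d i) (c i) (f i) \<in> carrier_mat (rk D i) (rk C i)" by (rule hpart_carrier[OF F])
  have "hpart w (d i) (c i) (f i) * df C i = hpart w (d i) (c (Suc i)) (f i * df C i)"
    by (rule hpart_mult_right[OF F complexD(1)[OF C(1)]]) (use C(2) in \<open>simp add: graded_by_def\<close>)
  also have "\<dots> = df D i * hpart w (d (Suc i)) (c (Suc i)) (f (Suc i))"
    unfolding chain_mapD(2)[OF f]
    by (rule hpart_mult_left[symmetric, OF complexD(1)[OF D(1)] F]) (use D(2) in \<open>simp add: graded_by_def\<close>)
  finally show "hpart w (d i) (c i) (f i) * df C i = df D i * hpart w (d (Suc i)) (c (Suc i)) (f (Suc i))" .
qed

lemma homogeneous_det: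
  fixes A :: "('v, 'k::comm_ring_1) mpoly mat"
  assumes A: "A \<in> carrier_mat n n"
    and h: "\<And>p q. p < n \<Longrightarrow> q < n \<Longrightarrow> homogeneous w (c q - a p) (A $$ (p, q))"
  shows "homogeneous w (sum c {0..<n} - sum a {0..<n}) (det A)"
  unfolding det_def'[OF A]
proof (rule homogeneous_sum)
  fix \<pi> assume "\<pi> \<in> {\<pi>. \<pi> permutes {0..<n}}"
  then have \<pi>: "\<pi> permutes {0..<n}" by simp
  have "homogeneous w (\<Sum>i\<in>{0..<n}. c (\<pi> i) - a i) (\<Prod>i\<in>{0..<n}. A $$ (i, \<pi> i))"
    by (rule homogeneous_prod) (use h permutes_in_image[OF \<pi>] in auto)
  moreover have "(\<Sum>i\<in>{0..<n}. c (\<pi> i) - a i) = sum c {0..<n} - sum a {0..<n}"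
    using sum.permute[OF \<pi>, of c] by (simp add: sum_subtractf o_def)
  ultimately show "homogeneous w (sum c {0..<n} - sum a {0..<n}) (signof \<pi> * (\<Prod>i = 0..<n. A $$ (i, \<pi> i)))"
    by (cases "sign \<pi> = 1") (auto simp: sign_def homogeneous_uminus)
qed

section \<open>Reduction modulo the variables and comparison of resolutions\<close>

lemma comm_ring_hom_const_part: "comm_ring_hom (const_part :: ('v, 'k::comm_ring_1) mpoly \<Rightarrow> ('v, 'k) mpoly)"
  by (rule comm_ring_hom_subst_hom)

lemma const_part_mat_mult_irrelevant:
  fixes A B :: "('v, 'k::comm_ring_1) mpoly mat"
  assumes A: "A \<in> carrier_mat n m" and B: "B \<in> carrier_mat m k"
    and irr: "elements_mat A \<subseteq> irrelevant_ideal \<or> elements_mat B \<subseteq> irrelevant_ideal"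
  shows "map_mat const_part (A * B) = 0\<^sub>m n k"
proof (rule eq_matI)
  fix i j assume "i < dim_row (0\<^sub>m n k :: ('v, 'k) mpoly mat)" "j < dim_col (0\<^sub>m n k :: ('v, 'k) mpoly mat)"
  then have ij: "i < n" "j < k" by auto
  have "const_part (A $$ (i, q) * B $$ (q, j)) = 0" if "q < m" for q
  proof -
    have "A $$ (i, q) \<in> elements_mat A" "B $$ (q, j) \<in> elements_mat B"
      using A B ij that by (auto intro: elements_matI)
    then have "const_part (A $$ (i, q)) = 0 \<or> const_part (B $$ (q, j)) = 0"
      using irr by (auto intro: const_part_irrelevant)
    then show ?thesis by (auto simp: subst_mult)
  qed
  then have "const_part ((A * B) $$ (i, j)) = 0"
    using A B ij by (simp add: scalar_prod_def subst_sum)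
  then show "map_mat const_part (A * B) $$ (i, j) = 0\<^sub>m n k $$ (i, j)"
    using A B ij by simp
qed (use A B in auto)

lemma mat_image_eqI:
  fixes A B :: "'a::comm_ring_1 mat"
  assumes "dim_row A = 1" "dim_row B = 1"
    and im: "img0 A \<subseteq> img0 B"
  shows "mat_image A \<subseteq> mat_image B"
proof
  fix v assume v: "v \<in> mat_image A"
  then obtain u where u: "u \<in> mat_image B" "v $ 0 = u $ 0" using im by blast
  have "v = u" using u v assms(1,2) by (intro eq_vecI) (auto simp: mat_image_def)
  then show "v \<in> mat_image B" using u by simp
qed

text \<open>Only \<open>D\<close> has to be minimal. If \<open>f\<close> and \<open>g\<close> are comparison maps in both directions, then \<open>f g\<close> is
  homotopic to the identity of \<open>D\<close>, hence equal to it modulo the variables. As the ranks agree, the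
  determinants of \<open>f\<close> have nonzero constant terms; being homogeneous, they are units.\<close>

lemma isomorphic_resolutions:
  fixes C D :: "('v, 'k::field) mpoly cpx"
  assumes C: "is_complex C" "acyclic C" "graded_by w c C" and D: "is_complex D" "acyclic D" "graded_by w d D"
    and w: "\<And>x. w x > 0" and min: "\<And>i. elements_mat (df D i) \<subseteq> irrelevant_ideal"
    and rk: "\<And>i. rk C i = rk D i" "rk D 0 = 1"
    and im: "img0 (df C 0) = img0 (df D 0)"
  shows "isomorphic_complexes C D"
proof -
  have lift: "\<exists>f. chain_map E E' f \<and> f 0 = 1\<^sub>m 1"
    if E: "is_complex E" and E': "is_complex E'" "acyclic E'" and r: "rk E 0 = 1" "rk E' 0 = 1"
      and im: "img0 (df E 0) \<subseteq> img0 (df E' 0)"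
    for E E' :: "('v, 'k) mpoly cpx"
  proof -
    have e: "df E 0 \<in> carrier_mat 1 (rk E 1)" and e': "df E' 0 \<in> carrier_mat 1 (rk E' 1)"
      using complexD(1)[OF E, of 0] complexD(1)[OF E'(1), of 0] r by simp_all
    have "col (df E 0) j \<in> mat_image (df E' 0)" if "j < rk E 1" for j
    proof -
      have "col (df E 0) j = df E 0 *\<^sub>v unit_vec (rk E 1) j" using e that by (intro eq_vecI) auto
      also have "\<dots> \<in> mat_image (df E 0)" using e by (intro mat_imageI) simp
      also have "\<dots> \<subseteq> mat_image (df E' 0)" by (rule mat_image_eqI[OF _ _ im]) (use e e' in auto)
      finally show ?thesis .
    qed
    then obtain f1 where f1: "f1 \<in> carrier_mat (rk E' 1) (rk E 1)" "df E 0 = df E' 0 * f1"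
      using mat_factor[OF e e'] by blast
    have "1\<^sub>m 1 * df E 0 = df E' 0 * f1" unfolding left_mult_one_mat[OF e] by (rule f1(2))
    obtain f where "chain_map E E' f" "f 0 = 1\<^sub>m 1"
      by (rule chain_map_lift[OF E E' _ f1(1) \<open>1\<^sub>m 1 * df E 0 = df E' 0 * f1\<close>]) (simp add: r, rule that)
    then show ?thesis by blast
  qed
  obtain f' where f': "chain_map C D f'" "f' 0 = 1\<^sub>m 1" using lift[OF C(1) D(1,2)] rk im by auto
  obtain g where g: "chain_map D C g" "g 0 = 1\<^sub>m 1" using lift[OF D(1) C(1,2)] rk im by auto
  \<comment> \<open>The degrees of \<open>D\<close> are shifted so that the generators in
    homological degree 0 have equal degrees; otherwise the homogeneous part of the identity
    \<open>f' 0\<close> would be zero.\<close>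
  define d' where "d' i p = d i p + (c 0 0 - d 0 0)" for i p
  have D': "graded_by w d' D" using D(3) by (simp add: graded_by_def d'_def)
  define f where "f i = hpart w (d' i) (c i) (f' i)" for i
  have f: "chain_map C D f" unfolding f_def by (rule chain_map_hpart[OF C(1,3) D(1) D' f'(1)])
  have f0: "f 0 = 1\<^sub>m 1"
    unfolding f_def f'(2) hpart_def
    by (rule eq_matI) (auto simp: d'_def hcomp_homogeneous[OF homogeneous_Const[of _ 1, unfolded Const_1]] hcomp_0)
  note F = chain_mapD(1)[OF f, unfolded rk(1)] and G = chain_mapD(1)[OF g(1), unfolded rk(1)]
  note fg = chain_map_comp[OF D(1) C(1) D(1) g(1) f]
  have e: "chain_map D D (\<lambda>i. f i * g i - 1\<^sub>m (rk D i))"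
    by (rule chain_map_diff[OF D(1) D(1) fg chain_map_id[OF D(1)]])
  \<comment> \<open>Both maps are identities in degree 0, so the homotopy may begin with zero. In
    higher degrees each of its two terms has a differential of \<open>D\<close> as a factor and
    vanishes modulo the variables.\<close>
  have e0: "f 0 * g 0 - 1\<^sub>m (rk D 0) = df D 0 * 0\<^sub>m (rk D 1) (rk D 0)"
    using rk complexD(1)[OF D(1), of 0] by (simp add: f0 g(2))
  obtain h where h: "\<And>i. h i \<in> carrier_mat (rk D (Suc i)) (rk D i)"
    "\<And>i. f (Suc i) * g (Suc i) - 1\<^sub>m (rk D (Suc i)) = df D (Suc i) * h (Suc i) + h i * df D i"
    by (rule chain_map_homotopy[OF D(1) D(1,2) e zero_carrier_mat e0]) (rule that)
  interpret cp: comm_ring_hom "const_part :: ('v, 'k) mpoly \<Rightarrow> ('v, 'k) mpoly" by (rule comm_ring_hom_const_part)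
  have one: "map_mat const_part (f i) * map_mat const_part (g i) = 1\<^sub>m (rk D i)" for i
  proof -
    have fgc: "f i * g i \<in> carrier_mat (rk D i) (rk D i)" using F G by (rule mult_carrier_mat)
    have "map_mat const_part (f i * g i) = 1\<^sub>m (rk D i)"
    proof (cases i)
      case 0
      then show ?thesis using rk by (simp add: f0 g(2) cp.mat_hom_one)
    next
      case (Suc j)
      have z: "map_mat const_part (df D i * h i) = 0\<^sub>m (rk D i) (rk D i)"
        "map_mat const_part (h j * df D j) = 0\<^sub>m (rk D i) (rk D i)"
        using const_part_mat_mult_irrelevant[OF complexD(1)[OF D(1)] h(1), of i]
          const_part_mat_mult_irrelevant[OF h(1) complexD(1)[OF D(1)], of j] min Suc by auto
      have dc: "df D i * h i \<in> carrier_mat (rk D i) (rk D i)" "h j * df D j \<in> carrier_mat (rk D i) (rk D i)"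
        using mult_carrier_mat[OF complexD(1)[OF D(1)] h(1), of i]
          mult_carrier_mat[OF h(1) complexD(1)[OF D(1)], of j] Suc by auto
      show ?thesis
      proof (rule eq_matI)
        fix p q assume "p < dim_row (1\<^sub>m (rk D i) :: ('v, 'k) mpoly mat)" "q < dim_col (1\<^sub>m (rk D i) :: ('v, 'k) mpoly mat)"
        then have pq: "p < rk D i" "q < rk D i" by auto
        have "(f i * g i - 1\<^sub>m (rk D i)) $$ (p, q) = (df D i * h i + h j * df D j) $$ (p, q)"
          unfolding Suc h(2) by simp
        then have "(f i * g i) $$ (p, q) = 1\<^sub>m (rk D i) $$ (p, q) + ((df D i * h i) $$ (p, q) + (h j * df D j) $$ (p, q))"
          using pq carrier_matD[OF dc(1)] carrier_matD[OF dc(2)] carrier_matD[OF fgc]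
          by (simp only: index_minus_mat index_add_mat one_carrier_mat[THEN carrier_matD(1)]
             one_carrier_mat[THEN carrier_matD(2)]) (simp only: diff_eq_eq add.commute)
        moreover have "const_part ((df D i * h i) $$ (p, q)) = 0" "const_part ((h j * df D j) $$ (p, q)) = 0"
          using arg_cong[OF z(1), of "\<lambda>A. A $$ (p, q)"] arg_cong[OF z(2), of "\<lambda>A. A $$ (p, q)"] pq
            carrier_matD[OF dc(1)] carrier_matD[OF dc(2)] by (simp_all only: index_map_mat index_zero_mat)
        moreover have "const_part (1\<^sub>m (rk D i) $$ (p, q)) = 1\<^sub>m (rk D i) $$ (p, q)"
          using pq by (simp add: subst_simps)
        ultimately show "map_mat const_part (f i * g i) $$ (p, q) = 1\<^sub>m (rk D i) $$ (p, q)"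
          using pq carrier_matD[OF fgc] by (simp only: index_map_mat subst_add add_0_right)
      qed (use carrier_matD[OF fgc] in \<open>simp_all only: index_map_mat index_one_mat\<close>)
    qed
    then show ?thesis by (simp only: cp.mat_hom_mult[OF F G])
  qed
  have "\<exists>u. det (f i) * u = 1" for i
  proof -
    have cF: "map_mat const_part (f i) \<in> carrier_mat (rk D i) (rk D i)"
      and cG: "map_mat const_part (g i) \<in> carrier_mat (rk D i) (rk D i)" using F G by auto
    have "const_part (det (f i)) * const_part (det (g i)) = 1"
      unfolding cp.hom_det[symmetric] det_mult[OF cF cG, symmetric] one by simp
    then have cp: "const_part (det (f i)) \<noteq> 0" by auto
    have h: "homogeneous w (sum (c i) {0..<rk D i} - sum (d' i) {0..<rk D i}) (det (f i))"
    proof (rule homogeneous_det[OF F])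
      fix p q assume "p < rk D i" "q < rk D i"
      then show "homogeneous w (c i q - d' i p) (f i $$ (p, q))"
        using chain_mapD(1)[OF f'(1), of i] rk by (simp add: f_def hpart_def homogeneous_hcomp)
    qed
    obtain u where "det (f i) * u = 1" by (rule homogeneous_unit[OF h w cp])
    then show ?thesis by blast
  qed
  then obtain u where u: "\<And>i. det (f i) * u i = 1" by metis
  define v where "v i = u i \<cdot>\<^sub>m adj_mat (f i)" for i
  have V: "v i \<in> carrier_mat (rk D i) (rk D i)" for i using adj_mat(1)[OF F] by (simp add: v_def)
  have fv: "f i * v i = 1\<^sub>m (rk D i)" "v i * f i = 1\<^sub>m (rk D i)" for i
  proof -
    have "f i * v i = u i \<cdot>\<^sub>m (det (f i) \<cdot>\<^sub>m 1\<^sub>m (rk D i))"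
      unfolding v_def mult_smult_distrib[OF F adj_mat(1)[OF F]] adj_mat(2)[OF F] ..
    moreover have "v i * f i = u i \<cdot>\<^sub>m (det (f i) \<cdot>\<^sub>m 1\<^sub>m (rk D i))"
      unfolding v_def mult_smult_assoc_mat[OF adj_mat(1)[OF F] F] adj_mat(3)[OF F] ..
    moreover have "u i \<cdot>\<^sub>m (det (f i) \<cdot>\<^sub>m 1\<^sub>m (rk D i)) = 1\<^sub>m (rk D i)"
      using u[of i] by (intro eq_matI) (auto simp: mult.commute)
    ultimately show "f i * v i = 1\<^sub>m (rk D i)" "v i * f i = 1\<^sub>m (rk D i)" by simp_all
  qed
  show ?thesis by (rule isomorphic_complexesI[OF C(1) D(1) f, of v]) (simp_all only: rk(1) V fv)
qed

subsection \<open>Base change of exact complexes\<close>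

text \<open>A free extension \<open>S\<close> of \<open>R\<close> with basis \<open>e\<close>, where \<open>coef \<mu>\<close> is the coordinate of \<open>e \<mu>\<close>.\<close>

lemma acyclic_free_extension:
  fixes h :: "'a::comm_ring_1 \<Rightarrow> 'b::comm_ring_1" and coef :: "'m \<Rightarrow> 'b \<Rightarrow> 'a" and e :: "'m \<Rightarrow> 'b"
  assumes h: "comm_ring_hom h" and C: "is_complex C" "acyclic C"
    and coef_add: "\<And>\<mu> s t. coef \<mu> (s + t) = coef \<mu> s + coef \<mu> t"
    and coef_mult: "\<And>\<mu> a s. coef \<mu> (h a * s) = a * coef \<mu> s"
    and expand: "\<And>s. \<exists>A. finite A \<and> (\<forall>B. finite B \<longrightarrow> A \<subseteq> B \<longrightarrow> s = (\<Sum>\<mu>\<in>B. h (coef \<mu> s) * e \<mu>))"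
  shows "acyclic (base_change h C)"
proof (rule acyclicI)
  interpret h: comm_ring_hom h by (rule h)
  show D: "is_complex (base_change h C)" by (rule is_complex_base_change[OF h C(1)])
  have coef_0: "coef \<mu> 0 = 0" for \<mu> using coef_mult[of \<mu> 0 0] by simp
  have coef_sum: "coef \<mu> (sum g X) = (\<Sum>x\<in>X. coef \<mu> (g x))" for \<mu> X and g :: "nat \<Rightarrow> 'b"
    by (induction X rule: infinite_finite_induct) (simp_all add: coef_0 coef_add)
  fix i y
  let ?n = "rk C (Suc i)" and ?m = "rk C (Suc (Suc i))" and ?d = "df C i" and ?d' = "df C (Suc i)"
  assume "y \<in> carrier_vec (rk (base_change h C) (Suc i))"
    and "df (base_change h C) i *\<^sub>v y = 0\<^sub>v (rk (base_change h C) i)"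
  then have y: "y \<in> carrier_vec ?n" "map_mat h ?d *\<^sub>v y = 0\<^sub>v (rk C i)" by (simp_all add: base_change_def)
  have d: "?d \<in> carrier_mat (rk C i) ?n" and d': "?d' \<in> carrier_mat ?n ?m" by (rule complexD(1)[OF C(1)])+
  have "\<exists>u. u \<in> carrier_vec ?m \<and> vec ?n (\<lambda>q. coef \<mu> (y $ q)) = ?d' *\<^sub>v u" for \<mu>
  proof -
    have "?d *\<^sub>v vec ?n (\<lambda>q. coef \<mu> (y $ q)) = 0\<^sub>v (rk C i)"
    proof (rule eq_vecI)
      fix p assume "p < dim_vec (0\<^sub>v (rk C i) :: 'a vec)"
      then have p: "p < rk C i" by simp
      have "(?d *\<^sub>v vec ?n (\<lambda>q. coef \<mu> (y $ q))) $ p = (\<Sum>q = 0..<?n. ?d $$ (p, q) * coef \<mu> (y $ q))"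
        using d p by (simp add: scalar_prod_def)
      also have "\<dots> = coef \<mu> (\<Sum>q = 0..<?n. h (?d $$ (p, q)) * y $ q)"
        by (simp add: coef_sum coef_mult)
      also have "(\<Sum>q = 0..<?n. h (?d $$ (p, q)) * y $ q) = (map_mat h ?d *\<^sub>v y) $ p"
        using d p y(1) by (simp add: scalar_prod_def)
      also have "\<dots> = 0" using p y(2) by simp
      finally show "(?d *\<^sub>v vec ?n (\<lambda>q. coef \<mu> (y $ q))) $ p = 0\<^sub>v (rk C i) $ p" using p coef_0 by simp
    qed (use d in simp)
    from acyclicD[OF C _ this] show ?thesis by (metis vec_carrier)
  qed
  then obtain u where u: "\<And>\<mu>. u \<mu> \<in> carrier_vec ?m" "\<And>\<mu>. vec ?n (\<lambda>q. coef \<mu> (y $ q)) = ?d' *\<^sub>v u \<mu>" by metis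
  have "\<exists>A. \<forall>q. finite (A q) \<and> (\<forall>B. finite B \<longrightarrow> A q \<subseteq> B \<longrightarrow> y $ q = (\<Sum>\<mu>\<in>B. h (coef \<mu> (y $ q)) * e \<mu>))"
    by (rule choice) (use expand in blast)
  then obtain A where A: "\<And>q. finite (A q)"
    "\<And>q B. finite B \<Longrightarrow> A q \<subseteq> B \<Longrightarrow> y $ q = (\<Sum>\<mu>\<in>B. h (coef \<mu> (y $ q)) * e \<mu>)" by blast
  \<comment> \<open>One finite index set has to serve all entries of \<open>y\<close>; this is why
    \<open>expand\<close> speaks of all finite supersets of \<open>A\<close>.\<close>
  define B where "B = (\<Union>q<?n. A q)"
  have B: "finite B" using A(1) by (simp add: B_def)
  define x where "x = vec ?m (\<lambda>r. \<Sum>\<mu>\<in>B. h (u \<mu> $ r) * e \<mu>)"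
  have "y = map_mat h ?d' *\<^sub>v x"
  proof (rule eq_vecI)
    fix q assume "q < dim_vec (map_mat h ?d' *\<^sub>v x)"
    then have q: "q < ?n" using d' by simp
    have c: "coef \<mu> (y $ q) = (\<Sum>r = 0..<?m. ?d' $$ (q, r) * u \<mu> $ r)" for \<mu>
    proof -
      have "coef \<mu> (y $ q) = (?d' *\<^sub>v u \<mu>) $ q" using q by (simp add: u(2)[symmetric])
      then show ?thesis using q d' u(1)[of \<mu>] by (simp add: scalar_prod_def)
    qed
    have "y $ q = (\<Sum>\<mu>\<in>B. h (coef \<mu> (y $ q)) * e \<mu>)"
      by (rule A(2)[OF B]) (use q in \<open>auto simp: B_def\<close>)
    also have "\<dots> = (\<Sum>\<mu>\<in>B. \<Sum>r = 0..<?m. h (?d' $$ (q, r)) * (h (u \<mu> $ r) * e \<mu>))"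
      by (simp add: c h.hom_sum h.hom_mult sum_distrib_right mult.assoc)
    also have "\<dots> = (\<Sum>r = 0..<?m. h (?d' $$ (q, r)) * (\<Sum>\<mu>\<in>B. h (u \<mu> $ r) * e \<mu>))"
      by (subst sum.swap) (simp add: sum_distrib_left)
    also have "\<dots> = (map_mat h ?d' *\<^sub>v x) $ q"
      using q d' by (simp add: x_def scalar_prod_def)
    finally show "y $ q = (map_mat h ?d' *\<^sub>v x) $ q" .
  qed (use d' y in simp)
  moreover have "x \<in> carrier_vec ?m" by (simp add: x_def)
  ultimately show "\<exists>u\<in>carrier_vec (rk (base_change h C) (Suc (Suc i))). y = df (base_change h C) (Suc i) *\<^sub>v u"
    by (auto simp: base_change_def)
qed

lemma mult_mat_vec_smult:
  fixes A :: "'a::comm_ring_1 mat"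
  assumes "A \<in> carrier_mat n m" "v \<in> carrier_vec m"
  shows "A *\<^sub>v (k \<cdot>\<^sub>v v) = k \<cdot>\<^sub>v (A *\<^sub>v v)"
  using assms by (intro eq_vecI) (auto simp: scalar_prod_def sum_distrib_left mult.left_commute)

text \<open>A resolution stays exact modulo an element \<open>x\<close> regular on the ring and on
  the resolved quotient. A cycle modulo \<open>x\<close> lifts to \<open>yl\<close> with
  \<open>d yl = x z\<close>; then \<open>z\<close> is a boundary \<open>d w\<close>, by exactness
  or, in degree 0, by \<open>nzd_mod\<close>, and \<open>yl - x w\<close> is a true cycle lifting
  the same element.\<close>

lemma acyclic_quotient:
  fixes h :: "'a::comm_ring_1 \<Rightarrow> 'b::comm_ring_1"
  assumes h: "comm_ring_hom h" and C: "is_complex C" "acyclic C" "rk C 0 = 1"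
    and sec: "\<And>p. h (s p) = p" and ker: "\<And>p. h p = 0 \<Longrightarrow> \<exists>q. p = x * q" and x: "h x = 0"
    and nzd: "\<And>p. x * p = 0 \<Longrightarrow> p = 0"
    and nzd_mod: "\<And>p. x * p \<in> img0 (df C 0) \<Longrightarrow> p \<in> img0 (df C 0)"
  shows "acyclic (base_change h C)"
proof (rule acyclicI)
  interpret h: comm_ring_hom h by (rule h)
  show D: "is_complex (base_change h C)" by (rule is_complex_base_change[OF h C(1)])
  fix i y
  let ?n = "rk C (Suc i)" and ?m = "rk C (Suc (Suc i))" and ?d = "df C i" and ?d' = "df C (Suc i)"
  assume "y \<in> carrier_vec (rk (base_change h C) (Suc i))"
    and "df (base_change h C) i *\<^sub>v y = 0\<^sub>v (rk (base_change h C) i)"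
  then have y: "y \<in> carrier_vec ?n" "map_mat h ?d *\<^sub>v y = 0\<^sub>v (rk C i)" by (simp_all add: base_change_def)
  have d: "?d \<in> carrier_mat (rk C i) ?n" and d': "?d' \<in> carrier_mat ?n ?m" by (rule complexD(1)[OF C(1)])+
  define yl where "yl = map_vec s y"
  have yl: "yl \<in> carrier_vec ?n" "map_vec h yl = y" using y(1) by (auto simp: yl_def sec)
  have dyl: "?d *\<^sub>v yl \<in> carrier_vec (rk C i)" by (rule mult_mat_vec_carrier[OF d yl(1)])
  have "map_vec h (?d *\<^sub>v yl) = 0\<^sub>v (rk C i)" using h.mult_mat_vec_hom[OF d yl(1)] yl(2) y(2) by simp
  then have "\<exists>q. (?d *\<^sub>v yl) $ p = x * q" if "p < rk C i" for p
    using ker dyl that by (metis index_map_vec(1) index_zero_vec(1) carrier_vecD)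
  then obtain z0 where z0: "\<And>p. p < rk C i \<Longrightarrow> (?d *\<^sub>v yl) $ p = x * z0 p" by metis
  define z where "z = vec (rk C i) z0"
  have z: "z \<in> carrier_vec (rk C i)" "?d *\<^sub>v yl = x \<cdot>\<^sub>v z"
    using z0 carrier_vecD[OF dyl] by (auto simp: z_def intro!: eq_vecI)
  have "z \<in> mat_image ?d"
  proof (cases i)
    case 0
    have "x * z $ 0 = (?d *\<^sub>v yl) $ 0" using z C(3) 0 by simp
    moreover have "?d *\<^sub>v yl \<in> mat_image ?d" using yl(1) d by (intro mat_imageI) simp
    ultimately have "x * z $ 0 \<in> img0 (df C 0)" using 0 by auto
    from nzd_mod[OF this] obtain v where v: "v \<in> mat_image ?d" "z $ 0 = v $ 0" using 0 by auto
    then have "z = v" using z(1) C(3) 0 d by (intro eq_vecI) (auto simp: mat_image_def)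
    then show ?thesis using v by simp
  next
    case (Suc j)
    have e: "df C j \<in> carrier_mat (rk C j) (rk C i)" using complexD(1)[OF C(1), of j] Suc by simp
    have "x \<cdot>\<^sub>v (df C j *\<^sub>v z) = df C j *\<^sub>v (x \<cdot>\<^sub>v z)" by (rule mult_mat_vec_smult[OF e z(1), symmetric])
    also have "\<dots> = df C j * ?d *\<^sub>v yl" unfolding z(2)[symmetric] by (rule assoc_mult_mat_vec[OF e d yl(1), symmetric])
    also have "\<dots> = 0\<^sub>v (rk C j)" using yl(1) complexD(2)[OF C(1), of j] Suc by (simp add: zero_mat_mult_vec)
    finally have xz: "x \<cdot>\<^sub>v (df C j *\<^sub>v z) = 0\<^sub>v (rk C j)" .
    have "df C j *\<^sub>v z = 0\<^sub>v (rk C j)"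
    proof (rule eq_vecI)
      fix p assume "p < dim_vec (0\<^sub>v (rk C j) :: 'a vec)"
      then have p: "p < rk C j" by simp
      have "(x \<cdot>\<^sub>v (df C j *\<^sub>v z)) $ p = 0" using xz p by simp
      then have "x * (df C j *\<^sub>v z) $ p = 0" using p e by simp
      then show "(df C j *\<^sub>v z) $ p = 0\<^sub>v (rk C j) $ p" using nzd p by simp
    qed (use e in simp)
    then have "z \<in> mat_ker (df C j)" using z(1) e by (simp add: mat_ker_def)
    then show ?thesis using C(2) Suc by simp
  qed
  then obtain w where w: "w \<in> carrier_vec ?n" "z = ?d *\<^sub>v w" using d by (auto simp: mat_image_def)
  have xw: "x \<cdot>\<^sub>v w \<in> carrier_vec ?n" using w(1) by simp
  have "?d *\<^sub>v (yl - x \<cdot>\<^sub>v w) = ?d *\<^sub>v yl - ?d *\<^sub>v (x \<cdot>\<^sub>v w)" by (rule mult_minus_distrib_mat_vec[OF d yl(1) xw])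
  also have "\<dots> = 0\<^sub>v (rk C i)" unfolding z(2) mult_mat_vec_smult[OF d w(1)] w(2) using mult_mat_vec_carrier[OF d w(1)] by simp
  finally obtain u where u: "u \<in> carrier_vec ?m" "yl - x \<cdot>\<^sub>v w = ?d' *\<^sub>v u"
    using acyclicD[OF C(1,2) minus_carrier_vec[OF yl(1) xw]] by metis
  have "y = map_vec h (yl - x \<cdot>\<^sub>v w)"
    using yl w(1) by (intro eq_vecI) (auto simp: h.hom_minus h.hom_mult x)
  also have "\<dots> = map_mat h ?d' *\<^sub>v map_vec h u" unfolding u(2) by (rule h.mult_mat_vec_hom[OF d' u(1)])
  finally show "\<exists>u\<in>carrier_vec (rk (base_change h C) (Suc (Suc i))). y = df (base_change h C) (Suc i) *\<^sub>v u"
    using u(1) by (auto simp: base_change_def)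
qed

subsection \<open>Coefficients with respect to the variables \<open>\<tau>\<close>\<close>

lift_definition bpart :: "(tvar \<Rightarrow>\<^sub>0 nat) \<Rightarrow> (rvar \<Rightarrow>\<^sub>0 nat)" is "\<lambda>m x. m (Base x)"
proof -
  fix m :: "tvar \<Rightarrow> nat" assume "finite {x. m x \<noteq> 0}"
  then have "finite (Base -` {x. m x \<noteq> 0})" by (rule finite_vimageI) (simp add: inj_def)
  then show "finite {x. m (Base x) \<noteq> 0}" by (simp add: vimage_def)
qed

text \<open>The part in the \<open>\<tau>\<close> stays a monomial over \<open>tvar\<close>, so that
  it is itself the basis element of \<open>R[\<tau>]\<close> over \<open>R\<close> that it
  indexes.\<close>

lift_definition tpart :: "(tvar \<Rightarrow>\<^sub>0 nat) \<Rightarrow> (tvar \<Rightarrow>\<^sub>0 nat)" is "\<lambda>m v. if v \<in> range Base then 0 else m v"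
  by (rule finite_subset) auto

definition emb :: "(rvar \<Rightarrow>\<^sub>0 nat) \<Rightarrow> (tvar \<Rightarrow>\<^sub>0 nat)" where
  "emb n = (\<Sum>x\<in>Poly_Mapping.keys n. Poly_Mapping.single (Base x) (Poly_Mapping.lookup n x))"

lemma lookup_emb: "Poly_Mapping.lookup (emb n) v = (case v of Base x \<Rightarrow> Poly_Mapping.lookup n x | _ \<Rightarrow> 0)"
  by (auto simp: emb_def lookup_sum lookup_single when_def sum.delta in_keys_iff split: tvar.splits)

lemma lookup_bpart: "Poly_Mapping.lookup (bpart m) x = Poly_Mapping.lookup m (Base x)" by transfer simp
lemma lookup_tpart: "Poly_Mapping.lookup (tpart m) v = (if v \<in> range Base then 0 else Poly_Mapping.lookup m v)" by transfer simp

lemma bpart_emb_add: "bpart (emb n + m) = n + bpart m"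
  by (rule poly_mapping_eqI) (simp add: lookup_bpart lookup_add lookup_emb)

lemma tpart_emb_add: "tpart (emb n + m) = tpart m"
  by (rule poly_mapping_eqI) (auto simp: lookup_tpart lookup_add lookup_emb split: tvar.splits)

lemma emb_bpart_tpart: "emb (bpart m) + tpart m = m"
  by (rule poly_mapping_eqI) (auto simp: lookup_tpart lookup_bpart lookup_add lookup_emb split: tvar.splits)

lemma extend_single: "extend (Poly_Mapping.single n a) = Poly_Mapping.single (emb n) a"
proof -
  have pow: "(Var x :: (tvar, 'a) mpoly) ^ k = Poly_Mapping.single (Poly_Mapping.single x k) 1" for x k
    by (induction k) (simp_all add: Var_def mult_single single_add[symmetric])
  have prod: "(\<Prod>x\<in>A. Poly_Mapping.single (g x) (1::'a)) = Poly_Mapping.single (sum g A) 1"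
    for A and g :: "rvar \<Rightarrow> tvar \<Rightarrow>\<^sub>0 nat"
    by (induction A rule: infinite_finite_induct) (simp_all add: mult_single)
  show ?thesis unfolding extend_def subst_single monom_value_def pow prod
    by (simp add: emb_def Const_def mult_single)
qed

text \<open>The coordinate at the basis element \<open>\<mu>\<close> of the free
  \<open>R\<close>-module \<open>R[\<tau>]\<close>; it is 0 when \<open>\<mu>\<close> involves a
  variable of \<open>R\<close>.\<close>

definition tcoef :: "(tvar \<Rightarrow>\<^sub>0 nat) \<Rightarrow> (tvar, 'k::field) mpoly \<Rightarrow> (rvar, 'k) mpoly" where
  "tcoef \<mu> p = (\<Sum>m\<in>Poly_Mapping.keys p. if tpart m = \<mu> then Poly_Mapping.single (bpart m) (Poly_Mapping.lookup p m) else 0)"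

lemma tcoef_superset:
  assumes "finite A" "Poly_Mapping.keys p \<subseteq> A"
  shows "tcoef \<mu> p = (\<Sum>m\<in>A. if tpart m = \<mu> then Poly_Mapping.single (bpart m) (Poly_Mapping.lookup p m) else 0)"
  unfolding tcoef_def by (rule sum.mono_neutral_left) (use assms in \<open>auto simp: in_keys_iff\<close>)

lemma tcoef_add: "tcoef \<mu> (p + q) = tcoef \<mu> p + tcoef \<mu> q"
proof -
  let ?A = "Poly_Mapping.keys p \<union> Poly_Mapping.keys q"
  have "Poly_Mapping.keys (p + q) \<subseteq> ?A" by (rule Poly_Mapping.keys_add)
  then show ?thesis
    by (simp add: tcoef_superset[of ?A] lookup_add single_add if_distrib sum.distrib[symmetric] cong: if_cong)
qed

lemma tcoef_single: "tcoef \<mu> (Poly_Mapping.single m a) = (if tpart m = \<mu> then Poly_Mapping.single (bpart m) a else 0)"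
  using tcoef_superset[of "{m}" "Poly_Mapping.single m a" \<mu>] by auto

lemma extend_add: "extend (p + q) = extend p + extend q" by (simp add: extend_def subst_add)
lemma extend_0: "extend 0 = 0" by (simp add: extend_def subst_0)

lemma tcoef_extend_mult: "tcoef \<mu> (extend a * p) = a * tcoef \<mu> p"
proof (induction a rule: mpoly_sum_induct)
  case (single n c)
  show ?case
    by (induction p rule: mpoly_sum_induct)
      (auto simp: extend_single mult_single tcoef_single tpart_emb_add bpart_emb_add distrib_left tcoef_add)
qed (simp add: extend_add distrib_right tcoef_add)

lemma tcoef_expand:
  assumes "finite B" "tpart ` Poly_Mapping.keys p \<subseteq> B"
  shows "p = (\<Sum>\<mu>\<in>B. extend (tcoef \<mu> p) * Poly_Mapping.single \<mu> 1)"
proof -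
  have "(\<Sum>\<mu>\<in>B. extend (tcoef \<mu> p) * Poly_Mapping.single \<mu> 1)
    = (\<Sum>\<mu>\<in>B. \<Sum>m\<in>Poly_Mapping.keys p. if tpart m = \<mu> then Poly_Mapping.single m (Poly_Mapping.lookup p m) else 0)"
  proof (rule sum.cong[OF refl])
    fix \<mu>
    have "extend (tcoef \<mu> p) = (\<Sum>m\<in>Poly_Mapping.keys p. if tpart m = \<mu> then Poly_Mapping.single (emb (bpart m)) (Poly_Mapping.lookup p m) else 0)"
      unfolding tcoef_def by (simp add: extend_def subst_sum if_distrib subst_0 extend_single[unfolded extend_def] cong: if_cong)
    then show "extend (tcoef \<mu> p) * Poly_Mapping.single \<mu> 1 =
        (\<Sum>m\<in>Poly_Mapping.keys p. if tpart m = \<mu> then Poly_Mapping.single m (Poly_Mapping.lookup p m) else 0)"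
      by (simp add: sum_distrib_right) (rule sum.cong, auto simp: mult_single emb_bpart_tpart)
  qed
  also have "\<dots> = (\<Sum>m\<in>Poly_Mapping.keys p. \<Sum>\<mu>\<in>B. if tpart m = \<mu> then Poly_Mapping.single m (Poly_Mapping.lookup p m) else 0)"
    by (rule sum.swap)
  also have "\<dots> = (\<Sum>m\<in>Poly_Mapping.keys p. Poly_Mapping.single m (Poly_Mapping.lookup p m))"
    using assms by (intro sum.cong) (auto simp: sum.delta')
  also have "\<dots> = p" by (rule poly_sum_single[symmetric])
  finally show ?thesis by simp
qed

lemma comm_ring_hom_extend: "comm_ring_hom extend"
  unfolding extend_def by (rule comm_ring_hom_subst_hom)

lemma acyclic_extend:
  fixes F :: "(rvar, 'k::field) mpoly cpx"
  assumes "is_complex F" "acyclic F" shows "acyclic (base_change extend F)"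
proof (rule acyclic_free_extension[OF comm_ring_hom_extend assms tcoef_add tcoef_extend_mult])
  show "\<exists>A. finite A \<and> (\<forall>B. finite B \<longrightarrow> A \<subseteq> B \<longrightarrow> s = (\<Sum>\<mu>\<in>B. extend (tcoef \<mu> s) * Poly_Mapping.single \<mu> 1))"
    for s :: "(tvar, 'k) mpoly"
    by (rule exI[of _ "tpart ` Poly_Mapping.keys s"]) (auto intro: tcoef_expand)
qed

section \<open>The ideals of the almost complete intersection\<close>

instance rvar :: countable by countable_datatype
instance tvar :: countable by countable_datatype

text \<open>The order is arbitrary. It only serves to make the polynomial ring an instance of \<^class>\<open>idom\<close>.\<close>

instantiation tvar :: linorder
begin
definition less_eq_tvar :: "tvar \<Rightarrow> tvar \<Rightarrow> bool" where "less_eq_tvar x y \<longleftrightarrow> to_nat x \<le> to_nat y"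
definition less_tvar :: "tvar \<Rightarrow> tvar \<Rightarrow> bool" where "less_tvar x y \<longleftrightarrow> to_nat x < to_nat y"
instance by standard (auto simp: less_eq_tvar_def less_tvar_def)
end

subsection \<open>Non-zero-divisors modulo ideals\<close>

lemma hcomp_all_0: "(\<And>n::nat. hcomp w (int n) p = 0) \<Longrightarrow> p = 0"
  by (rule poly_mapping_eqI) (metis lookup_hcomp lookup_zero)

lemma hcomp_diff_hcomp: "hcomp w n (p - hcomp w k p) = (if n = k then 0 else hcomp w n p)"
  by (auto simp: hcomp_diff hcomp_homogeneous[OF homogeneous_hcomp] hcomp_other[OF homogeneous_hcomp])

lemma homogeneous_mult0: "homogeneous w 0 p \<Longrightarrow> homogeneous w 0 q \<Longrightarrow> homogeneous w 0 (p * q)"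
  using homogeneous_mult[of w 0 p 0 q] by simp

lemma homogeneous_mult1:
  "homogeneous w 1 p \<Longrightarrow> homogeneous w 0 q \<Longrightarrow> homogeneous w 1 (p * q)"
  "homogeneous w 0 p \<Longrightarrow> homogeneous w 1 q \<Longrightarrow> homogeneous w 1 (p * q)"
  using homogeneous_mult[of w 1 p 0 q] homogeneous_mult[of w 0 p 1 q] by simp_all

lemma hcomp_mult0: "homogeneous w 0 a \<Longrightarrow> hcomp w n (a * p) = a * hcomp w n p"
  using hcomp_mult'[of w 0 a n p] by simp

text \<open>The vanishing of \<open>a\<close> in degree \<open>Suc n\<close> removes the
  contribution of \<open>g0\<close>, so only the leading form \<open>g1\<close> is seen.\<close>

lemma hcomp_mult_top:
  assumes "homogeneous w 1 g1" "homogeneous w 0 g0" "hcomp w (int (Suc n)) a = 0"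
  shows "hcomp w (int (Suc n)) ((g1 + g0) * a) = g1 * hcomp w (int n) a"
  using hcomp_mult'[OF assms(1), of "int (Suc n)" a] assms(3)
  by (simp add: distrib_right hcomp_add hcomp_mult0[OF assms(2)])

text \<open>A leading-form argument: since \<open>f1\<close>, \<open>f2\<close> have degree 0, the
  ideal is stable under taking components, and the top component of \<open>a\<close> is multiplied
  by \<open>g1\<close> into it. That component lies in the ideal by \<open>top\<close>; subtracting
  it lowers the degree of \<open>a\<close>.\<close>

lemma nonzero_divisor_top:
  fixes f1 f2 :: "('v, 'k::comm_ring_1) mpoly"
  assumes f: "homogeneous w 0 f1" "homogeneous w 0 f2" and g: "homogeneous w 1 g1" "homogeneous w 0 g0"
    and top: "\<And>a b c. g1 * a = f1 * b + f2 * c \<Longrightarrow> \<exists>d e. a = f1 * d + f2 * e"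
    and eq: "(g1 + g0) * a = f1 * b + f2 * c"
  shows "\<exists>d e. a = f1 * d + f2 * e"
proof -
  have *: "\<exists>d e. a = f1 * d + f2 * e"
    if "\<And>n. n \<ge> N \<Longrightarrow> hcomp w (int n) a = 0" "(g1 + g0) * a = f1 * b + f2 * c" for N a b c
    using that
  proof (induction N arbitrary: a b c)
    case 0
    have "a = 0" by (rule hcomp_all_0[of w], rule "0.prems"(1)) simp
    then have "a = f1 * 0 + f2 * 0" by simp
    then show ?case by blast
  next
    case (Suc N)
    let ?h = "hcomp w (int (Suc N))" and ?t = "hcomp w (int N) a"
    have "?h a = 0" by (rule Suc.prems(1)) simp
    from hcomp_mult_top[OF g this] have "g1 * ?t = ?h ((g1 + g0) * a)" by (rule sym)
    also have "\<dots> = f1 * ?h b + f2 * ?h c" unfolding Suc.prems(2) by (simp only: hcomp_add hcomp_mult0[OF f(1)] hcomp_mult0[OF f(2)])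
    finally have "\<exists>d e. ?t = f1 * d + f2 * e" by (rule top)
    then obtain d e where t: "?t = f1 * d + f2 * e" by blast
    have "(g1 + g0) * (a - ?t) = (f1 * b + f2 * c) - (g1 + g0) * (f1 * d + f2 * e)"
      unfolding t[symmetric] Suc.prems(2)[symmetric] by (rule right_diff_distrib)
    also have "\<dots> = f1 * (b - (g1 + g0) * d) + f2 * (c - (g1 + g0) * e)" by (simp add: algebra_simps)
    finally have eq: "(g1 + g0) * (a - ?t) = f1 * (b - (g1 + g0) * d) + f2 * (c - (g1 + g0) * e)" .
    have "hcomp w (int n) (a - ?t) = 0" if "n \<ge> N" for n
      using Suc.prems(1)[of n] that by (auto simp: hcomp_diff_hcomp)
    from Suc.IH[OF this eq] obtain d' e' where "a - ?t = f1 * d' + f2 * e'" by blast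
    then have "a = (f1 * d' + f2 * e') + ?t" by (rule iffD1[OF diff_eq_eq])
    also have "\<dots> = f1 * (d' + d) + f2 * (e' + e)" unfolding t by (simp add: algebra_simps)
    finally show ?case by blast
  qed
  obtain N where "\<And>n. n > N \<Longrightarrow> hcomp w (int n) a = 0" by (rule hcomp_bounded[of w a]) blast
  then show ?thesis using *[of "Suc N" a b c] eq by simp
qed

text \<open>The regular sequence \<open>x, f\<close> permuted: if \<open>f\<close> remains a
  nonzerodivisor at \<open>x = 0\<close>, then \<open>b\<close> must be divisible by
  \<open>x\<close>, and \<open>x\<close> cancels.\<close>

lemma Var_nonzero_divisor:
  fixes f :: "('v, 'k::comm_ring_1) mpoly"
  assumes inj: "\<And>b. kill x f * b = 0 \<Longrightarrow> b = 0" and eq: "Var x * a = f * b"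
  shows "\<exists>d. a = f * d"
proof -
  have "kill x f * kill x b = 0" using arg_cong[OF eq, of "kill x"] by simp
  then have "kill x b = 0" by (rule inj)
  then obtain d where b: "b = Var x * d" by (rule kill_eq_0E)
  have "Var x * a = Var x * (f * d)" unfolding eq b by (rule mult.left_commute)
  then have "a = f * d" by (rule Var_mult_cancel)
  then show ?thesis by blast
qed

text \<open>At \<open>x = 0\<close> the coefficients \<open>b\<close>, \<open>c\<close> form a
  Koszul syzygy with some factor \<open>e\<close>. Subtracting the Koszul syzygy of
  \<open>f1\<close>, \<open>f2\<close> themselves with the same \<open>e\<close> leaves coefficients
  divisible by \<open>x\<close>.\<close>

lemma Var_nonzero_divisor2:
  fixes f1 f2 :: "('v, 'k::comm_ring_1) mpoly"
  assumes syz: "\<And>b c. kill x f1 * b + kill x f2 * c = 0 \<Longrightarrow> \<exists>e. b = - kill x f2 * e \<and> c = kill x f1 * e"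
    and eq: "Var x * a = f1 * b + f2 * c"
  shows "\<exists>d e. a = f1 * d + f2 * e"
proof -
  have "kill x f1 * kill x b + kill x f2 * kill x c = 0" using arg_cong[OF eq, of "kill x"] by simp
  then obtain e where e: "kill x b = - kill x f2 * e" "kill x c = kill x f1 * e" using syz by blast
  obtain b' where b': "b = kill x b + Var x * b'" by (rule kill_split)
  obtain c' where c': "c = kill x c + Var x * c'" by (rule kill_split)
  obtain f1' where f1': "f1 = kill x f1 + Var x * f1'" by (rule kill_split)
  obtain f2' where f2': "f2 = kill x f2 + Var x * f2'" by (rule kill_split)
  have b: "b + f2 * e = Var x * (b' + f2' * e)"
  proof -
    have "p + g * e = Var x * (p' + g' * e)" if "p = - g0 * e + Var x * p'" "g = g0 + Var x * g'"
      for p p' g g' g0 :: "('v, 'k) mpoly" unfolding that by (simp add: algebra_simps)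
    from this[OF b'[unfolded e] f2'] show ?thesis .
  qed
  have c: "c - f1 * e = Var x * (c' - f1' * e)"
  proof -
    have "p - g * e = Var x * (p' - g' * e)" if "p = g0 * e + Var x * p'" "g = g0 + Var x * g'"
      for p p' g g' g0 :: "('v, 'k) mpoly" unfolding that by (simp add: algebra_simps)
    from this[OF c'[unfolded e] f1'] show ?thesis .
  qed
  have "Var x * a = f1 * (b + f2 * e) + f2 * (c - f1 * e)" unfolding eq by (simp add: algebra_simps)
  also have "\<dots> = Var x * (f1 * (b' + f2' * e) + f2 * (c' - f1' * e))" unfolding b c by (simp add: algebra_simps)
  finally have "a = f1 * (b' + f2' * e) + f2 * (c' - f1' * e)" by (rule Var_mult_cancel)
  then show ?thesis by blast
qed

lemma regular_pair_syz:
  fixes f1 f2 :: "'a::idom"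
  assumes "f1 \<noteq> 0" "\<And>a b. f2 * a = f1 * b \<Longrightarrow> \<exists>d. a = f1 * d" "f1 * b + f2 * c = 0"
  shows "\<exists>e. b = - f2 * e \<and> c = f1 * e"
proof -
  have "f2 * c = f1 * (- b)" using assms(3) by (simp add: eq_neg_iff_add_eq_0 add.commute)
  then obtain e where e: "c = f1 * e" using assms(2) by blast
  then have "f1 * (b + f2 * e) = 0" using assms(3) by (simp add: algebra_simps)
  then have "b = - f2 * e" using assms(1) by (simp add: eq_neg_iff_add_eq_0)
  with e show ?thesis by blast
qed

lemma regular3_Vars:
  fixes x y z :: "'v"
  assumes "x \<noteq> y" "x \<noteq> z" "y \<noteq> z"
  shows "regular3 (Var x :: ('v, 'k::comm_ring_1) mpoly) (Var y) (Var z)"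
  unfolding regular3_def
proof (intro conjI allI impI)
  fix a b c :: "('v, 'k) mpoly"
  show "a = 0" if "Var x * a = 0" using that by (rule Var_mult_eq_0)
  show "\<exists>c. a = Var x * c" if "Var y * a = Var x * b"
  proof -
    have "Var y * kill x a = 0" using arg_cong[OF that, of "kill x"] assms by simp
    then have "kill x a = 0" by (rule Var_mult_eq_0)
    then obtain c where "a = Var x * c" by (rule kill_eq_0E)
    then show ?thesis by blast
  qed
  show "\<exists>d e. a = Var x * d + Var y * e" if "Var z * a = Var x * b + Var y * c"
  proof -
    have "Var z * kill x (kill y a) = 0"
      using arg_cong[OF that, of "\<lambda>p. kill x (kill y p)"] assms by simp
    then have "kill x (kill y a) = 0" by (rule Var_mult_eq_0)
    then obtain d where d: "kill y a = Var x * d" by (rule kill_eq_0E)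
    obtain e where "a = kill y a + Var y * e" by (rule kill_split)
    then show ?thesis unfolding d by blast
  qed
qed

subsection \<open>The quadrics and the determinant\<close>

abbreviation tv :: "rvar \<Rightarrow> (tvar, 'k::field) mpoly" where "tv x \<equiv> Var (Base x)"

definition q1 :: "(tvar, 'k::field) mpoly" where "q1 = tv C23 * tv U11 - tv C13 * tv U12 + tv C12 * tv U13"
definition q2 :: "(tvar, 'k::field) mpoly" where "q2 = tv C23 * tv U21 - tv C13 * tv U22 + tv C12 * tv U23"
definition q3 :: "(tvar, 'k::field) mpoly" where "q3 = tv C23 * tv U31 - tv C13 * tv U32 + tv C12 * tv U33"

definition det_U :: "(tvar, 'k::field) mpoly" where
  "det_U = tv U11 * (tv U22 * tv U33 - tv U23 * tv U32) - tv U12 * (tv U21 * tv U33 - tv U23 * tv U31)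
     + tv U13 * (tv U21 * tv U32 - tv U22 * tv U31)"

lemma nonzero_subst: "subst_hom f p \<noteq> 0 \<Longrightarrow> p \<noteq> 0"
  by (auto simp: subst_0)

text \<open>The linear variables separate the quadrics: \<open>q2\<close> has the leading term
  \<open>- c13 u22\<close> in \<open>u22\<close> and \<open>q3\<close> has \<open>c12 u33\<close> in
  \<open>u33\<close>, variables absent from the preceding quadrics. The leading coefficients are
  handled by setting one variable at a time to zero.\<close>

lemma regular_q: "regular3 (q1 :: (tvar, 'k::field) mpoly) q2 q3"
proof -
  \<comment> \<open>A point at which \<open>q1\<close> and all its specializations listed in
    \<open>nz\<close> take the value 1.\<close>
  let ?f = "\<lambda>x. if x = Base C23 \<or> x = Base U11 then 1 else 0 :: (tvar, 'k) mpoly"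
  let ?q1' = "tv C23 * tv U11 - tv C13 * tv U12 :: (tvar, 'k) mpoly"
  let ?q2' = "tv C23 * tv U21 - tv C13 * tv U22 :: (tvar, 'k) mpoly"
  have nz: "q1 \<noteq> (0 :: (tvar, 'k) mpoly)" "?q1' \<noteq> 0" "tv C23 * tv U11 + tv C12 * tv U13 \<noteq> (0 :: (tvar, 'k) mpoly)"
    "tv C23 * tv U11 \<noteq> (0 :: (tvar, 'k) mpoly)"
    by (rule nonzero_subst[of ?f], simp add: q1_def subst_simps)+
  let ?w22 = "\<lambda>x. if x = Base U22 then 1 else 0 :: nat" and ?w33 = "\<lambda>x. if x = Base U33 then 1 else 0 :: nat"
  have neg: "x * (y * a) = g * (- b)" if e: "- x * y * a = g * b + 0 * c" for x y a g b c :: "(tvar, 'k) mpoly"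
  proof -
    have "x * (y * a) = - (- x * y * a)" by (simp add: mult.assoc)
    also have "\<dots> = g * (- b)" unfolding e by simp
    finally show ?thesis .
  qed
  note hom = homogeneous_add homogeneous_diff homogeneous_uminus homogeneous_mult0 homogeneous_mult1 homogeneous_Var
  have quadric: "\<exists>d. a = f * d"
    if f: "homogeneous ?w22 0 f" "kill (Base C13) f \<noteq> 0" "kill (Base U22) f \<noteq> 0"
      and g: "homogeneous ?w22 0 g" and eq: "(- tv C13 * tv U22 + g) * a = f * b" for a b f g :: "(tvar, 'k) mpoly"
  proof -
    \<comment> \<open>The ideal has one generator here; the second slot of the lemma for two
      generators is filled with 0.\<close>
    have "\<exists>d e. a = f * d + 0 * e"
    proof (rule nonzero_divisor_top[OF f(1) homogeneous_0 _ g])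
      show "homogeneous ?w22 1 (- tv C13 * tv U22 :: (tvar, 'k) mpoly)" by (auto intro!: hom)
      show "(- tv C13 * tv U22 + g) * a = f * b + 0 * b" using eq by simp
      fix a b c :: "(tvar, 'k) mpoly" assume "- tv C13 * tv U22 * a = f * b + 0 * c"
      then have "tv C13 * (tv U22 * a) = f * (- b)" by (rule neg)
      then have "\<exists>d. tv U22 * a = f * d"
        by (rule Var_nonzero_divisor[rotated]) (use f in simp)
      then obtain d where "tv U22 * a = f * d" by blast
      then have "\<exists>d. a = f * d"
        by (rule Var_nonzero_divisor[rotated]) (use f in simp)
      then obtain e where "a = f * e" by blast
      then show "\<exists>d e. a = f * d + 0 * e" by auto
    qed
    then show ?thesis by simp
  qed
  have reg2: "\<exists>d. a = q1 * d" if "q2 * a = q1 * b" for a b :: "(tvar, 'k) mpoly"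
  proof (rule quadric)
    show "homogeneous ?w22 0 (q1 :: (tvar, 'k) mpoly)" "homogeneous ?w22 0 (tv C23 * tv U21 + tv C12 * tv U23 :: (tvar, 'k) mpoly)"
      by (auto simp: q1_def intro!: hom)
    show "kill (Base C13) q1 \<noteq> (0 :: (tvar, 'k) mpoly)" "kill (Base U22) q1 \<noteq> (0 :: (tvar, 'k) mpoly)"
      using nz by (simp_all add: q1_def)
    show "(- tv C13 * tv U22 + (tv C23 * tv U21 + tv C12 * tv U23)) * a = q1 * b"
      using that by (simp add: q2_def algebra_simps)
  qed
  \<comment> \<open>The same pair at \<open>c12 = 0\<close>: since \<open>c12\<close> is a factor of
    the leading term of \<open>q3\<close>, its regularity modulo \<open>q1\<close>,
    \<open>q2\<close> comes down to this.\<close>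
  have reg2': "\<exists>d. a = ?q1' * d" if "?q2' * a = ?q1' * b" for a b :: "(tvar, 'k) mpoly"
  proof (rule quadric)
    show "homogeneous ?w22 0 ?q1'" "homogeneous ?w22 0 (tv C23 * tv U21 :: (tvar, 'k) mpoly)" by (auto intro!: hom)
    show "kill (Base C13) ?q1' \<noteq> 0" "kill (Base U22) ?q1' \<noteq> 0" using nz by simp_all
    show "(- tv C13 * tv U22 + tv C23 * tv U21) * a = ?q1' * b"
      using that by (simp add: algebra_simps)
  qed
  have reg3: "\<exists>d e. a = q1 * d + q2 * e" if "q3 * a = q1 * b + q2 * c" for a b c :: "(tvar, 'k) mpoly"
  proof (rule nonzero_divisor_top)
    show "homogeneous ?w33 0 q1" "homogeneous ?w33 0 q2" "homogeneous ?w33 1 (tv C12 * tv U33)"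
      "homogeneous ?w33 0 (tv C23 * tv U31 - tv C13 * tv U32)"
      by (auto simp: q1_def q2_def intro!: hom)
    show "(tv C12 * tv U33 + (tv C23 * tv U31 - tv C13 * tv U32)) * a = q1 * b + q2 * c"
      using that by (simp add: q3_def algebra_simps)
    fix a b c :: "(tvar, 'k) mpoly" assume "tv C12 * tv U33 * a = q1 * b + q2 * c"
    then have de0: "tv C12 * (tv U33 * a) = q1 * b + q2 * c" by (simp only: mult.assoc)
    have k12: "kill (Base C12) q1 = ?q1'" "kill (Base C12) q2 = ?q2'" by (simp_all add: q1_def q2_def)
    have "\<exists>d e. tv U33 * a = q1 * d + q2 * e"
    proof (rule Var_nonzero_divisor2[OF _ de0])
      show "\<exists>e. b = - kill (Base C12) q2 * e \<and> c = kill (Base C12) q1 * e"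
        if "kill (Base C12) q1 * b + kill (Base C12) q2 * c = 0" for b c :: "(tvar, 'k) mpoly"
        unfolding k12 by (rule regular_pair_syz[OF nz(2) _ that[unfolded k12]]) (rule reg2')
    qed
    then obtain d e where de: "tv U33 * a = q1 * d + q2 * e" by blast
    have k33: "kill (Base U33) q1 = q1" "kill (Base U33) q2 = q2" by (simp_all add: q1_def q2_def)
    show "\<exists>d e. a = q1 * d + q2 * e"
    proof (rule Var_nonzero_divisor2[OF _ de])
      show "\<exists>e. b = - kill (Base U33) q2 * e \<and> c = kill (Base U33) q1 * e"
        if "kill (Base U33) q1 * b + kill (Base U33) q2 * c = 0" for b c :: "(tvar, 'k) mpoly"
        unfolding k33 by (rule regular_pair_syz[OF nz(1) _ that[unfolded k33]]) (rule reg2)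
    qed
  qed
  show ?thesis unfolding regular3_def
  proof (intro conjI allI impI)
    fix a b c :: "(tvar, 'k) mpoly"
    show "a = 0" if "q1 * a = 0" using that nz(1) by simp
    show "\<exists>c. a = q1 * c" if "q2 * a = q1 * b" using that by (rule reg2)
    show "\<exists>d e. a = q1 * d + q2 * e" if "q3 * a = q1 * b + q2 * c" using that by (rule reg3)
  qed
qed

text \<open>\<open>det_U\<close> is nonzero and free of the \<open>c\<close>, so it remains a
  nonzero element of a domain after the three \<open>c\<close> are set to zero.\<close>

lemma det_U_nonzero_divisor:
  fixes a :: "(tvar, 'k::field) mpoly"
  assumes "det_U * a = tv C23 * b1 + tv C13 * b2 + tv C12 * b3"
  obtains d1 d2 d3 where "a = tv C23 * d1 + tv C13 * d2 + tv C12 * d3"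
proof -
  let ?k = "\<lambda>p. kill (Base C23) (kill (Base C13) (kill (Base C12) p))"
  let ?f = "\<lambda>x. if x = Base U11 \<or> x = Base U22 \<or> x = Base U33 then 1 else 0 :: (tvar, 'k) mpoly"
  have nz: "det_U \<noteq> (0 :: (tvar, 'k) mpoly)"
    by (rule nonzero_subst[of ?f]) (simp add: det_U_def subst_simps)
  have kd: "?k det_U = det_U" by (simp add: det_U_def)
  have "?k (det_U * a) = 0" unfolding assms by simp
  then have "det_U * ?k a = 0" by (simp only: kill_simps kd)
  then have "?k a = 0" using nz by simp
  then obtain d1 where d1: "kill (Base C13) (kill (Base C12) a) = tv C23 * d1" by (rule kill_eq_0E)
  obtain d2 where d2: "kill (Base C12) a = kill (Base C13) (kill (Base C12) a) + tv C13 * d2" by (rule kill_split)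
  obtain d3 where d3: "a = kill (Base C12) a + tv C12 * d3" by (rule kill_split)
  show ?thesis by (rule that) (rule d3[unfolded d2[unfolded d1]])
qed

text \<open>Membership of \<open>(b1, b2, b3)\<close> in the image of the transpose of \<^const>\<open>W_mat\<close>.\<close>

definition W_comb :: "(tvar, 'k::field) mpoly \<Rightarrow> (tvar, 'k) mpoly \<Rightarrow> (tvar, 'k) mpoly \<Rightarrow> bool" where
  "W_comb b1 b2 b3 \<longleftrightarrow> (\<exists>e1 e2 e3 f1 f2 f3.
     b1 = tv C12 * e2 - tv C13 * e3 - tv U11 * f1 - tv U21 * f2 - tv U31 * f3 \<and>
     b2 = - tv C12 * e1 + tv C23 * e3 + tv U12 * f1 + tv U22 * f2 + tv U32 * f3 \<and>
     b3 = tv C13 * e1 - tv C23 * e2 - tv U13 * f1 - tv U23 * f2 - tv U33 * f3)"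

lemma W_combI:
  assumes "b1 = tv C12 * e2 - tv C13 * e3 - tv U11 * f1 - tv U21 * f2 - tv U31 * f3"
    and "b2 = - tv C12 * e1 + tv C23 * e3 + tv U12 * f1 + tv U22 * f2 + tv U32 * f3"
    and "b3 = tv C13 * e1 - tv C23 * e2 - tv U13 * f1 - tv U23 * f2 - tv U33 * f3"
  shows "W_comb b1 b2 b3"
  using assms unfolding W_comb_def by blast

lemma W_combE:
  assumes "W_comb b1 b2 b3"
  obtains e1 e2 e3 f1 f2 f3 where "b1 = tv C12 * e2 - tv C13 * e3 - tv U11 * f1 - tv U21 * f2 - tv U31 * f3"
    "b2 = - tv C12 * e1 + tv C23 * e3 + tv U12 * f1 + tv U22 * f2 + tv U32 * f3"
    "b3 = tv C13 * e1 - tv C23 * e2 - tv U13 * f1 - tv U23 * f2 - tv U33 * f3"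
  using assms unfolding W_comb_def by blast

lemma W_comb_add:
  assumes "W_comb a1 a2 a3" "W_comb b1 b2 b3" shows "W_comb (a1 + b1) (a2 + b2) (a3 + b3)"
proof -
  from assms(1) obtain e1 e2 e3 f1 f2 f3 where a: "a1 = tv C12 * e2 - tv C13 * e3 - tv U11 * f1 - tv U21 * f2 - tv U31 * f3"
    "a2 = - tv C12 * e1 + tv C23 * e3 + tv U12 * f1 + tv U22 * f2 + tv U32 * f3"
    "a3 = tv C13 * e1 - tv C23 * e2 - tv U13 * f1 - tv U23 * f2 - tv U33 * f3" by (rule W_combE)
  from assms(2) obtain e1' e2' e3' f1' f2' f3' where b: "b1 = tv C12 * e2' - tv C13 * e3' - tv U11 * f1' - tv U21 * f2' - tv U31 * f3'"
    "b2 = - tv C12 * e1' + tv C23 * e3' + tv U12 * f1' + tv U22 * f2' + tv U32 * f3'"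
    "b3 = tv C13 * e1' - tv C23 * e2' - tv U13 * f1' - tv U23 * f2' - tv U33 * f3'" by (rule W_combE)
  show ?thesis
    by (rule W_combI[of _ "e2 + e2'" "e3 + e3'" "f1 + f1'" "f2 + f2'" "f3 + f3'" _ "e1 + e1'"])
      (simp_all add: a b distrib_left)
qed

section \<open>Membership in the ideal \<open>J\<close> extended to \<open>R[\<tau>]\<close>\<close>

definition in_J :: "(tvar, 'k::field) mpoly \<Rightarrow> bool" where
  "in_J x \<longleftrightarrow> (\<exists>a1 a2 a3 a4. x = q1 * a1 + q2 * a2 + q3 * a3 + det_U * a4)"

lemma in_JI: "x = q1 * a1 + q2 * a2 + q3 * a3 + det_U * a4 \<Longrightarrow> in_J x"
  unfolding in_J_def by blast

lemma in_JE:
  assumes "in_J x" obtains a1 a2 a3 a4 where "x = q1 * a1 + q2 * a2 + q3 * a3 + det_U * a4"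
  using assms unfolding in_J_def by blast

lemma in_J_iff: "in_J x \<longleftrightarrow> x \<in> ideal_gen {q1, q2, q3, det_U}"
proof
  assume "in_J x"
  then show "x \<in> ideal_gen {q1, q2, q3, det_U}"
    by (elim in_JE, simp only:) (intro ideal_gen_add ideal_gen_mult_right ideal_gen_base; simp)
next
  assume "x \<in> ideal_gen {q1, q2, q3, det_U}"
  then obtain a1 y where "x = y + q1 * a1" "y \<in> ideal_gen {q2, q3, det_U}" by (rule ideal_gen_insertE)
  moreover from this(2) obtain a2 a3 a4 where "y = q2 * a2 + q3 * a3 + det_U * a4" by (rule ideal_gen_3E)
  ultimately show "in_J x" by (intro in_JI[of x a1 a2 a3 a4]) (simp add: ac_simps)
qed

lemma in_J_gens: "in_J q1" "in_J q2" "in_J q3" "in_J det_U"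
  unfolding in_J_iff by (rule ideal_gen_base; simp)+

lemma in_J_add: "in_J x \<Longrightarrow> in_J y \<Longrightarrow> in_J (x + y)"
  unfolding in_J_iff by (rule ideal_gen_add)

lemma in_J_diff: "in_J x \<Longrightarrow> in_J y \<Longrightarrow> in_J (x - y)"
  unfolding in_J_iff by (rule ideal_gen_diff)

lemma in_J_uminus: "in_J x \<Longrightarrow> in_J (- x)"
  unfolding in_J_iff by (rule ideal_gen_neg)

lemma in_J_mult: "in_J x \<Longrightarrow> in_J (r * x)"
  unfolding in_J_iff by (rule ideal_gen_mult)

text \<open>Injectivity of the row \<open>(c23, c13, c12)\<close> modulo \<open>J\<close>. The
  coefficient of \<open>det_U\<close> must lie in the ideal of the \<open>c\<close>, and
  \<open>c_jk det_U\<close> is a combination of the quadrics, so \<open>det_U\<close> can be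
  eliminated. What remains is a combination of the rows of \<open>U\<close> plus a syzygy of the
  regular sequence of the \<open>c\<close>: exactly the last three and the first three rows of
  \<open>W_mat\<close>.\<close>

lemma in_J_c_comb:
  fixes b1 b2 b3 :: "(tvar, 'k::field) mpoly"
  assumes "in_J (tv C23 * b1 + tv C13 * b2 + tv C12 * b3)"
  shows "W_comb b1 b2 b3"
proof -
  obtain a1 a2 a3 a4 where a: "tv C23 * b1 + tv C13 * b2 + tv C12 * b3 = q1 * a1 + q2 * a2 + q3 * a3 + det_U * a4"
    using assms unfolding in_J_def by blast
  let ?u = "\<lambda>x y z :: rvar. tv x * a1 + tv y * a2 + tv z * a3"
  \<comment> \<open>Each quadric is a row of \<open>U\<close> times \<open>(c23, -c13, c12)\<close>,
    so the quadrics can be absorbed into the coefficients of the \<open>c\<close>.\<close>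
  have "det_U * a4 = tv C23 * (b1 - ?u U11 U21 U31) + tv C13 * (b2 + ?u U12 U22 U32) + tv C12 * (b3 - ?u U13 U23 U33)"
  proof -
    have "det_U * a4 = (tv C23 * b1 + tv C13 * b2 + tv C12 * b3) - (q1 * a1 + q2 * a2 + q3 * a3)"
      unfolding a by (simp only: add_diff_cancel_left')
    also have "\<dots> = tv C23 * (b1 - ?u U11 U21 U31) + tv C13 * (b2 + ?u U12 U22 U32) + tv C12 * (b3 - ?u U13 U23 U33)"
      unfolding q1_def q2_def q3_def by (simp add: algebra_simps)
    finally show ?thesis .
  qed
  then obtain d1 d2 d3 where d: "a4 = tv C23 * d1 + tv C13 * d2 + tv C12 * d3" by (rule det_U_nonzero_divisor)
  text \<open>Cramer's rule for the system with matrix \<open>U\<close> and right-hand sides \<open>q\<^sub>i\<close>, whose solution is \<open>(c\<^sub>2\<^sub>3, -c\<^sub>1\<^sub>3, c\<^sub>1\<^sub>2)\<close>.\<close>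
  define A1 where "A1 = a1 + (tv U22 * tv U33 - tv U23 * tv U32) * d1
    + (tv U21 * tv U33 - tv U23 * tv U31) * d2 + (tv U21 * tv U32 - tv U22 * tv U31) * d3"
  define A2 where "A2 = a2 - (tv U12 * tv U33 - tv U13 * tv U32) * d1
    - (tv U11 * tv U33 - tv U13 * tv U31) * d2 - (tv U11 * tv U32 - tv U12 * tv U31) * d3"
  define A3 where "A3 = a3 + (tv U12 * tv U23 - tv U13 * tv U22) * d1
    + (tv U11 * tv U23 - tv U13 * tv U21) * d2 + (tv U11 * tv U22 - tv U12 * tv U21) * d3"
  have cramer: "q1 * a1 + q2 * a2 + q3 * a3 + det_U * a4 = q1 * A1 + q2 * A2 + q3 * A3"
    unfolding d A1_def A2_def A3_def q1_def q2_def q3_def det_U_def by (simp add: algebra_simps)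
  let ?v = "\<lambda>x y z :: rvar. tv x * A1 + tv y * A2 + tv z * A3"
  have "(b1 - ?v U11 U21 U31) * tv C23 + (b2 + ?v U12 U22 U32) * tv C13 + (b3 - ?v U13 U23 U33) * tv C12
    = (tv C23 * b1 + tv C13 * b2 + tv C12 * b3) - (q1 * A1 + q2 * A2 + q3 * A3)"
    unfolding q1_def q2_def q3_def by (simp add: algebra_simps)
  also have "\<dots> = 0" unfolding a cramer by simp
  finally have eq0: "(b1 - ?v U11 U21 U31) * tv C23 + (b2 + ?v U12 U22 U32) * tv C13 + (b3 - ?v U13 U23 U33) * tv C12 = 0" .
  have reg: "regular3 (tv C23 :: (tvar, 'k) mpoly) (tv C13) (tv C12)" by (rule regular3_Vars) simp_all
  obtain d e f where k: "b1 - ?v U11 U21 U31 = - d * tv C13 - e * tv C12"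
    "b2 + ?v U12 U22 U32 = d * tv C23 - f * tv C12" "b3 - ?v U13 U23 U33 = e * tv C23 + f * tv C13"
    by (rule regular3_koszul[OF reg eq0])
  show ?thesis
  proof (rule W_combI[of _ "- e" d "- A1" "- A2" "- A3" _ f])
    show "b1 = tv C12 * - e - tv C13 * d - tv U11 * - A1 - tv U21 * - A2 - tv U31 * - A3"
      using k(1) by (simp add: algebra_simps)
    show "b2 = - tv C12 * f + tv C23 * d + tv U12 * - A1 + tv U22 * - A2 + tv U32 * - A3"
      using k(2) by (simp add: algebra_simps)
    show "b3 = tv C13 * f - tv C23 * - e - tv U13 * - A1 - tv U23 * - A2 - tv U33 * - A3"
      using k(3) by (simp add: algebra_simps)
  qed
qed


subsection \<open>Injectivity of the doubling map\<close>

text \<open>The parts of \<open>s1\<close>, \<open>s2\<close>, \<open>s3\<close> free of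
  \<open>T4\<close>, with the minors of \<open>N_mat\<close> rewritten in the variables
  \<open>U\<close>; the column signs of \<open>N_mat\<close> produce the overall minus sign.\<close>

definition r1 :: "(tvar, 'k::field) mpoly" where
  "r1 = - (Var T1 * (tv U22 * tv U33 - tv U23 * tv U32) + Var T2 * (tv U12 * tv U33 - tv U13 * tv U32)
     + Var T3 * (tv U12 * tv U23 - tv U13 * tv U22))"
definition r2 :: "(tvar, 'k::field) mpoly" where
  "r2 = - (Var T1 * (tv U21 * tv U33 - tv U23 * tv U31) + Var T2 * (tv U11 * tv U33 - tv U13 * tv U31)
     + Var T3 * (tv U11 * tv U23 - tv U13 * tv U21))"
definition r3 :: "(tvar, 'k::field) mpoly" where
  "r3 = - (Var T1 * (tv U21 * tv U32 - tv U22 * tv U31) + Var T2 * (tv U11 * tv U32 - tv U12 * tv U31)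
     + Var T3 * (tv U11 * tv U22 - tv U12 * tv U21))"

abbreviation \<sigma>1 :: "(tvar, 'k::field) mpoly" where "\<sigma>1 \<equiv> Var T4 * tv C23 + r1"
abbreviation \<sigma>2 :: "(tvar, 'k::field) mpoly" where "\<sigma>2 \<equiv> Var T4 * tv C13 + r2"
abbreviation \<sigma>3 :: "(tvar, 'k::field) mpoly" where "\<sigma>3 \<equiv> Var T4 * tv C12 + r3"

text \<open>Each row of \<open>W_mat\<close>, paired with
  \<open>(\<sigma>1, \<sigma>2, \<sigma>3)\<close>, lands in \<open>J\<close>: this is why
  \<open>psi1\<close> is well defined on the canonical module.\<close>

lemma sigma_W_rows:
  "- tv C12 * \<sigma>2 + tv C13 * \<sigma>3 = Var T1 * (tv U21 * q3 - tv U31 * q2) + Var T2 * (tv U11 * q3 - tv U31 * q1)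
     + Var T3 * (tv U11 * q2 - tv U21 * q1)"
  "tv C12 * \<sigma>1 - tv C23 * \<sigma>3 = Var T1 * (tv U32 * q2 - tv U22 * q3) + Var T2 * (tv U32 * q1 - tv U12 * q3)
     + Var T3 * (tv U22 * q1 - tv U12 * q2)"
  "- tv C13 * \<sigma>1 + tv C23 * \<sigma>2 = Var T1 * (tv U23 * q3 - tv U33 * q2) + Var T2 * (tv U13 * q3 - tv U33 * q1)
     + Var T3 * (tv U13 * q2 - tv U23 * q1)"
  "- tv U11 * \<sigma>1 + tv U12 * \<sigma>2 - tv U13 * \<sigma>3 = - Var T4 * q1 + Var T1 * det_U"
  "- tv U21 * \<sigma>1 + tv U22 * \<sigma>2 - tv U23 * \<sigma>3 = - Var T4 * q2 - Var T2 * det_U"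
  "- tv U31 * \<sigma>1 + tv U32 * \<sigma>2 - tv U33 * \<sigma>3 = - Var T4 * q3 + Var T3 * det_U"
  unfolding r1_def r2_def r3_def q1_def q2_def q3_def det_U_def by (simp_all add: algebra_simps)

lemma W_comb_in_J:
  assumes "W_comb b1 b2 b3" shows "in_J (\<sigma>1 * b1 + \<sigma>2 * b2 + \<sigma>3 * b3)"
proof -
  from assms obtain e1 e2 e3 f1 f2 f3 where b: "b1 = tv C12 * e2 - tv C13 * e3 - tv U11 * f1 - tv U21 * f2 - tv U31 * f3"
    "b2 = - tv C12 * e1 + tv C23 * e3 + tv U12 * f1 + tv U22 * f2 + tv U32 * f3"
    "b3 = tv C13 * e1 - tv C23 * e2 - tv U13 * f1 - tv U23 * f2 - tv U33 * f3" by (rule W_combE)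
  have "\<sigma>1 * b1 + \<sigma>2 * b2 + \<sigma>3 * b3 =
      e1 * (- tv C12 * \<sigma>2 + tv C13 * \<sigma>3) + e2 * (tv C12 * \<sigma>1 - tv C23 * \<sigma>3) + e3 * (- tv C13 * \<sigma>1 + tv C23 * \<sigma>2)
      + f1 * (- tv U11 * \<sigma>1 + tv U12 * \<sigma>2 - tv U13 * \<sigma>3)
      + f2 * (- tv U21 * \<sigma>1 + tv U22 * \<sigma>2 - tv U23 * \<sigma>3)
      + f3 * (- tv U31 * \<sigma>1 + tv U32 * \<sigma>2 - tv U33 * \<sigma>3)"
    unfolding b by (simp add: algebra_simps)
  then show ?thesis unfolding sigma_W_rows
    by (simp only:) (intro in_J_add in_J_diff in_J_mult in_J_gens)
qed

text \<open>Only the part \<open>\<tau>\<^sub>4 c\<close> of \<open>\<psi>\<^sub>1\<close> matters: it is the top component for the degree in \<open>\<tau>\<^sub>4\<close>, so the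
  top coefficients of a vector that \<open>\<psi>\<^sub>1\<close> maps into \<open>J\<close> are mapped into \<open>J\<close> by \<open>c\<close>.\<close>

lemma in_J_sigma_comb:
  fixes b1 b2 b3 :: "(tvar, 'k::field) mpoly"
  assumes "in_J (\<sigma>1 * b1 + \<sigma>2 * b2 + \<sigma>3 * b3)"
  shows "W_comb b1 b2 b3"
proof -
  let ?w = "\<lambda>x. if x = T4 then 1 else 0 :: nat"
  have *: "W_comb b1 b2 b3"
    if "\<And>n. n \<ge> N \<Longrightarrow> hcomp ?w (int n) b1 = 0 \<and> hcomp ?w (int n) b2 = 0 \<and> hcomp ?w (int n) b3 = 0"
      "in_J (\<sigma>1 * b1 + \<sigma>2 * b2 + \<sigma>3 * b3)" for N and b1 b2 b3 :: "(tvar, 'k) mpoly"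
    using that
  proof (induction N arbitrary: b1 b2 b3)
    case 0
    have "b1 = 0" "b2 = 0" "b3 = 0" by (rule hcomp_all_0[of ?w], use "0.prems"(1) in simp)+
    then show ?case by (intro W_combI[of _ 0 0 0 0 0 _ 0]) simp_all
  next
    case (Suc N)
    let ?h = "hcomp ?w (int (Suc N))" and ?t = "\<lambda>b. hcomp ?w (int N) b"
    from Suc.prems(2) obtain a1 a2 a3 a4 where
      a: "\<sigma>1 * b1 + \<sigma>2 * b2 + \<sigma>3 * b3 = q1 * a1 + q2 * a2 + q3 * a3 + det_U * a4" by (rule in_JE)
    note hom = homogeneous_add homogeneous_diff homogeneous_uminus homogeneous_mult0 homogeneous_mult1 homogeneous_Var
    have h0: "homogeneous ?w 0 (q1 :: (tvar, 'k) mpoly)" "homogeneous ?w 0 (q2 :: (tvar, 'k) mpoly)"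
      "homogeneous ?w 0 (q3 :: (tvar, 'k) mpoly)" "homogeneous ?w 0 (det_U :: (tvar, 'k) mpoly)"
      "homogeneous ?w 0 (r1 :: (tvar, 'k) mpoly)" "homogeneous ?w 0 (r2 :: (tvar, 'k) mpoly)" "homogeneous ?w 0 (r3 :: (tvar, 'k) mpoly)"
      unfolding q1_def q2_def q3_def det_U_def r1_def r2_def r3_def by (intro hom; simp)+
    have h1: "homogeneous ?w 1 (Var T4 * tv x :: (tvar, 'k) mpoly)" for x by (intro homogeneous_mult1(1) homogeneous_Var) simp_all
    have z: "?h b1 = 0" "?h b2 = 0" "?h b3 = 0" using Suc.prems(1)[of "Suc N"] by blast+
    have "Var T4 * (tv C23 * ?t b1 + tv C13 * ?t b2 + tv C12 * ?t b3) = ?h (\<sigma>1 * b1 + \<sigma>2 * b2 + \<sigma>3 * b3)"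
      by (simp only: hcomp_add hcomp_mult_top[OF h1 h0(5) z(1)] hcomp_mult_top[OF h1 h0(6) z(2)]
        hcomp_mult_top[OF h1 h0(7) z(3)] distrib_left mult.assoc)
    also have "\<dots> = q1 * ?h a1 + q2 * ?h a2 + q3 * ?h a3 + det_U * ?h a4"
      unfolding a by (simp only: hcomp_add hcomp_mult0[OF h0(1)] hcomp_mult0[OF h0(2)] hcomp_mult0[OF h0(3)] hcomp_mult0[OF h0(4)])
    finally have eq: "Var T4 * (tv C23 * ?t b1 + tv C13 * ?t b2 + tv C12 * ?t b3) =
       q1 * ?h a1 + q2 * ?h a2 + q3 * ?h a3 + det_U * ?h a4" .
    \<comment> \<open>\<open>T4\<close> is a nonzerodivisor modulo \<open>J\<close>, whose
      generators do not involve it: the values of the coefficients at \<open>T4 = 0\<close>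
      contribute zero and the rest is divisible by \<open>T4\<close>.\<close>
    have "in_J (tv C23 * ?t b1 + tv C13 * ?t b2 + tv C12 * ?t b3)"
    proof -
      let ?k = "kill T4 :: (tvar, 'k) mpoly \<Rightarrow> _"
      have k: "?k q1 = q1" "?k q2 = q2" "?k q3 = q3" "?k det_U = det_U"
        by (simp_all add: q1_def q2_def q3_def det_U_def)
      obtain c1 where c1: "?h a1 = ?k (?h a1) + Var T4 * c1" by (rule kill_split)
      obtain c2 where c2: "?h a2 = ?k (?h a2) + Var T4 * c2" by (rule kill_split)
      obtain c3 where c3: "?h a3 = ?k (?h a3) + Var T4 * c3" by (rule kill_split)
      obtain c4 where c4: "?h a4 = ?k (?h a4) + Var T4 * c4" by (rule kill_split)
      have "?k (Var T4 * (tv C23 * ?t b1 + tv C13 * ?t b2 + tv C12 * ?t b3)) = 0" by simp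
      then have k0: "q1 * ?k (?h a1) + q2 * ?k (?h a2) + q3 * ?k (?h a3) + det_U * ?k (?h a4) = 0"
        unfolding eq by (simp only: kill_simps k)
      have gen: "p1 * x1 + p2 * x2 + p3 * x3 + p4 * x4 = t * (p1 * y1 + p2 * y2 + p3 * y3 + p4 * y4)"
        if "x1 = z1 + t * y1" "x2 = z2 + t * y2" "x3 = z3 + t * y3" "x4 = z4 + t * y4"
          "p1 * z1 + p2 * z2 + p3 * z3 + p4 * z4 = 0"
        for p1 p2 p3 p4 x1 x2 x3 x4 y1 y2 y3 y4 z1 z2 z3 z4 t :: "(tvar, 'k) mpoly"
      proof -
        have "p1 * x1 + p2 * x2 + p3 * x3 + p4 * x4 = (p1 * z1 + p2 * z2 + p3 * z3 + p4 * z4)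
           + t * (p1 * y1 + p2 * y2 + p3 * y3 + p4 * y4)" unfolding that(1-4) by (simp add: algebra_simps)
        then show ?thesis unfolding that(5) by simp
      qed
      have "Var T4 * (tv C23 * ?t b1 + tv C13 * ?t b2 + tv C12 * ?t b3) =
         Var T4 * (q1 * c1 + q2 * c2 + q3 * c3 + det_U * c4)"
        unfolding eq by (rule gen[OF c1 c2 c3 c4 k0])
      then have "tv C23 * ?t b1 + tv C13 * ?t b2 + tv C12 * ?t b3 = q1 * c1 + q2 * c2 + q3 * c3 + det_U * c4"
        by (rule Var_mult_cancel)
      then show ?thesis by (rule in_JI)
    qed
    then have W: "W_comb (?t b1) (?t b2) (?t b3)" by (rule in_J_c_comb)
    \<comment> \<open>Well-definedness of \<open>psi1\<close> allows the top components to be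
      subtracted without leaving \<open>J\<close>, so the induction on the degree bound
      applies.\<close>
    have "\<sigma>1 * (b1 - ?t b1) + \<sigma>2 * (b2 - ?t b2) + \<sigma>3 * (b3 - ?t b3) =
        (\<sigma>1 * b1 + \<sigma>2 * b2 + \<sigma>3 * b3) - (\<sigma>1 * ?t b1 + \<sigma>2 * ?t b2 + \<sigma>3 * ?t b3)"
      by (simp only: right_diff_distrib) (simp only: diff_conv_add_uminus minus_add_distrib add_ac)
    then have "in_J (\<sigma>1 * (b1 - ?t b1) + \<sigma>2 * (b2 - ?t b2) + \<sigma>3 * (b3 - ?t b3))"
      using in_J_diff[OF Suc.prems(2) W_comb_in_J[OF W]] by metis
    moreover have "hcomp ?w (int n) (b1 - ?t b1) = 0 \<and> hcomp ?w (int n) (b2 - ?t b2) = 0 \<and>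
        hcomp ?w (int n) (b3 - ?t b3) = 0" if "n \<ge> N" for n
      using Suc.prems(1)[of n] that by (auto simp: hcomp_diff_hcomp)
    ultimately have "W_comb (b1 - ?t b1) (b2 - ?t b2) (b3 - ?t b3)" using Suc.IH by blast
    from W_comb_add[OF this W] show ?case by simp
  qed
  obtain N1 where N1: "\<And>n. n > N1 \<Longrightarrow> hcomp ?w (int n) b1 = 0" by (rule hcomp_bounded[of ?w b1]) blast
  obtain N2 where N2: "\<And>n. n > N2 \<Longrightarrow> hcomp ?w (int n) b2 = 0" by (rule hcomp_bounded[of ?w b2]) blast
  obtain N3 where N3: "\<And>n. n > N3 \<Longrightarrow> hcomp ?w (int n) b3 = 0" by (rule hcomp_bounded[of ?w b3]) blast
  show ?thesis by (rule *[of "Suc (N1 + N2 + N3)", OF _ assms]) (simp add: N1 N2 N3)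
qed

subsection \<open>Minors\<close>

lemma det_2:
  assumes A: "(A :: 'a::comm_ring_1 mat) \<in> carrier_mat 2 2"
  shows "det A = A $$ (0, 0) * A $$ (1, 1) - A $$ (0, 1) * A $$ (1, 0)"
proof -
  have 1: "det B = B $$ (0, 0)" if "B \<in> carrier_mat 1 1" for B :: "'a mat"
    using laplace_expansion_row[OF that, of 0] that by (simp add: cofactor_def mat_delete_def)
  have d: "mat_delete A 0 j \<in> carrier_mat 1 1" for j using A by (auto simp: mat_delete_def)
  have "det A = (\<Sum>j<2. A $$ (0, j) * cofactor A 0 j)" by (rule laplace_expansion_row[OF A]) simp
  moreover have "cofactor A 0 0 = A $$ (1, 1)" "cofactor A 0 1 = - A $$ (1, 0)"
    using A unfolding cofactor_def 1[OF d] by (simp_all add: mat_delete_def)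
  ultimately show ?thesis by (simp add: numeral_2_eq_2)
qed

lemma det_3:
  assumes A: "(A :: 'a::comm_ring_1 mat) \<in> carrier_mat 3 3"
  shows "det A = A $$ (0, 0) * (A $$ (1, 1) * A $$ (2, 2) - A $$ (1, 2) * A $$ (2, 1))
     - A $$ (0, 1) * (A $$ (1, 0) * A $$ (2, 2) - A $$ (1, 2) * A $$ (2, 0))
     + A $$ (0, 2) * (A $$ (1, 0) * A $$ (2, 1) - A $$ (1, 1) * A $$ (2, 0))"
proof -
  have d: "mat_delete A 0 j \<in> carrier_mat 2 2" for j using A by (auto simp: mat_delete_def)
  have "det A = (\<Sum>j<3. A $$ (0, j) * cofactor A 0 j)" by (rule laplace_expansion_row[OF A]) simp
  then have e: "det A = A $$ (0, 0) * cofactor A 0 0 + A $$ (0, 1) * cofactor A 0 1 + A $$ (0, 2) * cofactor A 0 2"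
    by (simp add: numeral_3_eq_3 numeral_2_eq_2)
  have c: "cofactor A 0 0 = A $$ (1, 1) * A $$ (2, 2) - A $$ (1, 2) * A $$ (2, 1)"
    "cofactor A 0 1 = - (A $$ (1, 0) * A $$ (2, 2) - A $$ (1, 2) * A $$ (2, 0))"
    "cofactor A 0 2 = A $$ (1, 0) * A $$ (2, 1) - A $$ (1, 1) * A $$ (2, 0)"
    using A unfolding cofactor_def det_2[OF d] by (simp_all add: mat_delete_def numeral_2_eq_2)
  show ?thesis unfolding e c by (simp add: algebra_simps)
qed

lemma pick_pair: assumes "a < b" shows "pick {i. i = a \<or> i = b} 0 = a" "pick {i. i = a \<or> i = b} (Suc 0) = b"
proof -
  show a: "pick {i. i = a \<or> i = b} 0 = a"
    using assms by (auto intro!: Least_equality)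
  show "pick {i. i = a \<or> i = b} (Suc 0) = b"
    unfolding pick.simps(2) a using assms by (auto intro!: Least_equality)
qed

lemma pick_triple:
  assumes "a < b" "b < c"
  shows "pick {i. i = a \<or> i = b \<or> i = c} 0 = a" "pick {i. i = a \<or> i = b \<or> i = c} (Suc 0) = b"
    "pick {i. i = a \<or> i = b \<or> i = c} (Suc (Suc 0)) = c"
proof -
  show a: "pick {i. i = a \<or> i = b \<or> i = c} 0 = a"
    using assms by (auto intro!: Least_equality)
  show b: "pick {i. i = a \<or> i = b \<or> i = c} (Suc 0) = b"
    unfolding pick.simps(2) a using assms by (auto intro!: Least_equality)
  show "pick {i. i = a \<or> i = b \<or> i = c} (Suc (Suc 0)) = c"
    unfolding pick.simps(2)[of _ "Suc 0"] b using assms by (auto intro!: Least_equality)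
qed

lemma minor_2:
  fixes A :: "'a::comm_ring_1 mat"
  assumes "a < b" "b < dim_row A" "c < d" "d < dim_col A"
  shows "minor A {Suc a, Suc b} {Suc c, Suc d} = A $$ (a, c) * A $$ (b, d) - A $$ (a, d) * A $$ (b, c)"
proof -
  have "{i. i < dim_row A \<and> i \<in> {i. Suc i \<in> {Suc a, Suc b}}} = {a, b}" "{i. i < dim_col A \<and> i \<in> {i. Suc i \<in> {Suc c, Suc d}}} = {c, d}"
    using assms by auto
  then have card: "card {i. i < dim_row A \<and> i \<in> {i. Suc i \<in> {Suc a, Suc b}}} = 2"
    "card {i. i < dim_col A \<and> i \<in> {i. Suc i \<in> {Suc c, Suc d}}} = 2" using assms by simp_all
  show ?thesis unfolding minor_def
    by (subst det_2) (simp_all only: submatrix_def card index_mat mat_carrier split: prod.splits,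
      simp add: pick_pair[OF assms(1)] pick_pair[OF assms(3)] del: pick.simps)
qed

lemma minor_3:
  fixes A :: "'a::comm_ring_1 mat"
  assumes "a < b" "b < c" "c < dim_row A" "d < e" "e < f" "f < dim_col A"
  shows "minor A {Suc a, Suc b, Suc c} {Suc d, Suc e, Suc f} =
    A $$ (a, d) * (A $$ (b, e) * A $$ (c, f) - A $$ (b, f) * A $$ (c, e))
     - A $$ (a, e) * (A $$ (b, d) * A $$ (c, f) - A $$ (b, f) * A $$ (c, d))
     + A $$ (a, f) * (A $$ (b, d) * A $$ (c, e) - A $$ (b, e) * A $$ (c, d))"
proof -
  have "{i. i < dim_row A \<and> i \<in> {i. Suc i \<in> {Suc a, Suc b, Suc c}}} = {a, b, c}"
    "{i. i < dim_col A \<and> i \<in> {i. Suc i \<in> {Suc d, Suc e, Suc f}}} = {d, e, f}"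
    using assms by auto
  then have card: "card {i. i < dim_row A \<and> i \<in> {i. Suc i \<in> {Suc a, Suc b, Suc c}}} = 3"
    "card {i. i < dim_col A \<and> i \<in> {i. Suc i \<in> {Suc d, Suc e, Suc f}}} = 3" using assms by simp_all
  show ?thesis unfolding minor_def
    by (subst det_3) (simp_all only: submatrix_def card index_mat mat_carrier split: prod.splits,
      simp add: pick_triple[OF assms(1,2)] pick_triple[OF assms(4,5)] numeral_2_eq_2 del: pick.simps)
qed

lemma N_dim [simp]: "dim_row N_mat = 3" "dim_col N_mat = 3"
  by (simp_all add: N_mat_def mat_of_rows_list_def)

lemma N_entries: "N_mat $$ (0, 0) = - Var U11" "N_mat $$ (0, 1) = Var U12" "N_mat $$ (0, 2) = - Var U13"
  "N_mat $$ (1, 0) = - Var U21" "N_mat $$ (1, 1) = Var U22" "N_mat $$ (1, 2) = - Var U23"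
  "N_mat $$ (2, 0) = - Var U31" "N_mat $$ (2, 1) = Var U32" "N_mat $$ (2, 2) = - Var U33"
  by (simp_all add: N_mat_def mat_of_rows_list_def numeral_2_eq_2)

lemma N_minors:
  "minor N_mat {2,3} {2,3} = Var U23 * Var U32 - Var U22 * Var U33"
  "minor N_mat {1,3} {2,3} = Var U13 * Var U32 - Var U12 * Var U33"
  "minor N_mat {1,2} {2,3} = Var U13 * Var U22 - Var U12 * Var U23"
  "minor N_mat {2,3} {1,3} = Var U21 * Var U33 - Var U23 * Var U31"
  "minor N_mat {1,3} {1,3} = Var U11 * Var U33 - Var U13 * Var U31"
  "minor N_mat {1,2} {1,3} = Var U11 * Var U23 - Var U13 * Var U21"
  "minor N_mat {2,3} {1,2} = Var U22 * Var U31 - Var U21 * Var U32"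
  "minor N_mat {1,3} {1,2} = Var U12 * Var U31 - Var U11 * Var U32"
  "minor N_mat {1,2} {1,2} = Var U12 * Var U21 - Var U11 * Var U22"
  "minor N_mat {1,2,3} {1,2,3} = Var U11 * (Var U22 * Var U33 - Var U23 * Var U32)
     - Var U12 * (Var U21 * Var U33 - Var U23 * Var U31) + Var U13 * (Var U21 * Var U32 - Var U22 * Var U31)"
  using minor_2[of 1 2 N_mat 1 2] minor_2[of 0 2 N_mat 1 2] minor_2[of 0 1 N_mat 1 2]
    minor_2[of 1 2 N_mat 0 2] minor_2[of 0 2 N_mat 0 2] minor_2[of 0 1 N_mat 0 2]
    minor_2[of 1 2 N_mat 0 1] minor_2[of 0 2 N_mat 0 1] minor_2[of 0 1 N_mat 0 1]
    minor_3[of 0 1 2 N_mat 0 1 2]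
  by (simp_all add: N_entries[unfolded One_nat_def numeral_2_eq_2 numeral_3_eq_3] numeral_2_eq_2 numeral_3_eq_3 algebra_simps)

lemma M_dim [simp]: "dim_row M_mat = 3" "dim_col M_mat = 4"
  by (simp_all add: M_mat_def mat_of_rows_list_def)

lemma M_entries: "M_mat $$ (0, 0) = Var A11" "M_mat $$ (0, 1) = Var A12" "M_mat $$ (0, 2) = Var A13" "M_mat $$ (0, 3) = Var A14"
  "M_mat $$ (1, 0) = Var A21" "M_mat $$ (1, 1) = Var A22" "M_mat $$ (1, 2) = Var A23" "M_mat $$ (1, 3) = Var A24"
  "M_mat $$ (2, 0) = Var A31" "M_mat $$ (2, 1) = Var A32" "M_mat $$ (2, 2) = Var A33" "M_mat $$ (2, 3) = Var A34"
  by (simp_all add: M_mat_def mat_of_rows_list_def numeral_2_eq_2 numeral_3_eq_3)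

definition det3 :: "'a \<Rightarrow> 'a \<Rightarrow> 'a \<Rightarrow> 'a \<Rightarrow> 'a \<Rightarrow> 'a \<Rightarrow> 'a \<Rightarrow> 'a \<Rightarrow> 'a \<Rightarrow> 'a::comm_ring_1" where
  "det3 a b c d e f g h i = a * (e * i - f * h) - b * (d * i - f * g) + c * (d * h - e * g)"

lemma M_minors:
  "minor M_mat {1,2,3} {2,3,4} = det3 (Var A12) (Var A13) (Var A14) (Var A22) (Var A23) (Var A24) (Var A32) (Var A33) (Var A34)"
  "minor M_mat {1,2,3} {1,3,4} = det3 (Var A11) (Var A13) (Var A14) (Var A21) (Var A23) (Var A24) (Var A31) (Var A33) (Var A34)"
  "minor M_mat {1,2,3} {1,2,4} = det3 (Var A11) (Var A12) (Var A14) (Var A21) (Var A22) (Var A24) (Var A31) (Var A32) (Var A34)"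
  "minor M_mat {1,2,3} {1,2,3} = det3 (Var A11) (Var A12) (Var A13) (Var A21) (Var A22) (Var A23) (Var A31) (Var A32) (Var A33)"
  using minor_3[of 0 1 2 M_mat 1 2 3] minor_3[of 0 1 2 M_mat 0 2 3]
    minor_3[of 0 1 2 M_mat 0 1 3] minor_3[of 0 1 2 M_mat 0 1 2]
  by (simp_all add: M_entries[unfolded One_nat_def numeral_2_eq_2 numeral_3_eq_3] eval_nat_numeral det3_def)

subsection \<open>The Kustin-Miller ideal and the variable \<open>x\<^sub>4\<close>\<close>

lemma s_eq_sigma: "s1 = \<sigma>1" "s2 = \<sigma>2" "s3 = \<sigma>3"
  unfolding s1_def s2_def s3_def N_minors extend_def r1_def r2_def r3_def
  by (simp_all add: subst_simps algebra_simps)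

definition Q1 :: "(kmvar, 'k::field) mpoly" where
  "Q1 = Var A11 * Var X1 + Var A12 * Var X2 + Var A13 * Var X3 + Var A14 * Var X4"
definition Q2 :: "(kmvar, 'k::field) mpoly" where
  "Q2 = Var A21 * Var X1 + Var A22 * Var X2 + Var A23 * Var X3 + Var A24 * Var X4"
definition Q3 :: "(kmvar, 'k::field) mpoly" where
  "Q3 = Var A31 * Var X1 + Var A32 * Var X2 + Var A33 * Var X3 + Var A34 * Var X4"
definition H1 :: "(kmvar, 'k::field) mpoly" where
  "H1 = Var X1 * Var V + det3 (Var A12) (Var A13) (Var A14) (Var A22) (Var A23) (Var A24) (Var A32) (Var A33) (Var A34)"
definition H2 :: "(kmvar, 'k::field) mpoly" where
  "H2 = Var X2 * Var V - det3 (Var A11) (Var A13) (Var A14) (Var A21) (Var A23) (Var A24) (Var A31) (Var A33) (Var A34)"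
definition H3 :: "(kmvar, 'k::field) mpoly" where
  "H3 = Var X3 * Var V + det3 (Var A11) (Var A12) (Var A14) (Var A21) (Var A22) (Var A24) (Var A31) (Var A32) (Var A34)"
definition H4 :: "(kmvar, 'k::field) mpoly" where
  "H4 = Var X4 * Var V - det3 (Var A11) (Var A12) (Var A13) (Var A21) (Var A22) (Var A23) (Var A31) (Var A32) (Var A33)"

lemmas KM_gens_def = Q1_def Q2_def Q3_def H1_def H2_def H3_def H4_def

lemma KM_ideal_gens: "KM_ideal = ideal_gen {Q1, Q2, Q3, H1, H2, H3, H4}"
  unfolding KM_ideal_def KM_gens_def M_minors ..

abbreviation in_Q :: "(kmvar, 'k::field) mpoly \<Rightarrow> bool" where
  "in_Q x \<equiv> x \<in> ideal_gen {Q1, Q2, Q3}"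

lemma in_QI: "x = Q1 * a1 + Q2 * a2 + Q3 * a3 \<Longrightarrow> in_Q x"
  by (simp only:) (intro ideal_gen_add ideal_gen_mult_right ideal_gen_base; simp)

lemma KM_idealE:
  assumes "p \<in> KM_ideal"
  obtains y b1 b2 b3 b4 where "in_Q y" "p = y + (H1 * b1 + H2 * b2 + H3 * b3 + H4 * b4)"
proof -
  have "{Q1, Q2, Q3, H1, H2, H3, H4} = {H4, H3, H2, H1, Q1, Q2, Q3 :: (kmvar, 'a) mpoly}" by blast
  from assms[unfolded KM_ideal_gens this] obtain y b1 b2 b3 b4
    where "in_Q y" "p = y + H1 * b1 + H2 * b2 + H3 * b3 + H4 * b4"
    by (elim ideal_gen_insertE[of _ H4] ideal_gen_insertE[of _ H3] ideal_gen_insertE[of _ H2] ideal_gen_insertE[of _ H1]) blast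
  then show ?thesis by (intro that) (simp_all only: add.assoc)
qed

lemma KM_idealI:
  assumes "in_Q y" shows "y + (H1 * b1 + H2 * b2 + H3 * b3 + H4 * b4) \<in> KM_ideal"
proof -
  have "y \<in> KM_ideal"
    using assms module.span_mono[OF module_mult, of "{Q1, Q2, Q3}" "{Q1, Q2, Q3, H1, H2, H3, H4}"]
    unfolding KM_ideal_gens by blast
  then show ?thesis unfolding KM_ideal_gens
    by (intro ideal_gen_add ideal_gen_mult_right ideal_gen_base[of H1] ideal_gen_base[of H2]
        ideal_gen_base[of H3] ideal_gen_base[of H4]; simp)
qed

section \<open>The substitution and its section\<close>

abbreviation km :: "(kmvar, 'k::field) mpoly \<Rightarrow> (tvar, 'k) mpoly" where
  "km \<equiv> subst_hom KM_subst"

text \<open>Together with \<open>tv_section\<close> this inverts the substitution on the variables.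
  \<open>X4\<close> is not reached, so the composite in the other order is
  \<open>kill X4\<close>.\<close>

primrec rv_section :: "rvar \<Rightarrow> (kmvar, 'k::field) mpoly" where
  "rv_section C12 = - Var X3" | "rv_section C13 = - Var X2" | "rv_section C23 = - Var X1"
| "rv_section U11 = - Var A11" | "rv_section U12 = Var A12" | "rv_section U13 = - Var A13"
| "rv_section U21 = - Var A21" | "rv_section U22 = Var A22" | "rv_section U23 = - Var A23"
| "rv_section U31 = - Var A31" | "rv_section U32 = Var A32" | "rv_section U33 = - Var A33"

primrec tv_section :: "tvar \<Rightarrow> (kmvar, 'k::field) mpoly" where
  "tv_section (Base x) = rv_section x"
| "tv_section T1 = Var A14" | "tv_section T2 = - Var A24" | "tv_section T3 = Var A34" | "tv_section T4 = - Var V"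

abbreviation km_section :: "(tvar, 'k::field) mpoly \<Rightarrow> (kmvar, 'k) mpoly" where
  "km_section \<equiv> subst_hom tv_section"

lemma km_km_section:
  fixes p :: "(tvar, 'k::field) mpoly"
  shows "km (km_section p) = p"
proof -
  have "km (tv_section x) = (Var x :: (tvar, 'k) mpoly)" for x :: tvar
  proof (cases x)
    case (Base y)
    then show ?thesis by (cases y) (simp_all add: subst_simps)
  qed (simp_all add: subst_simps)
  then show ?thesis unfolding subst_subst by (simp add: subst_hom_id)
qed

lemma km_section_km:
  fixes p :: "(kmvar, 'k::field) mpoly"
  shows "km_section (km p) = kill X4 p"
proof -
  have "km_section (KM_subst x) = (if x = X4 then 0 else Var x :: (kmvar, 'k) mpoly)" for x :: kmvar
    by (cases x) (simp_all add: subst_simps)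
  then show ?thesis unfolding subst_subst kill_def by simp
qed

lemma km_split: obtains q where "p = km_section (km p) + Var X4 * q"
  unfolding km_section_km by (rule kill_split)

lemma km_eqD: assumes "km p = km q" obtains r where "p = q + Var X4 * r"
proof -
  have "kill X4 (p - q) = 0" by (simp only: km_section_km[symmetric] subst_diff assms) (simp add: subst_0)
  then obtain r where "p - q = Var X4 * r" by (rule kill_eq_0E)
  then have "p = q + Var X4 * r" unfolding diff_eq_eq by (simp only: add.commute)
  then show ?thesis by (rule that)
qed

lemma km_gens: "km Q1 = q1" "km Q2 = q2" "km Q3 = q3" "km H1 = \<sigma>1" "km H2 = \<sigma>2" "km H3 = \<sigma>3" "km H4 = - det_U"
  unfolding KM_gens_def det3_def q1_def q2_def q3_def r1_def r2_def r3_def det_U_def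
  by (simp_all add: subst_simps algebra_simps)

text \<open>The right-hand sides are determinants with two columns of \<open>M\<close> and the column \<open>M x\<close>. These
  syzygies of the Kustin-Miller generators lift the rows of \<^const>\<open>W_mat\<close> and the relations
  \<open>c\<^sub>j\<^sub>k det U \<in> (q\<^sub>1, q\<^sub>2, q\<^sub>3)\<close>.\<close>

lemma det3_syzygies:
  fixes a11 a12 a13 a14 a21 a22 a23 a24 a31 a32 a33 a34 x1 x2 x3 x4 v :: "'a::comm_ring_1"
  defines "y1 \<equiv> a11 * x1 + a12 * x2 + a13 * x3 + a14 * x4" and "y2 \<equiv> a21 * x1 + a22 * x2 + a23 * x3 + a24 * x4"
    and "y3 \<equiv> a31 * x1 + a32 * x2 + a33 * x3 + a34 * x4"
    and "h1 \<equiv> x1 * v + det3 a12 a13 a14 a22 a23 a24 a32 a33 a34" and "h2 \<equiv> x2 * v - det3 a11 a13 a14 a21 a23 a24 a31 a33 a34"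
    and "h3 \<equiv> x3 * v + det3 a11 a12 a14 a21 a22 a24 a31 a32 a34" and "h4 \<equiv> x4 * v - det3 a11 a12 a13 a21 a22 a23 a31 a32 a33"
  shows "x3 * h2 - x2 * h3 = y1 * (a21 * a34 - a31 * a24) - y2 * (a11 * a34 - a31 * a14) + y3 * (a11 * a24 - a21 * a14)"
    and "x1 * h3 - x3 * h1 = y1 * (a22 * a34 - a32 * a24) - y2 * (a12 * a34 - a32 * a14) + y3 * (a12 * a24 - a22 * a14)"
    and "x2 * h1 - x1 * h2 = y1 * (a23 * a34 - a33 * a24) - y2 * (a13 * a34 - a33 * a14) + y3 * (a13 * a24 - a23 * a14)"
    and "x4 * h1 - x1 * h4 = y1 * (a22 * a33 - a32 * a23) - y2 * (a12 * a33 - a32 * a13) + y3 * (a12 * a23 - a22 * a13)"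
    and "x2 * h4 - x4 * h2 = y1 * (a21 * a33 - a31 * a23) - y2 * (a11 * a33 - a31 * a13) + y3 * (a11 * a23 - a21 * a13)"
    and "x4 * h3 - x3 * h4 = y1 * (a21 * a32 - a31 * a22) - y2 * (a11 * a32 - a31 * a12) + y3 * (a11 * a22 - a21 * a12)"
  unfolding y1_def y2_def y3_def h1_def h2_def h3_def h4_def det3_def by (simp_all add: algebra_simps)

text \<open>Laplace expansion of the vanishing 4 by 4 determinants obtained from the matrix by
  repeating one of its rows.\<close>

lemma det3_syzygies':
  fixes a11 a12 a13 a14 a21 a22 a23 a24 a31 a32 a33 a34 x1 x2 x3 x4 v :: "'a::comm_ring_1"
  defines "h1 \<equiv> x1 * v + det3 a12 a13 a14 a22 a23 a24 a32 a33 a34" and "h2 \<equiv> x2 * v - det3 a11 a13 a14 a21 a23 a24 a31 a33 a34"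
    and "h3 \<equiv> x3 * v + det3 a11 a12 a14 a21 a22 a24 a31 a32 a34" and "h4 \<equiv> x4 * v - det3 a11 a12 a13 a21 a22 a23 a31 a32 a33"
  shows "a11 * h1 + a12 * h2 + a13 * h3 = v * (a11 * x1 + a12 * x2 + a13 * x3 + a14 * x4) - a14 * h4"
    and "a21 * h1 + a22 * h2 + a23 * h3 = v * (a21 * x1 + a22 * x2 + a23 * x3 + a24 * x4) - a24 * h4"
    and "a31 * h1 + a32 * h2 + a33 * h3 = v * (a31 * x1 + a32 * x2 + a33 * x3 + a34 * x4) - a34 * h4"
  unfolding h1_def h2_def h3_def h4_def det3_def by (simp_all add: algebra_simps)
lemma KM_syzygies:
  "Var X3 * H2 - Var X2 * H3 = Q1 * (Var A21 * Var A34 - Var A31 * Var A24) - Q2 * (Var A11 * Var A34 - Var A31 * Var A14)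
     + Q3 * (Var A11 * Var A24 - Var A21 * Var A14)"
  "Var X1 * H3 - Var X3 * H1 = Q1 * (Var A22 * Var A34 - Var A32 * Var A24) - Q2 * (Var A12 * Var A34 - Var A32 * Var A14)
     + Q3 * (Var A12 * Var A24 - Var A22 * Var A14)"
  "Var X2 * H1 - Var X1 * H2 = Q1 * (Var A23 * Var A34 - Var A33 * Var A24) - Q2 * (Var A13 * Var A34 - Var A33 * Var A14)
     + Q3 * (Var A13 * Var A24 - Var A23 * Var A14)"
  "Var A11 * H1 + Var A12 * H2 + Var A13 * H3 = Var V * Q1 - Var A14 * H4"
  "Var A21 * H1 + Var A22 * H2 + Var A23 * H3 = Var V * Q2 - Var A24 * H4"
  "Var A31 * H1 + Var A32 * H2 + Var A33 * H3 = Var V * Q3 - Var A34 * H4"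
  "Var X4 * H1 - Var X1 * H4 = Q1 * (Var A22 * Var A33 - Var A32 * Var A23) - Q2 * (Var A12 * Var A33 - Var A32 * Var A13)
     + Q3 * (Var A12 * Var A23 - Var A22 * Var A13)"
  "Var X2 * H4 - Var X4 * H2 = Q1 * (Var A21 * Var A33 - Var A31 * Var A23) - Q2 * (Var A11 * Var A33 - Var A31 * Var A13)
     + Q3 * (Var A11 * Var A23 - Var A21 * Var A13)"
  "Var X4 * H3 - Var X3 * H4 = Q1 * (Var A21 * Var A32 - Var A31 * Var A22) - Q2 * (Var A11 * Var A32 - Var A31 * Var A12)
     + Q3 * (Var A11 * Var A22 - Var A21 * Var A12)"
  unfolding KM_gens_def by (rule det3_syzygies det3_syzygies')+

lemma in_Q_comb: "in_Q (Q1 * a - Q2 * b + Q3 * c)"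
  by (rule in_QI[of _ a "- b" c]) simp

lemma in_Q_syzygies:
  "in_Q (Var X3 * H2 - Var X2 * H3)" "in_Q (Var X1 * H3 - Var X3 * H1)" "in_Q (Var X2 * H1 - Var X1 * H2)"
  "in_Q (Var X4 * H1 - Var X1 * H4)" "in_Q (Var X2 * H4 - Var X4 * H2)" "in_Q (Var X4 * H3 - Var X3 * H4)"
  unfolding KM_syzygies by (rule in_Q_comb)+

text \<open>Modulo \<open>x\<^sub>4\<close>, a relation \<open>x\<^sub>4 p \<in> I\<^sub>K\<^sub>M\<close> becomes a syzygy of the generators of \<open>I\<close>. Subtracting lifts of
  such syzygies, first for \<open>s\<^sub>1, s\<^sub>2, s\<^sub>3\<close>, then for \<open>det U\<close>, then for \<open>q\<^sub>1, q\<^sub>2, q\<^sub>3\<close>, makes all coefficients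
  divisible by \<open>x\<^sub>4\<close>.\<close>

lemma Var_X4_nonzero_divisor:
  fixes p :: "(kmvar, 'k::field) mpoly"
  assumes "Var X4 * p \<in> KM_ideal" shows "p \<in> KM_ideal"
proof -
  obtain y0 b1 b2 b3 b4 where y0: "in_Q y0" "Var X4 * p = y0 + (H1 * b1 + H2 * b2 + H3 * b3 + H4 * b4)"
    using assms by (rule KM_idealE)
  have kmX4: "km (Var X4 * z) = 0" for z :: "(kmvar, 'k) mpoly" by (simp add: subst_simps)
  have kmQ: "\<exists>a1 a2 a3. km y = q1 * a1 + q2 * a2 + q3 * a3" if "in_Q y" for y :: "(kmvar, 'k) mpoly"
    using that by (elim ideal_gen_3E) (auto simp: subst_simps km_gens)
  \<comment> \<open>The substitution kills \<open>X4\<close> and sends the Kustin-Miller generators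
    to those of \<open>I\<close>, so the relation becomes a syzygy over
    \<open>R[\<tau>]\<close>.\<close>
  have "in_J (\<sigma>1 * km b1 + \<sigma>2 * km b2 + \<sigma>3 * km b3)"
  proof -
    obtain a1 a2 a3 where a: "km y0 = q1 * a1 + q2 * a2 + q3 * a3" using kmQ[OF y0(1)] by blast
    have "0 = (q1 * a1 + q2 * a2 + q3 * a3) + (\<sigma>1 * km b1 + \<sigma>2 * km b2 + \<sigma>3 * km b3 + - det_U * km b4)"
      using arg_cong[OF y0(2), of km] unfolding kmX4 by (simp only: subst_add subst_mult km_gens a)
    then have "\<sigma>1 * km b1 + \<sigma>2 * km b2 + \<sigma>3 * km b3 = q1 * (- a1) + q2 * (- a2) + q3 * (- a3) + det_U * km b4"
    proof -
      have "S = q1 * (- a1) + q2 * (- a2) + q3 * (- a3) + det_U * b"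
        if "0 = (q1 * a1 + q2 * a2 + q3 * a3) + (S + - det_U * b)" for S b
      proof -
        have "S = (q1 * (- a1) + q2 * (- a2) + q3 * (- a3) + det_U * b)
            + ((q1 * a1 + q2 * a2 + q3 * a3) + (S + - det_U * b))" by (simp add: algebra_simps)
        then show ?thesis unfolding that[symmetric] by simp
      qed
      then show ?thesis using \<open>0 = _\<close> by blast
    qed
    then show ?thesis by (rule in_JI)
  qed
  then have "W_comb (km b1) (km b2) (km b3)" by (rule in_J_sigma_comb)
  then obtain e1 e2 e3 f1 f2 f3 where W: "km b1 = tv C12 * e2 - tv C13 * e3 - tv U11 * f1 - tv U21 * f2 - tv U31 * f3"
    "km b2 = - tv C12 * e1 + tv C23 * e3 + tv U12 * f1 + tv U22 * f2 + tv U32 * f3"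
    "km b3 = tv C13 * e1 - tv C23 * e2 - tv U13 * f1 - tv U23 * f2 - tv U33 * f3" by (rule W_combE)
  let ?s = "km_section :: (tvar, 'k) mpoly \<Rightarrow> _"
  let ?E1 = "?s e1" and ?E2 = "?s e2" and ?E3 = "?s e3" and ?F1 = "?s f1" and ?F2 = "?s f2" and ?F3 = "?s f3"
  \<comment> \<open>The combination of rows of \<open>W_mat\<close> is lifted term by term through
    the section; \<open>KM_syzygies\<close> then evaluates
    \<open>H1 w1 + H2 w2 + H3 w3\<close>.\<close>
  define w1 where "w1 = - Var X3 * ?E2 + Var X2 * ?E3 + Var A11 * ?F1 + Var A21 * ?F2 + Var A31 * ?F3"
  define w2 where "w2 = Var X3 * ?E1 - Var X1 * ?E3 + Var A12 * ?F1 + Var A22 * ?F2 + Var A32 * ?F3"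
  define w3 where "w3 = - Var X2 * ?E1 + Var X1 * ?E2 + Var A13 * ?F1 + Var A23 * ?F2 + Var A33 * ?F3"
  have "km b1 = km w1" "km b2 = km w2" "km b3 = km w3"
    unfolding W w1_def w2_def w3_def by (simp_all add: subst_simps km_km_section algebra_simps)
  then obtain g1 g2 g3 where g: "b1 = w1 + Var X4 * g1" "b2 = w2 + Var X4 * g2" "b3 = w3 + Var X4 * g3"
    by (meson km_eqD)
  define y1 where "y1 = ?E1 * (Var X3 * H2 - Var X2 * H3) + ?E2 * (Var X1 * H3 - Var X3 * H1) + ?E3 * (Var X2 * H1 - Var X1 * H2)
     + Var V * (?F1 * Q1 + ?F2 * Q2 + ?F3 * Q3)"
  have y1: "in_Q y1" unfolding y1_def by (intro ideal_gen_add ideal_gen_mult in_Q_syzygies; rule ideal_gen_base; simp)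
  \<comment> \<open>The lifted row syzygies end in a multiple of \<open>H4\<close>, which corrects
    its coefficient.\<close>
  define b where "b = b4 - Var A14 * ?F1 - Var A24 * ?F2 - Var A34 * ?F3"
  have Hw: "H1 * w1 + H2 * w2 + H3 * w3 = y1 - H4 * (Var A14 * ?F1 + Var A24 * ?F2 + Var A34 * ?F3)"
  proof -
    have "H1 * w1 + H2 * w2 + H3 * w3 = ?E1 * (Var X3 * H2 - Var X2 * H3) + ?E2 * (Var X1 * H3 - Var X3 * H1)
       + ?E3 * (Var X2 * H1 - Var X1 * H2) + ?F1 * (Var A11 * H1 + Var A12 * H2 + Var A13 * H3)
       + ?F2 * (Var A21 * H1 + Var A22 * H2 + Var A23 * H3) + ?F3 * (Var A31 * H1 + Var A32 * H2 + Var A33 * H3)"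
      unfolding w1_def w2_def w3_def by (simp add: algebra_simps)
    also have "\<dots> = y1 - H4 * (Var A14 * ?F1 + Var A24 * ?F2 + Var A34 * ?F3)"
      unfolding KM_syzygies(4-6) y1_def by (simp add: algebra_simps)
    finally show ?thesis .
  qed
  have p1: "Var X4 * (p - (H1 * g1 + H2 * g2 + H3 * g3)) = (y0 + y1) + H4 * b"
  proof -
    have "Var X4 * (p - (H1 * g1 + H2 * g2 + H3 * g3)) = Var X4 * p - Var X4 * (H1 * g1 + H2 * g2 + H3 * g3)"
      by (rule right_diff_distrib)
    also have "\<dots> = y0 + (H1 * w1 + H2 * w2 + H3 * w3) + H4 * b4" unfolding y0(2) g by (simp add: algebra_simps)
    also have "\<dots> = (y0 + y1) + H4 * b" unfolding Hw b_def by (simp add: algebra_simps)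
    finally show ?thesis .
  qed
  \<comment> \<open>Now \<open>det_U * km b\<close> lies in the ideal of the quadrics, hence in that
    of the \<open>c\<close>, modulo which \<open>det_U\<close> is regular.\<close>
  have "\<exists>d1 d2 d3. km b = tv C23 * d1 + tv C13 * d2 + tv C12 * d3"
  proof -
    obtain a1 a2 a3 where a: "km (y0 + y1) = q1 * a1 + q2 * a2 + q3 * a3" using kmQ[OF ideal_gen_add[OF y0(1) y1]] by blast
    have "0 = (q1 * a1 + q2 * a2 + q3 * a3) + - det_U * km b"
      using arg_cong[OF p1, of km] unfolding kmX4 by (simp only: subst_add[of _ "y0 + y1"] subst_mult km_gens a)
    then have "det_U * km b = q1 * a1 + q2 * a2 + q3 * a3" by simp
    also have "\<dots> = tv C23 * (tv U11 * a1 + tv U21 * a2 + tv U31 * a3) + tv C13 * - (tv U12 * a1 + tv U22 * a2 + tv U32 * a3)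
        + tv C12 * (tv U13 * a1 + tv U23 * a2 + tv U33 * a3)"
      unfolding q1_def q2_def q3_def by (simp add: algebra_simps)
    finally show ?thesis by (rule det_U_nonzero_divisor) blast
  qed
  then obtain d1 d2 d3 where d: "km b = tv C23 * d1 + tv C13 * d2 + tv C12 * d3" by blast
  let ?D1 = "?s d1" and ?D2 = "?s d2" and ?D3 = "?s d3"
  have "km b = km (- Var X1 * ?D1 - Var X2 * ?D2 - Var X3 * ?D3)"
    unfolding d by (simp add: subst_simps km_km_section)
  then obtain g4 where g4: "b = (- Var X1 * ?D1 - Var X2 * ?D2 - Var X3 * ?D3) + Var X4 * g4" by (rule km_eqD)
  \<comment> \<open>Modulo the \<open>Q\<close>, the products \<open>x_j H4\<close> may be replaced
    by \<open>x_4 H_j\<close>; this makes the coefficient of \<open>H4\<close> divisible by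
    \<open>X4\<close> at the cost of new multiples of \<open>X4\<close> at \<open>H1\<close>,
    \<open>H2\<close>, \<open>H3\<close>.\<close>
  define y2 where "y2 = ?D1 * (Var X4 * H1 - Var X1 * H4) - ?D2 * (Var X2 * H4 - Var X4 * H2) + ?D3 * (Var X4 * H3 - Var X3 * H4)"
  have y2: "in_Q y2" unfolding y2_def by (intro ideal_gen_add ideal_gen_diff ideal_gen_mult in_Q_syzygies)
  have p2: "Var X4 * (p - (H1 * g1 + H2 * g2 + H3 * g3) - (H4 * g4 - H1 * ?D1 - H2 * ?D2 - H3 * ?D3)) = (y0 + y1) + y2"
  proof -
    have "H4 * b = y2 + Var X4 * (H4 * g4 - H1 * ?D1 - H2 * ?D2 - H3 * ?D3)"
      unfolding g4 y2_def by (simp add: algebra_simps)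
    then show ?thesis using p1 by (simp only: right_diff_distrib[of "Var X4" "p - _"]) (simp add: add.assoc)
  qed
  from ideal_gen_add[OF ideal_gen_add[OF y0(1) y1] y2] obtain a1 a2 a3 where a: "(y0 + y1) + y2 = Q1 * a1 + Q2 * a2 + Q3 * a3" by (rule ideal_gen_3E)
  \<comment> \<open>Only the quadrics are left; they form a regular sequence, so their syzygies are
    Koszul and lift verbatim to \<open>Q1\<close>, \<open>Q2\<close>, \<open>Q3\<close>.\<close>
  have "km a1 * q1 + km a2 * q2 + km a3 * q3 = 0"
    using arg_cong[OF p2[unfolded a], of km] unfolding kmX4 by (simp add: subst_simps km_gens mult.commute)
  then obtain d e f where k: "km a1 = - d * q2 - e * q3" "km a2 = d * q1 - f * q3" "km a3 = e * q1 + f * q2"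
    by (rule regular3_koszul[OF regular_q])
  have "km a1 = km (- ?s d * Q2 - ?s e * Q3)" "km a2 = km (?s d * Q1 - ?s f * Q3)" "km a3 = km (?s e * Q1 + ?s f * Q2)"
    unfolding k by (simp_all add: subst_simps km_km_section km_gens)
  then obtain h1 h2 h3 where h: "a1 = (- ?s d * Q2 - ?s e * Q3) + Var X4 * h1" "a2 = (?s d * Q1 - ?s f * Q3) + Var X4 * h2"
    "a3 = (?s e * Q1 + ?s f * Q2) + Var X4 * h3" by (meson km_eqD)
  have "(y0 + y1) + y2 = Var X4 * (Q1 * h1 + Q2 * h2 + Q3 * h3)"
    unfolding a h by (simp add: algebra_simps)
  from Var_mult_cancel[OF p2[unfolded this]]
  have "p = (Q1 * h1 + Q2 * h2 + Q3 * h3) + (H1 * (g1 - ?D1) + H2 * (g2 - ?D2) + H3 * (g3 - ?D3) + H4 * g4)"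
    by (simp add: algebra_simps)
  then show ?thesis using KM_idealI[OF in_QI[OF refl]] by metis
qed

section \<open>The doubling as a specialization of the Kustin-Miller resolution\<close>

subsection \<open>Ideals and presentation matrices after base change\<close>

lemma img0_map_subset:
  fixes A :: "'a::comm_ring_1 mat" and h :: "'a \<Rightarrow> 'b::comm_ring_1"
  assumes h: "comm_ring_hom h" and A: "dim_row A = 1" and p: "p \<in> img0 A"
  shows "h p \<in> img0 (map_mat h A)"
proof -
  interpret comm_ring_hom h by (rule h)
  obtain v where v: "v \<in> carrier_vec (dim_col A)" "p = (A *\<^sub>v v) $ 0" using p by (auto simp: mat_image_def)
  have A': "A \<in> carrier_mat 1 (dim_col A)" by (rule carrier_matI) (use A in simp_all)
  have "h p = map_vec h (A *\<^sub>v v) $ 0" using v(2) A by simp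
  then have "h p = (map_mat h A *\<^sub>v map_vec h v) $ 0" unfolding mult_mat_vec_hom[OF A' v(1)] .
  moreover have "map_mat h A *\<^sub>v map_vec h v \<in> mat_image (map_mat h A)" using v(1) by (intro mat_imageI) simp
  ultimately show ?thesis by blast
qed

lemma img0_map_surj:
  fixes A :: "'a::comm_ring_1 mat" and h :: "'a \<Rightarrow> 'b::comm_ring_1"
  assumes h: "comm_ring_hom h" and A: "dim_row A = 1" and sec: "\<And>p. h (s p) = p"
  shows "img0 (map_mat h A) = h ` img0 A"
proof
  interpret comm_ring_hom h by (rule h)
  have A': "A \<in> carrier_mat 1 (dim_col A)" by (rule carrier_matI) (use A in simp_all)
  show "h ` img0 A \<subseteq> img0 (map_mat h A)" using img0_map_subset[OF h A] by blast
  show "img0 (map_mat h A) \<subseteq> h ` img0 A"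
  proof
    fix q assume "q \<in> img0 (map_mat h A)"
    then obtain v where v: "v \<in> carrier_vec (dim_col A)" "q = (map_mat h A *\<^sub>v v) $ 0"
      by (auto simp: mat_image_def)
    define u where "u = map_vec s v"
    have u: "u \<in> carrier_vec (dim_col A)" "map_vec h u = v" using v(1) by (auto simp: u_def sec)
    have "q = (map_vec h (A *\<^sub>v u)) $ 0" unfolding mult_mat_vec_hom[OF A' u(1)] u(2) v(2) ..
    then have "q = h ((A *\<^sub>v u) $ 0)" using A by simp
    moreover have "A *\<^sub>v u \<in> mat_image A" using u(1) by (intro mat_imageI) simp
    ultimately show "q \<in> h ` img0 A" by blast
  qed
qed

text \<open>The inclusion is turned into a factorization \<open>A = B * X\<close>, which a ring
  homomorphism preserves.\<close>

lemma mat_image_map_mono: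
  fixes A B :: "'a::comm_ring_1 mat" and h :: "'a \<Rightarrow> 'b::comm_ring_1"
  assumes h: "comm_ring_hom h" and A: "A \<in> carrier_mat n m" and B: "B \<in> carrier_mat n k"
    and sub: "mat_image A \<subseteq> mat_image B"
  shows "mat_image (map_mat h A) \<subseteq> mat_image (map_mat h B)"
proof -
  interpret comm_ring_hom h by (rule h)
  have "col A j \<in> mat_image B" if "j < m" for j
  proof -
    have "col A j = A *\<^sub>v unit_vec m j" using A that by (intro eq_vecI) auto
    also have "\<dots> \<in> mat_image A" using A by (intro mat_imageI) simp
    finally show ?thesis using sub by blast
  qed
  then obtain X where X: "X \<in> carrier_mat k m" "A = B * X" using mat_factor[OF A B] by blast
  show ?thesis
  proof
    fix v assume "v \<in> mat_image (map_mat h A)"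
    then obtain u where u: "u \<in> carrier_vec m" "v = map_mat h A *\<^sub>v u" using A by (auto simp: mat_image_def)
    have X': "map_mat h X \<in> carrier_mat k m" and B': "map_mat h B \<in> carrier_mat n k" using X B by auto
    have "v = map_mat h B *\<^sub>v (map_mat h X *\<^sub>v u)"
      unfolding u(2) X(2) mat_hom_mult[OF B X(1)] by (rule assoc_mult_mat_vec[OF B' X' u(1)])
    then show "v \<in> mat_image (map_mat h B)"
      using mat_imageI[of "map_mat h X *\<^sub>v u" "map_mat h B"] mult_mat_vec_carrier[OF X' u(1)] B by simp
  qed
qed

lemma extend_J_gens:
  "extend (Var C23 * Var U11 - Var C13 * Var U12 + Var C12 * Var U13) = q1"
  "extend (Var C23 * Var U21 - Var C13 * Var U22 + Var C12 * Var U23) = q2"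
  "extend (Var C23 * Var U31 - Var C13 * Var U32 + Var C12 * Var U33) = q3"
  "extend (- minor N_mat {1,2,3} {1,2,3}) = - det_U"
  unfolding N_minors by (simp_all add: extend_def subst_simps q1_def q2_def q3_def det_U_def)

lemma in_J_extend:
  assumes "p \<in> J_ideal" shows "in_J (extend p)"
  using assms unfolding J_ideal_def
proof (induction rule: ideal_gen_induct)
  case base
  show ?case by (rule in_JI[of _ 0 0 0 0]) (simp add: extend_0)
next
  case (step c x y)
  have "in_J (extend x)"
    using step(1) by (elim insertE emptyE)
      (simp_all only: extend_J_gens in_J_gens in_J_uminus[OF in_J_gens(4)])
  then show ?case using step(2)
    by (simp only: extend_add) (simp only: extend_def subst_mult, intro in_J_add in_J_mult)
qed

lemma gens_in_extend_J:
  fixes g :: "(tvar, 'k::field) mpoly"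
  assumes "g \<in> {q1, q2, q3, - det_U}" shows "g \<in> extend ` J_ideal"
proof -
  let ?S = "{Var C23 * Var U11 - Var C13 * Var U12 + Var C12 * Var U13,
     Var C23 * Var U21 - Var C13 * Var U22 + Var C12 * Var U23,
     Var C23 * Var U31 - Var C13 * Var U32 + Var C12 * Var U33,
     - minor N_mat {1,2,3} {1,2,3}} :: (rvar, 'k) mpoly set"
  have "extend ` ?S \<subseteq> extend ` J_ideal"
    unfolding J_ideal_def by (rule image_mono) (rule module.span_superset[OF module_mult])
  then show ?thesis using assms unfolding image_insert image_empty extend_J_gens by (rule subsetD)
qed

text \<open>The substitution is onto, so the image of an ideal is an ideal and comparing generators
  suffices.\<close>

lemma km_KM_ideal: "km ` KM_ideal = (I_ideal :: (tvar, 'k::field) mpoly set)"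
proof
  have gens: "km g \<in> I_ideal" if "g \<in> {Q1, Q2, Q3, H1, H2, H3, H4}" for g :: "(kmvar, 'k) mpoly"
    using that unfolding I_ideal_def s_eq_sigma
    by (elim insertE emptyE; simp only: km_gens; intro ideal_gen_base) (use gens_in_extend_J in auto)
  show "km ` KM_ideal \<subseteq> (I_ideal :: (tvar, 'k) mpoly set)"
  proof safe
    fix p :: "(kmvar, 'k) mpoly" assume "p \<in> KM_ideal"
    then show "km p \<in> I_ideal" unfolding KM_ideal_gens
    proof (induction rule: ideal_gen_induct)
      case base
      show ?case unfolding I_ideal_def by (simp add: subst_0 ideal_gen_zero)
    next
      case (step c x y)
      show ?case unfolding subst_add subst_mult
        using gens[OF step(1)] step(2) unfolding I_ideal_def by (intro ideal_gen_add ideal_gen_mult)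
    qed
  qed
  have add: "a + b \<in> km ` KM_ideal" if ab: "a \<in> km ` KM_ideal" "b \<in> km ` KM_ideal" for a b :: "(tvar, 'k) mpoly"
  proof -
    obtain p q where pq: "a = km p" "b = km q" "p \<in> KM_ideal" "q \<in> KM_ideal" using ab by blast
    have "p + q \<in> KM_ideal" using pq(3,4) unfolding KM_ideal_gens by (rule ideal_gen_add)
    then have "km (p + q) \<in> km ` KM_ideal" by (rule imageI)
    then show ?thesis by (simp only: subst_add pq(1,2))
  qed
  have mult: "c * a \<in> km ` KM_ideal" if a: "a \<in> km ` KM_ideal" for a c :: "(tvar, 'k) mpoly"
  proof -
    obtain p where p: "a = km p" "p \<in> KM_ideal" using a by blast
    have "km_section c * p \<in> KM_ideal" using p(2) unfolding KM_ideal_gens by (rule ideal_gen_mult)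
    then have "km (km_section c * p) \<in> km ` KM_ideal" by (rule imageI)
    then show ?thesis by (simp only: subst_mult km_km_section p(1))
  qed
  have g: "km g \<in> km ` KM_ideal" if "g \<in> {Q1, Q2, Q3, H1, H2, H3, H4}" for g :: "(kmvar, 'k) mpoly"
    unfolding KM_ideal_gens by (rule imageI, rule ideal_gen_base[OF that])
  have J: "x \<in> km ` KM_ideal" if x: "in_J x" for x :: "(tvar, 'k) mpoly"
  proof -
    obtain a1 a2 a3 a4 where "x = q1 * a1 + q2 * a2 + q3 * a3 + det_U * a4" using x by (rule in_JE)
    then have "x = a1 * km Q1 + a2 * km Q2 + a3 * km Q3 + (- a4) * km H4"
      unfolding km_gens by (simp add: mult.commute)
    then show ?thesis by (simp only:) (intro add mult g; simp)
  qed
  show "(I_ideal :: (tvar, 'k) mpoly set) \<subseteq> km ` KM_ideal"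
  proof
    fix x :: "(tvar, 'k) mpoly" assume "x \<in> I_ideal"
    then show "x \<in> km ` KM_ideal" unfolding I_ideal_def
    proof (induction rule: ideal_gen_induct)
      case base
      show ?case using J[OF in_JI[of _ 0 0 0 0]] by simp
    next
      case (step c x y)
      have s: "(s1 :: (tvar, 'k) mpoly) \<in> km ` KM_ideal" "(s2 :: (tvar, 'k) mpoly) \<in> km ` KM_ideal" "(s3 :: (tvar, 'k) mpoly) \<in> km ` KM_ideal"
        using g[of H1] g[of H2] g[of H3] unfolding s_eq_sigma km_gens by simp_all
      have "x \<in> km ` KM_ideal"
      proof (cases "x \<in> extend ` J_ideal")
        case True
        then obtain p where "x = extend p" "p \<in> J_ideal" by (elim imageE)
        then show ?thesis using J[OF in_J_extend] by (simp only:)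
      next
        case False
        then have "x = s1 \<or> x = s2 \<or> x = s3" using step(1) by simp
        then show ?thesis by (elim disjE) (simp_all only: s)
      qed
      then show ?case using step(2) by (intro add mult)
    qed
  qed
qed

lemma W_mat_carrier: "W_mat \<in> carrier_mat 6 3"
  by (rule carrier_matI) (simp_all add: W_mat_def mat_of_rows_list_def)

lemma W_entries:
  "W_mat $$ (0, 0) = 0" "W_mat $$ (0, 1) = - Var C12" "W_mat $$ (0, 2) = Var C13"
  "W_mat $$ (1, 0) = Var C12" "W_mat $$ (1, 1) = 0" "W_mat $$ (1, 2) = - Var C23"
  "W_mat $$ (2, 0) = - Var C13" "W_mat $$ (2, 1) = Var C23" "W_mat $$ (2, 2) = 0"
  "W_mat $$ (3, 0) = - Var U11" "W_mat $$ (3, 1) = Var U12" "W_mat $$ (3, 2) = - Var U13"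
  "W_mat $$ (4, 0) = - Var U21" "W_mat $$ (4, 1) = Var U22" "W_mat $$ (4, 2) = - Var U23"
  "W_mat $$ (5, 0) = - Var U31" "W_mat $$ (5, 1) = Var U32" "W_mat $$ (5, 2) = - Var U33"
  by (simp_all add: W_mat_def mat_of_rows_list_def)

text \<open>Stated for any \<open>h\<close>, since it serves both \<open>extend\<close> and the
  identity of \<open>R\<close>.\<close>

lemma mult_W_transpose:
  fixes h :: "(rvar, 'k::field) mpoly \<Rightarrow> 'b::comm_ring_1"
  assumes h: "comm_ring_hom h" and x: "x \<in> carrier_vec 6" and i: "i < 3"
  shows "(map_mat h (transpose_mat W_mat) *\<^sub>v x) $ i =
    h (W_mat $$ (0, i)) * x $ 0 + h (W_mat $$ (1, i)) * x $ 1 + h (W_mat $$ (2, i)) * x $ 2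
    + h (W_mat $$ (3, i)) * x $ 3 + h (W_mat $$ (4, i)) * x $ 4 + h (W_mat $$ (5, i)) * x $ 5"
proof -
  have "(map_mat h (transpose_mat W_mat) *\<^sub>v x) $ i = (\<Sum>j = 0..<6. h (W_mat $$ (j, i)) * x $ j)"
    using W_mat_carrier[where 'a = 'k] x i by (simp add: scalar_prod_def)
  moreover have "(\<Sum>j = 0..<6. f j) = f 0 + f 1 + f 2 + f 3 + f 4 + f 5" for f :: "nat \<Rightarrow> 'b"
    by (simp add: eval_nat_numeral)
  ultimately show ?thesis by simp
qed

lemma W_comb_mat_image:
  fixes y :: "(tvar, 'k::field) mpoly vec"
  assumes W: "W_comb (y $ 0) (y $ 1) (y $ 2)" and y: "y \<in> carrier_vec 3"
  shows "y \<in> mat_image (map_mat extend (transpose_mat W_mat))"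
proof -
  obtain e1 e2 e3 f1 f2 f3 where e: "y $ 0 = tv C12 * e2 - tv C13 * e3 - tv U11 * f1 - tv U21 * f2 - tv U31 * f3"
    "y $ 1 = - tv C12 * e1 + tv C23 * e3 + tv U12 * f1 + tv U22 * f2 + tv U32 * f3"
    "y $ 2 = tv C13 * e1 - tv C23 * e2 - tv U13 * f1 - tv U23 * f2 - tv U33 * f3" using W by (rule W_combE)
  define x where "x = vec 6 (\<lambda>j. [e1, e2, e3, f1, f2, f3] ! j)"
  let ?A = "map_mat extend (transpose_mat W_mat) :: (tvar, 'k) mpoly mat"
  have A: "?A \<in> carrier_mat 3 6" using W_mat_carrier by simp
  have x: "x \<in> carrier_vec 6" by (simp add: x_def)
  have xs: "x $ 0 = e1" "x $ 1 = e2" "x $ 2 = e3" "x $ 3 = f1" "x $ 4 = f2" "x $ 5 = f3"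
    by (simp_all add: x_def)
  have ext: "extend (Var v) = tv v" "extend (- Var v) = - tv v" "extend 0 = 0" for v
    by (simp_all add: extend_def subst_simps)
  note m = mult_W_transpose[OF comm_ring_hom_extend x]
  have i3: "(0::nat) < 3" "(1::nat) < 3" "(2::nat) < 3" by simp_all
  have "y = ?A *\<^sub>v x"
  proof (rule eq_vecI)
    fix i assume "i < dim_vec (?A *\<^sub>v x)"
    then consider "i = 0" | "i = 1" | "i = 2" using A by fastforce
    then show "y $ i = (?A *\<^sub>v x) $ i"
    proof cases
      case 1
      show ?thesis unfolding 1 m[OF i3(1)] W_entries ext xs e by simp
    next
      case 2
      show ?thesis unfolding 2 m[OF i3(2)] W_entries ext xs e by simp
    next
      case 3
      show ?thesis unfolding 3 m[OF i3(3)] W_entries ext xs e by simp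
    qed
  qed (use A y in auto)
  then show ?thesis using mat_imageI[of x ?A] x A by simp
qed

subsection \<open>Gradings\<close>

abbreviation wt :: "tvar \<Rightarrow> nat" where "wt x \<equiv> if x = T4 then 2 else 1"

lemma homogeneous_multI: "homogeneous w a p \<Longrightarrow> homogeneous w b q \<Longrightarrow> a + b = n \<Longrightarrow> homogeneous w n (p * q)"
  using homogeneous_mult by blast

lemma graded_by_base_change:
  fixes C :: "('v, 'k::comm_ring_1) mpoly cpx"
  assumes C: "is_complex C" "graded_by w c C" and f: "\<And>x. homogeneous w' (int (w x)) (f x)"
  shows "graded_by w' c (base_change (subst_hom f) C)"
  unfolding graded_by_def base_change_def
proof (simp, intro allI impI)
  fix i p q assume "p < rk C i" "q < rk C (Suc i)"
  moreover from this have "homogeneous w (c (Suc i) q - c i p) (df C i $$ (p, q))"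
    using C(2) by (simp add: graded_by_def)
  ultimately show "homogeneous w' (c (Suc i) q - c i p) (map_mat (subst_hom f) (df C i) $$ (p, q))"
    using homogeneous_subst_hom[of w' w f, OF f] complexD(3,4)[OF C(1)] by simp
qed

text \<open>Dualizing negates degrees. The free shift \<open>s\<close> is chosen later so that
  \<open>psi1\<close> preserves degrees.\<close>

lemma graded_by_dual:
  assumes C: "is_complex C" "graded_by w c C"
  shows "graded_by w (\<lambda>i q. s - c (n - i) q) (dual n C)"
  unfolding graded_by_def
proof (intro allI impI)
  fix i p q assume pq: "p < rk (dual n C) i" "q < rk (dual n C) (Suc i)"
  then have i: "i < n" by (simp add: dual_rk split: if_splits)
  define j where "j = n - 1 - i"
  have j: "n - i = Suc j" "n - Suc i = j" using i by (simp_all add: j_def)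
  have pq': "p < rk C (Suc j)" "q < rk C j" using pq i j by (simp_all add: dual_rk)
  have "df (dual n C) i $$ (p, q) = df C j $$ (q, p)"
    using i pq' complexD(3,4)[OF C(1)] by (simp add: dual_def j_def)
  moreover have "homogeneous w (c (Suc j) p - c j q) (df C j $$ (q, p))"
    using C(2) pq' by (simp add: graded_by_def)
  ultimately show "homogeneous w (s - c (n - Suc i) q - (s - c (n - i) p)) (df (dual n C) i $$ (p, q))"
    unfolding j by simp
qed

lemma graded_by_cone:
  assumes C: "is_complex C" "graded_by w c C" and D: "is_complex D" "graded_by w d D" and f: "chain_map C D f"
    and hf: "\<And>i p q. p < rk D i \<Longrightarrow> q < rk C i \<Longrightarrow> homogeneous w (c i q - d i p) (f i $$ (p, q))"
  shows "graded_by w (\<lambda>i p. if p < rk D i then d i p else c (i - 1) (p - rk D i)) (cone C D f)"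
  unfolding graded_by_def
proof (intro allI impI)
  fix i p q assume pq: "p < rk (cone C D f) i" "q < rk (cone C D f) (Suc i)"
  have s: "shifted_df C i \<in> carrier_mat (shifted_rk C i) (rk C i)" by (rule shifted_df_carrier[OF C(1)])
  have e: "df (cone C D f) i $$ (p, q) =
    (if p < rk D i then if q < rk D (Suc i) then df D i $$ (p, q) else f i $$ (p, q - rk D (Suc i))
     else if q < rk D (Suc i) then 0 else shifted_df C i $$ (p - rk D i, q - rk D (Suc i)))"
    using pq s complexD(3,4)[OF D(1)] chain_mapD(3,4)[OF f] by (auto simp: df_cone rk_cone)
  have q': "q - rk D (Suc i) < rk C i" if "\<not> q < rk D (Suc i)" using that pq(2) by (simp add: rk_cone)
  have s': "homogeneous w (c i (q - rk D (Suc i)) - c (i - 1) (p - rk D i)) (shifted_df C i $$ (p - rk D i, q - rk D (Suc i)))"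
    if pq': "\<not> p < rk D i" "\<not> q < rk D (Suc i)"
  proof (cases i)
    case 0
    then show ?thesis using pq(1) pq' by (simp add: rk_cone)
  next
    case (Suc j)
    have "p - rk D i < rk C j" using pq(1) pq' Suc by (simp add: rk_cone)
    moreover have "q - rk D (Suc i) < rk C (Suc j)" using q'[OF pq'(2)] Suc by simp
    ultimately show ?thesis using C(2) Suc complexD(3,4)[OF C(1), of j]
      by (simp add: graded_by_def homogeneous_uminus)
  qed
  show "homogeneous w ((if q < rk D (Suc i) then d (Suc i) q else c (Suc i - 1) (q - rk D (Suc i))) -
      (if p < rk D i then d i p else c (i - 1) (p - rk D i))) (df (cone C D f) i $$ (p, q))"
    unfolding e using D(2) hf[OF _ q'] s' pq(2)
    by (auto simp: graded_by_def homogeneous_0)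
qed

lemma homogeneous_psi1:
  assumes "i < 3" shows "homogeneous wt 3 (psi1 $$ (0, i) :: (tvar, 'k::field) mpoly)"
proof -
  have v: "homogeneous wt 1 (tv x :: (tvar, 'k) mpoly)" for x by (rule homogeneous_Var) simp
  have t: "homogeneous wt 2 (Var T4 :: (tvar, 'k) mpoly)" "homogeneous wt 1 (Var T1 :: (tvar, 'k) mpoly)"
    "homogeneous wt 1 (Var T2 :: (tvar, 'k) mpoly)" "homogeneous wt 1 (Var T3 :: (tvar, 'k) mpoly)"
    by (rule homogeneous_Var, simp)+
  have m: "homogeneous wt 2 (tv a * tv b - tv x * tv y :: (tvar, 'k) mpoly)" for a b x y
    by (rule homogeneous_diff; rule homogeneous_multI[OF v v]; simp)
  have c: "homogeneous wt 3 (Var T4 * tv x :: (tvar, 'k) mpoly)" for x by (rule homogeneous_multI[OF t(1) v]) simp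
  have tm: "homogeneous wt 3 (Var T1 * (tv a * tv b - tv x * tv y) :: (tvar, 'k) mpoly)"
    "homogeneous wt 3 (Var T2 * (tv a * tv b - tv x * tv y) :: (tvar, 'k) mpoly)"
    "homogeneous wt 3 (Var T3 * (tv a * tv b - tv x * tv y) :: (tvar, 'k) mpoly)" for a b x y
    by (rule homogeneous_multI[OF t(2) m] homogeneous_multI[OF t(3) m] homogeneous_multI[OF t(4) m]; simp)+
  have "homogeneous wt 3 (\<sigma>1 :: (tvar, 'k) mpoly)" "homogeneous wt 3 (\<sigma>2 :: (tvar, 'k) mpoly)"
    "homogeneous wt 3 (\<sigma>3 :: (tvar, 'k) mpoly)"
    unfolding r1_def r2_def r3_def by (rule homogeneous_add homogeneous_uminus c tm)+
  moreover have "i = 0 \<or> i = 1 \<or> i = 2" using assms by linarith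
  ultimately show ?thesis
    by (auto simp: psi1_def mat_of_rows_list_def s_eq_sigma)
qed

text \<open>The image of a homogeneous matrix is a graded submodule.\<close>

lemma hpart_mat_image:
  assumes A: "A \<in> carrier_mat n m"
    and h: "\<And>p q. p < n \<Longrightarrow> q < m \<Longrightarrow> homogeneous w (c q - a p) (A $$ (p, q))"
    and v: "v \<in> mat_image A"
  shows "vec n (\<lambda>p. hcomp w (t - a p) (v $ p)) \<in> mat_image A"
proof -
  obtain x where x: "x \<in> carrier_vec m" "v = A *\<^sub>v x" using v A by (auto simp: mat_image_def)
  define x' where "x' = vec m (\<lambda>q. hcomp w (t - c q) (x $ q))"
  have "vec n (\<lambda>p. hcomp w (t - a p) (v $ p)) = A *\<^sub>v x'"
  proof (rule eq_vecI)
    fix p assume "p < dim_vec (A *\<^sub>v x')"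
    then have p: "p < n" using A by simp
    have "hcomp w (t - a p) (v $ p) = (\<Sum>q = 0..<m. hcomp w (t - a p) (A $$ (p, q) * x $ q))"
      using p A x by (simp add: scalar_prod_def hcomp_sum)
    also have "\<dots> = (\<Sum>q = 0..<m. A $$ (p, q) * hcomp w (t - c q) (x $ q))"
      using hcomp_mult'[OF h] p by (intro sum.cong) auto
    also have "\<dots> = (A *\<^sub>v x') $ p" using p A by (simp add: x'_def scalar_prod_def)
    finally show "vec n (\<lambda>p. hcomp w (t - a p) (v $ p)) $ p = (A *\<^sub>v x') $ p" using p by simp
  qed (use A in simp)
  then show ?thesis using mat_imageI[of x' A] A by (simp add: x'_def)
qed

text \<open>The degrees of the three generators of the canonical module agree: otherwise the homogeneous
  components of a Koszul column of the transpose of \<^const>\<open>W_mat\<close> would have a single nonzero entry,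
  although all columns sum to zero after \<open>c \<mapsto> 1\<close>, \<open>u \<mapsto> 0\<close>.\<close>

lemma canonical_degrees:
  fixes A :: "(rvar, 'k::field) mpoly mat"
  assumes A: "A \<in> carrier_mat 3 m"
    and h: "\<And>p q. p < 3 \<Longrightarrow> q < m \<Longrightarrow> homogeneous (\<lambda>_. 1) (c q - a p) (A $$ (p, q))"
    and im: "mat_image A = mat_image (transpose_mat W_mat)"
  shows "a 1 = a 0" "a 2 = a 0"
proof -
  let ?W = "transpose_mat W_mat :: (rvar, 'k) mpoly mat"
  have W: "?W \<in> carrier_mat 3 6" using W_mat_carrier by simp
  let ?E = "subst_hom (\<lambda>x. if x \<in> {C12, C13, C23} then 1 else 0) :: (rvar, 'k) mpoly \<Rightarrow> (rvar, 'k) mpoly"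
  have sum0: "?E (v $ 0) + ?E (v $ 1) + ?E (v $ 2) = 0" if "v \<in> mat_image ?W" for v
  proof -
    obtain x where x: "x \<in> carrier_vec 6" "v = ?W *\<^sub>v x" using \<open>v \<in> mat_image ?W\<close> W by (auto simp: mat_image_def)
    have id: "comm_ring_hom (\<lambda>p. p :: (rvar, 'k) mpoly)" by unfold_locales auto
    have mi: "map_mat (\<lambda>p. p) ?W = ?W" by (rule eq_matI) auto
    have m: "(?W *\<^sub>v x) $ i = W_mat $$ (0, i) * x $ 0 + W_mat $$ (1, i) * x $ 1 + W_mat $$ (2, i) * x $ 2
      + W_mat $$ (3, i) * x $ 3 + W_mat $$ (4, i) * x $ 4 + W_mat $$ (5, i) * x $ 5" if "i < 3" for i
      using mult_W_transpose[OF id x(1) that] unfolding mi .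
    have i3: "(0::nat) < 3" "(1::nat) < 3" "(2::nat) < 3" by simp_all
    show ?thesis unfolding x(2) m[OF i3(1)] m[OF i3(2)] m[OF i3(3)] W_entries by (simp add: subst_simps)
  qed
  have col: "col ?W j \<in> mat_image A" if "j < 6" for j
  proof -
    have "col ?W j = ?W *\<^sub>v unit_vec 6 j" using W that by (intro eq_vecI) auto
    then show ?thesis unfolding im using mat_imageI[of "unit_vec 6 j" ?W] W by simp
  qed
  have part: "?E (hcomp (\<lambda>_. 1) (t - a 0) (W_mat $$ (j, 0))) + ?E (hcomp (\<lambda>_. 1) (t - a 1) (W_mat $$ (j, 1)))
      + ?E (hcomp (\<lambda>_. 1) (t - a 2) (W_mat $$ (j, 2))) = 0" if j: "j < 6" for t j
    using sum0[OF hpart_mat_image[OF A h col[OF j], unfolded im, of t]] j W_mat_carrier[where 'a = 'k] by simp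
  have v: "homogeneous (\<lambda>_. 1) 1 (Var x :: (rvar, 'k) mpoly)" for x by (rule homogeneous_Var) simp
  have hv: "hcomp (\<lambda>_. 1) 1 (Var x) = (Var x :: (rvar, 'k) mpoly)"
    "n \<noteq> 1 \<Longrightarrow> hcomp (\<lambda>_. 1) n (Var x) = (0 :: (rvar, 'k) mpoly)" for x n
    using hcomp_homogeneous[OF v] hcomp_other[OF v] by auto
  show "a 2 = a 0"
  proof (rule ccontr)
    assume "a 2 \<noteq> a 0"
    \<comment> \<open>The Koszul column with index 1 has entries \<open>C12\<close>,
      \<open>0\<close>, \<open>- C23\<close>, so its component in degree \<open>a 0 + 1\<close>
      would be \<open>C12\<close> alone. The column with index 2 compares positions 0 and 1 in the
      same way.\<close>
    then show False using part[of 1 "a 0 + 1"] unfolding W_entries by (simp add: hv hcomp_uminus hcomp_0 subst_simps del: One_nat_def)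
  qed
  show "a 1 = a 0"
  proof (rule ccontr)
    assume "a 1 \<noteq> a 0"
    then show False using part[of 2 "a 0 + 1"] unfolding W_entries by (simp add: hv hcomp_uminus hcomp_0 subst_simps del: One_nat_def)
  qed
qed

lemma in_J_sum: "(\<And>j. j \<in> X \<Longrightarrow> in_J (g j)) \<Longrightarrow> in_J (sum g X)"
proof (induction X rule: infinite_finite_induct)
  case (insert x X)
  then show ?case by (simp add: in_J_add)
qed (use in_JI[of 0 0 0 0 0] in simp_all)

lemma in_J_img0:
  fixes A :: "(rvar, 'k::field) mpoly mat"
  assumes A: "dim_row A = 1" "img0 A = J_ideal" and x: "x \<in> img0 (map_mat extend A)"
  shows "in_J x"
proof -
  have e: "in_J (map_mat extend A $$ (0, j))" if j: "j < dim_col A" for j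
  proof -
    have "A $$ (0, j) = (A *\<^sub>v unit_vec (dim_col A) j) $ 0" using A(1) j by simp
    moreover have "A *\<^sub>v unit_vec (dim_col A) j \<in> mat_image A" by (rule mat_imageI) simp
    ultimately have "A $$ (0, j) \<in> img0 A" by blast
    then have "in_J (extend (A $$ (0, j)))" unfolding A(2) by (rule in_J_extend)
    then show ?thesis using A(1) j by simp
  qed
  have "dim_row (map_mat extend A) = 1" "dim_col (map_mat extend A) = dim_col A" using A(1) by simp_all
  from x[unfolded row_image[OF this]] obtain a
    where "x = (\<Sum>j<dim_col A. map_mat extend A $$ (0, j) * a j)" by blast
  then have "x = (\<Sum>j<dim_col A. a j * map_mat extend A $$ (0, j))" by (simp only: mult.commute)
  then show ?thesis by (simp only:) (intro in_J_sum in_J_mult e, simp)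
qed

lemma km_irrelevant:
  fixes p :: "(kmvar, 'k::field) mpoly"
  assumes "p \<in> irrelevant_ideal" shows "km p \<in> irrelevant_ideal"
proof -
  have gen: "KM_subst x \<in> (ideal_gen (range Var) :: (tvar, 'k) mpoly set)" for x
    by (cases x) (simp_all add: ideal_gen_neg ideal_gen_base ideal_gen_zero)
  from assms show ?thesis
    unfolding irrelevant_ideal_def
  proof (induction rule: ideal_gen_induct)
    case base
    show ?case by (simp add: subst_0 ideal_gen_zero)
  next
    case (step c x y)
    have "km x \<in> ideal_gen (range Var)" using step(1) gen by (auto simp: subst_Var)
    then show ?case unfolding subst_add subst_mult using step(2) by (intro ideal_gen_add ideal_gen_mult)
  qed
qed

lemma base_change_simps: "rk (base_change h C) = rk C" "df (base_change h C) i = map_mat h (df C i)"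
  by (simp_all add: base_change_def)

theorem theorem6p2:
  fixes F :: "(rvar, 'k::field) mpoly cpx"
    and \<psi> :: "nat \<Rightarrow> (tvar, 'k) mpoly mat"
    and G :: "(kmvar, 'k) mpoly cpx"
  assumes F_res: "minimal_free_resolution (\<lambda>_. 1) F J_ideal"
    and F_format: "rk F = format [1, 4, 6, 3]"
    and F_canonical: "mat_image (transpose_mat (df F 2)) = mat_image (transpose_mat W_mat)"
    and psi_chain: "chain_map (dual 3 (base_change extend F)) (base_change extend F) \<psi>"
    and psi_lifts: "\<psi> 0 = psi1"
    and G_res: "minimal_free_resolution KM_weight G KM_ideal"
    and G_format: "rk G = format [1, 7, 12, 7, 1]"
  shows "isomorphic_complexes
           (cone (dual 3 (base_change extend F)) (base_change extend F) \<psi>)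
           (base_change (subst_hom KM_subst) G)"
proof -
  let ?F = "base_change extend F" and ?B = "base_change km G"
  let ?D = "dual 3 ?F"
  have F: "is_complex F" "acyclic F" and F0: "img0 (df F 0) = J_ideal" and F_gr: "graded_complex (\<lambda>_. 1) F"
    using F_res by (auto simp: minimal_free_resolution_def free_resolution_def)
  have rkF: "rk F 0 = 1" "rk F 1 = 4" "rk F 2 = 6" "rk F 3 = 3" "\<And>i. i > 3 \<Longrightarrow> rk F i = 0"
    by (simp_all add: F_format format_def numeral_2_eq_2 numeral_3_eq_3)
  have Fc: "is_complex ?F" by (rule is_complex_base_change[OF comm_ring_hom_extend F(1)])
  have Fa: "acyclic ?F" by (rule acyclic_extend[OF F])
  have Dc: "is_complex ?D" by (rule is_complex_dual[OF Fc])
  have dF0: "dim_row (df F 0) = 1" using complexD(3)[OF F(1), of 0] rkF by simp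
  have q: "g \<in> img0 (df ?F 0)" if "g \<in> {q1, q2, q3, - det_U}" for g
    using gens_in_extend_J[OF that] img0_map_subset[OF comm_ring_hom_extend dF0]
    unfolding F0 base_change_simps by blast
  have Da: "acyclic ?D"
    by (rule acyclic_dual[OF Fc Fa _ regular_q]) (use rkF q in \<open>auto simp: base_change_simps\<close>)
  have D0: "df ?D 0 = map_mat extend (transpose_mat (df F 2))"
    by (rule eq_matI) (auto simp: dual_def base_change_simps numeral_2_eq_2)
  have dF2: "transpose_mat (df F 2) \<in> carrier_mat 3 6"
    using complexD(1)[OF F(1), of 2] rkF by (simp add: numeral_3_eq_3[symmetric])
  have inj: "y \<in> mat_image (df ?D 0)" if y: "y \<in> carrier_vec (rk ?D 0)" "psi1 *\<^sub>v y \<in> mat_image (df ?F 0)" for y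
  proof -
    have y3: "y \<in> carrier_vec 3" using y(1) rkF by (simp add: dual_rk base_change_simps)
    have "in_J ((psi1 *\<^sub>v y) $ 0)"
      by (rule in_J_img0[OF dF0 F0]) (use y(2) in \<open>simp add: base_change_simps\<close>)
    moreover have "(psi1 *\<^sub>v y) $ 0 = \<sigma>1 * y $ 0 + \<sigma>2 * y $ 1 + \<sigma>3 * y $ 2"
      using y3 by (simp add: psi1_def mat_of_rows_list_def scalar_prod_def s_eq_sigma numeral_3_eq_3 numeral_2_eq_2)
    ultimately have "W_comb (y $ 0) (y $ 1) (y $ 2)" using in_J_sigma_comb by simp
    then have "y \<in> mat_image (map_mat extend (transpose_mat W_mat))" by (rule W_comb_mat_image[OF _ y3])
    also have "\<dots> \<subseteq> mat_image (df ?D 0)"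
      unfolding D0 by (rule mat_image_map_mono[OF comm_ring_hom_extend _ dF2])
        (use W_mat_carrier F_canonical in auto)
    finally show ?thesis .
  qed
  obtain b where b: "graded_by (\<lambda>_. 1) b F" using F_gr unfolding graded_complex_def graded_by_def by blast
  have b3: "b 3 q = b 3 0" if "q < 3" for q
  proof -
    \<comment> \<open>Transposing negates degrees: rows carry \<open>- b 3\<close> and columns
      \<open>- b 2\<close>.\<close>
    have h: "homogeneous (\<lambda>_. 1) (- b 2 q - - b 3 p) (transpose_mat (df F 2) $$ (p, q))" if "p < 3" "q < 6" for p q
      using b[unfolded graded_by_def, rule_format, of q 2 p] that rkF dF2 complexD(3,4)[OF F(1), of 2]
      by (simp add: numeral_3_eq_3[symmetric])
    have "- b 3 1 = - b 3 0" "- b 3 2 = - b 3 0"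
      using canonical_degrees[OF dF2 h F_canonical] by blast+
    moreover have "q = 0 \<or> q = 1 \<or> q = 2" using that by linarith
    ultimately show ?thesis by auto
  qed
  have Fg: "graded_by wt b ?F"
    unfolding extend_def by (rule graded_by_base_change[OF F(1) b]) (simp add: homogeneous_Var)
  \<comment> \<open>The shift is chosen so that \<open>c 0 q - b 0 0 = 3\<close>, the degree of
    \<open>s1\<close>, \<open>s2\<close>, \<open>s3\<close>; a single shift works because
    \<open>b 3\<close> is constant.\<close>
  define c where "c i q = 3 + b 3 0 + b 0 0 - b (3 - i) q" for i q
  have Dg: "graded_by wt c ?D" unfolding c_def by (rule graded_by_dual[OF Fc Fg])
  define \<phi> where "\<phi> i = hpart wt (b i) (c i) (\<psi> i)" for i
  have \<phi>: "chain_map ?D ?F \<phi>" unfolding \<phi>_def by (rule chain_map_hpart[OF Dc Dg Fc Fg psi_chain])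
  have psi1_carrier: "(psi1 :: (tvar, 'k) mpoly mat) \<in> carrier_mat 1 3" by (rule carrier_matI) (simp_all add: psi1_def mat_of_rows_list_def)
  have \<phi>0: "\<phi> 0 = psi1"
  proof (rule eq_matI)
    fix p q assume "p < dim_row (psi1 :: (tvar, 'k) mpoly mat)" "q < dim_col (psi1 :: (tvar, 'k) mpoly mat)"
    then have pq: "p = 0" "q < 3" using carrier_matD[OF psi1_carrier] by auto
    have "c 0 q - b 0 0 = 3" using b3[OF pq(2)] by (simp add: c_def)
    then show "\<phi> 0 $$ (p, q) = psi1 $$ (p, q)"
      unfolding \<phi>_def psi_lifts hpart_def using pq carrier_matD[OF psi1_carrier] hcomp_homogeneous[OF homogeneous_psi1]
      by simp
  qed (simp_all add: \<phi>_def psi_lifts hpart_def)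
  have e: "chain_map ?D ?F (\<lambda>i. \<psi> i - \<phi> i)" by (rule chain_map_diff[OF Dc Fc psi_chain \<phi>])
  have e0: "\<psi> 0 - \<phi> 0 = df ?F 0 * 0\<^sub>m (rk ?F 1) (rk ?D 0)"
  proof -
    have "psi1 - psi1 = (0\<^sub>m 1 3 :: (tvar, 'k) mpoly mat)" by (rule minus_r_inv_mat[OF psi1_carrier])
    moreover have "df ?F 0 * 0\<^sub>m (rk ?F 1) (rk ?D 0) = 0\<^sub>m 1 3"
      using complexD(1)[OF Fc, of 0] rkF by (simp add: dual_rk base_change_simps)
    ultimately show ?thesis unfolding psi_lifts \<phi>0 by simp
  qed
  \<comment> \<open>\<open>\<psi>\<close> and \<open>\<phi>\<close> agree in degree 0, so the
    homotopy between them may start with zero.\<close>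
  obtain h where h: "\<And>i. h i \<in> carrier_mat (rk ?F (Suc i)) (rk ?D i)" "h 0 = 0\<^sub>m (rk ?F 1) (rk ?D 0)"
    "\<And>i. \<psi> (Suc i) - \<phi> (Suc i) = df ?F (Suc i) * h (Suc i) + h i * df ?D i"
    by (rule chain_map_homotopy[OF Dc Fc Fa e zero_carrier_mat e0]) (rule that)
  let ?K = "cone ?D ?F \<psi>" and ?L = "cone ?D ?F \<phi>"
  have iso1: "isomorphic_complexes ?K ?L"
    by (rule isomorphic_cones_homotopic[OF Dc Fc psi_chain \<phi> h(1) _ h(3)]) (simp only: h(2) e0)
  have Lc: "is_complex ?L" by (rule is_complex_cone[OF Dc Fc \<phi>])
  have La: "acyclic ?L"
    by (rule acyclic_cone[OF Dc Da Fc Fa \<phi>]) (use inj in \<open>simp only: \<phi>0\<close>)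
  have Lg: "graded_by wt (\<lambda>i p. if p < rk ?F i then b i p else c (i - 1) (p - rk ?F i)) ?L"
  proof (rule graded_by_cone[OF Dc Dg Fc Fg \<phi>])
    fix i p q assume "p < rk ?F i" "q < rk ?D i"
    then show "homogeneous wt (c i q - b i p) (\<phi> i $$ (p, q))"
      using chain_mapD(3,4)[OF psi_chain, of i] by (simp add: \<phi>_def hpart_def homogeneous_hcomp)
  qed
  have L0: "img0 (df ?L 0) = I_ideal" by (rule cone_H0[OF F(1) rkF(1,4) F0 \<phi> \<phi>0])

  have G: "is_complex G" "acyclic G" "rk G 0 = 1" and G0: "img0 (df G 0) = KM_ideal"
    and G_gr: "graded_complex KM_weight G" and G_min: "\<And>i. elements_mat (df G i) \<subseteq> irrelevant_ideal"
    using G_res by (auto simp: minimal_free_resolution_def free_resolution_def)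
  have Bc: "is_complex ?B" by (rule is_complex_base_change[OF comm_ring_hom_subst_hom G(1)])
  have Ba: "acyclic ?B"
  proof (rule acyclic_quotient[OF comm_ring_hom_subst_hom G, where s = km_section and x = "Var X4"])
    show "km (km_section p) = p" for p :: "(tvar, 'k) mpoly" by (rule km_km_section)
    show "\<exists>q. p = Var X4 * q" if "km p = 0" for p :: "(kmvar, 'k) mpoly"
      using km_split[of p] that by (auto simp: subst_0)
    show "km (Var X4) = (0 :: (tvar, 'k) mpoly)" by (simp add: subst_Var)
    show "p = 0" if "Var X4 * p = 0" for p :: "(kmvar, 'k) mpoly" using that by (rule Var_mult_eq_0)
    show "p \<in> img0 (df G 0)" if "Var X4 * p \<in> img0 (df G 0)" for p
      using that unfolding G0 by (rule Var_X4_nonzero_divisor)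
  qed
  obtain d where d: "graded_by KM_weight d G" using G_gr unfolding graded_complex_def graded_by_def by blast
  have Bg: "graded_by wt d ?B"
  proof (rule graded_by_base_change[OF G(1) d])
    show "homogeneous wt (int (KM_weight x)) (KM_subst x :: (tvar, 'k) mpoly)" for x
      by (cases x) (simp_all add: KM_weight_def homogeneous_uminus homogeneous_Var homogeneous_0)
  qed
  have B_min: "elements_mat (df ?B i) \<subseteq> irrelevant_ideal" for i
    using G_min[of i] by (auto simp: base_change_simps elements_mat_def intro!: km_irrelevant)
  have B0: "img0 (df ?B 0) = I_ideal"
    unfolding base_change_simps km_KM_ideal[symmetric] G0[symmetric]
    by (rule img0_map_surj[OF comm_ring_hom_subst_hom _ km_km_section])
      (use complexD(3)[OF G(1), of 0] G(3) in simp)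
  have rk: "rk ?L i = rk ?B i" for i
  proof -
    \<comment> \<open>The cone has ranks \<open>1\<close>, \<open>4 + 3\<close>,
      \<open>6 + 6\<close>, \<open>3 + 4\<close>, \<open>0 + 1\<close>.\<close>
    have rkG: "rk G 0 = 1" "rk G 1 = 7" "rk G 2 = 12" "rk G 3 = 7" "rk G 4 = 1" "\<And>i. i > 4 \<Longrightarrow> rk G i = 0"
      by (simp_all add: G_format format_def numeral_2_eq_2 numeral_3_eq_3)
    have "i = 0 \<or> i = 1 \<or> i = 2 \<or> i = 3 \<or> i = 4 \<or> i > 4" by linarith
    then show ?thesis
      using rkF rkG rkF(3)[unfolded numeral_2_eq_2] rkG(3)[unfolded numeral_2_eq_2]
      by (auto simp: rk_cone dual_rk base_change_simps split: nat.splits)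
  qed
  have iso2: "isomorphic_complexes ?L ?B"
    by (rule isomorphic_resolutions[OF Lc La Lg Bc Ba Bg _ B_min rk _ trans[OF L0 B0[symmetric]]])
      (simp_all add: base_change_simps G(3))
  show ?thesis
    by (rule isomorphic_complexes_trans[OF is_complex_cone[OF Dc Fc psi_chain] Lc Bc iso1 iso2])
qed

end
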